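(* Let $d\ge1$, let $V$ be a solid harmonic polynomial on $\mathbb R^d$ of degree $l\in\{0,1,2,\dots\}$, and put $\vartheta=\frac d2+l$. Let $p>-1$ be a constant and let $u(x)=V(x)\big[(1-|x|^2)^p\big]_+$ for $x\in\mathbb R^d$. Let $\alpha:\mathbb R^d\to(0,2]$ be Hölder continuous with $\inf\alpha>0$. Then for all $x$ with $|x|<1$, $$(-\Delta)^{\alpha(x)/2}u(x)=\frac{2^{\alpha(x)}\,\Gamma(p+1)\,\Gamma\big(\vartheta+\frac{\alpha(x)}2\big)}{\Gamma(\vartheta)\,\Gamma\big(p+1-\frac{\alpha(x)}2\big)}\,V(x)\,{}_2F_1\Big(\vartheta+\tfrac{\alpha(x)}2,\ -p+\tfrac{\alpha(x)}2;\ \vartheta;\ |x|^2\Big).$$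
   Context: Notation: $\big[(1-|x|^2)^p\big]_+$ equals $(1-|x|^2)^p$ for $|x|<1$ and $0$ otherwise, so $u$ is supported on the closed unit ball. The factor $1/\Gamma(z)$ is read as $0$ when $z$ is a nonpositive integer. Variable-order Laplacian. At a point $x$ with $0<\alpha(x)<2$, $$(-\Delta)^{\alpha(x)/2}u(x)=C_{d,\alpha(x)}\ \mathrm{P.V.}\int_{\mathbb R^d}\frac{u(x)-u(y)}{|x-y|^{d+\alpha(x)}}\,dy,\qquad C_{d,\alpha(x)}=\frac{2^{\alpha(x)-1}\alpha(x)\,\Gamma\big(\frac{\alpha(x)+d}{2}\big)}{\sqrt{\pi^d}\,\Gamma\big(1-\frac{\alpha(x)}2\big)},$$ with P.V. the principal value; at a point with $\alpha(x)=2$ it is the classical negative Laplacian $-\Delta u(x)=-\sum_{i=1}^d\partial_{x^{(i)}}^2u(x)$. A solid harmonic polynomial $V$ of degree $l$ is a polynomial on $\mathbb R^d$, homogeneous of degree $l$, with $\Delta V=0$. The Gauss hypergeometric function is ${}_2F_1(a,b;c;r)=\sum_{n=0}^\infty\frac{(a)_n(b)_n}{(c)_n}\frac{r^n}{n!}$ for $|r|<1$, where $(c)_0=1$, $(c)_n=c(c+1)\cdots(c+n-1)$. *)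

theory Defs
  imports "HOL-Analysis.Analysis"
begin

text \<open>
  The space \<open>\<real>\<^sup>d\<close> is an arbitrary type \<open>'a :: euclidean_space\<close>, with \<open>d = DIM('a) \<ge> 1\<close> and coordinate
  directions \<open>b \<in> Basis\<close>.
\<close>

section \<open>Classical Laplacian\<close>

definition partial_deriv :: "'a::euclidean_space \<Rightarrow> ('a \<Rightarrow> real) \<Rightarrow> 'a \<Rightarrow> real" where
  "partial_deriv b f x = deriv (\<lambda>t. f (x + t *\<^sub>R b)) 0"

definition laplacian :: "('a::euclidean_space \<Rightarrow> real) \<Rightarrow> 'a \<Rightarrow> real" where
  "laplacian f x = (\<Sum>b\<in>Basis. partial_deriv b (partial_deriv b f) x)"

text \<open>
  As \<open>deriv\<close> is total, existence of the pure second partial derivatives at a point is a separate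
  condition: the first partial derivatives exist near \<open>x\<close> and are partially differentiable at \<open>x\<close>.
\<close>

definition laplacian_exists :: "('a::euclidean_space \<Rightarrow> real) \<Rightarrow> 'a \<Rightarrow> bool" where
  "laplacian_exists f x \<longleftrightarrow>
     (\<forall>b\<in>Basis.
        (\<forall>\<^sub>F y in nhds x. (\<lambda>t. f (y + t *\<^sub>R b)) field_differentiable (at 0)) \<and>
        (\<lambda>t. partial_deriv b f (x + t *\<^sub>R b)) field_differentiable (at 0))"

text \<open>For polynomial functions over \<open>\<real>\<close>, homogeneity is expressed by scaling; zero is allowed.\<close>

definition solid_harmonic :: "nat \<Rightarrow> ('a::euclidean_space \<Rightarrow> real) \<Rightarrow> bool" where
  "solid_harmonic l V \<longleftrightarrow>
     real_polynomial_function V \<and>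
     (\<forall>c x. V (c *\<^sub>R x) = c ^ l * V x) \<and>
     (\<forall>x. laplacian V x = 0)"

section \<open>Variable-order fractional Laplacian\<close>

text \<open>
  The truncated integrals are absolutely convergent Lebesgue integrals over the complement of the
  ball of radius \<open>\<epsilon>\<close> around the singularity \<open>x\<close>.
\<close>

definition has_principal_value :: "('a::euclidean_space \<Rightarrow> real) \<Rightarrow> 'a \<Rightarrow> real \<Rightarrow> bool" where
  "has_principal_value f x I \<longleftrightarrow>
     (\<forall>\<epsilon>>0. set_integrable lborel {y. \<epsilon> < dist x y} f) \<and>
     ((\<lambda>\<epsilon>. LINT y:{y. \<epsilon> < dist x y}|lborel. f y) \<longlongrightarrow> I) (at_right 0)"

definition principal_value :: "('a::euclidean_space \<Rightarrow> real) \<Rightarrow> 'a \<Rightarrow> real" where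
  "principal_value f x = Lim (at_right 0) (\<lambda>\<epsilon>. LINT y:{y. \<epsilon> < dist x y}|lborel. f y)"

lemma principal_value_eqI: "has_principal_value f x I \<Longrightarrow> principal_value f x = I"
  unfolding has_principal_value_def principal_value_def by (auto intro: tendsto_Lim)

definition frac_lap_const :: "nat \<Rightarrow> real \<Rightarrow> real" where
  "frac_lap_const d a =
     2 powr (a - 1) * a * Gamma ((a + real d) / 2) / (sqrt (pi ^ d) * Gamma (1 - a / 2))"

definition frac_lap_integrand :: "real \<Rightarrow> ('a::euclidean_space \<Rightarrow> real) \<Rightarrow> 'a \<Rightarrow> 'a \<Rightarrow> real" where
  "frac_lap_integrand a u x y = (u x - u y) / norm (x - y) powr (real DIM('a) + a)"

text \<open>
  \<open>var_laplacian \<alpha> u x\<close> is \<open>(-\<Delta>)\<close> to the power \<open>\<alpha>(x)/2\<close> applied to \<open>u\<close>, at the point \<open>x\<close>; only orders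
  \<open>\<alpha>(x)\<close> in \<open>(0,2]\<close> are meaningful. It is a total function, and \<open>var_laplacian_exists\<close> says that
  the value at \<open>x\<close> is not a junk value.
\<close>

definition var_laplacian ::
    "('a::euclidean_space \<Rightarrow> real) \<Rightarrow> ('a \<Rightarrow> real) \<Rightarrow> 'a \<Rightarrow> real" where
  "var_laplacian \<alpha> u x =
     (if \<alpha> x = 2 then - laplacian u x
      else frac_lap_const DIM('a) (\<alpha> x) * principal_value (frac_lap_integrand (\<alpha> x) u x) x)"

definition var_laplacian_exists ::
    "('a::euclidean_space \<Rightarrow> real) \<Rightarrow> ('a \<Rightarrow> real) \<Rightarrow> 'a \<Rightarrow> bool" where
  "var_laplacian_exists \<alpha> u x \<longleftrightarrow>
     (if \<alpha> x = 2 then laplacian_exists u x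
      else \<exists>I. has_principal_value (frac_lap_integrand (\<alpha> x) u x) x I)"

section \<open>Hypergeometric function and Hoelder continuity\<close>

definition hyp2F1 :: "real \<Rightarrow> real \<Rightarrow> real \<Rightarrow> real \<Rightarrow> real" where
  "hyp2F1 a b c r =
     (\<Sum>n. pochhammer a n * pochhammer b n / pochhammer c n * (r ^ n / fact n))"

definition holder_continuous :: "('a::metric_space \<Rightarrow> 'b::metric_space) \<Rightarrow> bool" where
  "holder_continuous f \<longleftrightarrow>
     (\<exists>\<gamma> C. 0 < \<gamma> \<and> \<gamma> \<le> 1 \<and> (\<forall>x y. dist (f x) (f y) \<le> C * dist x y powr \<gamma>))"

end

theory Submission
  imports Defs "HOL-Probability.Probability" "HOL-Complex_Analysis.Complex_Analysis"
begin

text \<open>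
  For \<open>a = 2\<close> the formula is a direct computation with the Euler identity \<open>x \<bullet> \<nabla>V = l V\<close>. For
  \<open>0 < a < 2\<close> both sides are restrictions of functions holomorphic in the order \<open>a\<close> on
  \<open>-1 < Re a < 2\<close>, so it suffices to treat \<open>-1 < a < 0\<close>, where the principal value becomes a Riesz
  potential. By subordination \<open>|x - y|\<close> to a negative power is a superposition of Gaussians, and the
  Gaussian mean of a harmonic polynomial is its value at the centre; hence the potential of
  \<open>V(y) exp(-\<eta>|y|\<^sup>2)\<close> is \<open>V(x)\<close> times the Laplace transform at \<open>\<eta>\<close> of an explicit measure, a
  factorization of the radial kernel into two fractional integrals. Since exponentials determine a
  measure, the same formula holds with \<open>exp(-\<eta>t)\<close> replaced by \<open>(1 - t)\<^sup>p\<close> cut off at \<open>t = 1\<close>, and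
  the two remaining integrals are a Beta integral and Euler's integral for the hypergeometric
  function.
\<close>

section \<open>Polynomials on a Euclidean space as sums of monomials\<close>

text \<open>The obstacle is that for \<open>a > 0\<close> the kernel is not integrable at
  \<open>x\<close>, so the principal value allows neither Fubini nor subordination. For negative
  order both work, and the constant of the operator carries a factor \<open>a\<close> that cancels
  the simple pole at \<open>a = 0\<close>; this is what lets the identity cross zero. The bound
  \<open>a > -1\<close> keeps \<open>a + d\<close> positive for every \<open>d \<ge> 1\<close>, and
  \<open>a < 2\<close> is the range where second differences tame the singularity, so order 2 is a
  boundary point with its own computation. With \<open>b = - a / 2\<close>, the two fractional
  integrals arise as follows: the subordination variable \<open>s\<close> becomes
  \<open>w = s / (s + \<eta>)\<close>, which leaves exponentials linear in \<open>w\<close> and a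
  factor \<eta> to the power \<open>- b\<close>, itself the Laplace transform of
  \<open>r powr (b - 1) / Gamma b\<close>. The measures to be compared may be signed and infinite. A
  weight \<open>exp (- t)\<close> makes them finite, and in \<open>v = exp (- t)\<close>
  exponentials are powers, so Weierstrass approximation on the unit interval applies. The cut-off
  power can be unbounded or discontinuous and is reached only as a dominated limit of continuous
  functions.\<close>

definition monomial :: "('a::euclidean_space \<Rightarrow> nat) \<Rightarrow> 'a \<Rightarrow> real" where
  "monomial e y = (\<Prod>b\<in>Basis. (y \<bullet> b) ^ e b)"

text \<open>The induction for \<open>real_polynomial_function\<close> has a product step, through
  which neither Laplacians nor Gaussian means pass. Here the only step adds one monomial term, so a
  linear statement reduces to a single monomial.\<close>

inductive monomial_sum :: "('a::euclidean_space \<Rightarrow> real) \<Rightarrow> bool" where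
  zero: "monomial_sum (\<lambda>_. 0)"
| step: "monomial_sum f \<Longrightarrow> monomial_sum (\<lambda>y. c * monomial e y + f y)"

lemma monomial_sum_monomial: "monomial_sum (\<lambda>y. c * monomial e y)"
  using monomial_sum.step[OF monomial_sum.zero, of c e] by simp

lemma monomial_sum_add:
  assumes "monomial_sum f" "monomial_sum g"
  shows "monomial_sum (\<lambda>y. f y + g y)"
  using assms(1)
proof induction
  case zero
  then show ?case using assms(2) by simp
next
  case (step f c e)
  then show ?case using monomial_sum.step[of "\<lambda>y. f y + g y" c e] by (simp add: add.assoc)
qed

lemma monomial_sum_sum:
  assumes "finite A" "\<And>i. i \<in> A \<Longrightarrow> monomial_sum (f i)"
  shows "monomial_sum (\<lambda>y. \<Sum>i\<in>A. f i y)"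
  using assms by (induction A rule: finite_induct) (auto intro: monomial_sum.zero monomial_sum_add)

lemma monomial_mult: "monomial e y * monomial e' y = monomial (\<lambda>b. e b + e' b) y"
  by (simp add: monomial_def power_add prod.distrib)

lemma monomial_sum_mult_monomial:
  assumes "monomial_sum f"
  shows "monomial_sum (\<lambda>y. c * monomial e y * f y)"
  using assms
proof induction
  case zero
  then show ?case by (simp add: monomial_sum.zero)
next
  case (step f c' e')
  have "(\<lambda>y. c * monomial e y * (c' * monomial e' y + f y))
      = (\<lambda>y. (c * c') * monomial (\<lambda>b. e b + e' b) y + c * monomial e y * f y)"
    by (simp add: monomial_mult[symmetric] algebra_simps)
  then show ?case using monomial_sum.step[OF step.IH] by metis
qed

lemma monomial_sum_mult:
  assumes "monomial_sum f" "monomial_sum g"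
  shows "monomial_sum (\<lambda>y. f y * g y)"
  using assms(1)
proof induction
  case zero
  then show ?case by (simp add: monomial_sum.zero)
next
  case (step f c e)
  show ?case
    using monomial_sum_add[OF monomial_sum_mult_monomial[OF assms(2), of c e] step.IH]
    by (simp add: algebra_simps)
qed

lemma monomial_sum_coordinate:
  assumes "b \<in> Basis"
  shows "monomial_sum (\<lambda>y. c * (y \<bullet> b))"
proof -
  have "y \<bullet> b = monomial (\<lambda>i. if i = b then 1 else 0) y" for y :: 'a
    using assms by (simp add: monomial_def if_distrib prod.delta cong: if_cong)
  then show ?thesis using monomial_sum_monomial by simp
qed

lemma real_polynomial_function_monomial_sum:
  assumes "real_polynomial_function f"
  shows "monomial_sum f"
  using assms
proof induction
  case (linear f)
  have "f = (\<lambda>y. \<Sum>b\<in>Basis. f b * (y \<bullet> b))"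
  proof
    fix y
    have "f y = f (\<Sum>b\<in>Basis. (y \<bullet> b) *\<^sub>R b)" by (simp add: euclidean_representation)
    also have "\<dots> = (\<Sum>b\<in>Basis. f b * (y \<bullet> b))"
      using linear by (simp add: linear_simps real_vector.linear_sum bounded_linear.linear
          linear_sum linear_scale mult.commute)
    finally show "f y = (\<Sum>b\<in>Basis. f b * (y \<bullet> b))" .
  qed
  moreover have "monomial_sum (\<lambda>y. \<Sum>b\<in>Basis. f b * (y \<bullet> b))"
    by (intro monomial_sum_sum monomial_sum_coordinate finite_Basis)
  ultimately show ?case by simp
next
  case (const c)
  then show ?case using monomial_sum_monomial[of c "\<lambda>_. 0"] by (simp add: monomial_def)
qed (auto intro: monomial_sum_add monomial_sum_mult)

lemma continuous_on_real_polynomial: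
  "real_polynomial_function V \<Longrightarrow> continuous_on A V"
  by (intro continuous_on_polymonial_function) (simp add: real_polynomial_function_eq)

lemma borel_measurable_real_polynomial:
  "real_polynomial_function V \<Longrightarrow> V \<in> borel_measurable borel"
  by (intro borel_measurable_continuous_onI continuous_on_real_polynomial)

lemma continuous_on_compact_abs_bounded:
  fixes f :: "'a::topological_space \<Rightarrow> real"
  assumes "continuous_on A f" "compact A"
  shows "\<exists>B\<ge>0. \<forall>y\<in>A. \<bar>f y\<bar> \<le> B"
proof -
  obtain B where "\<forall>z\<in>f ` A. norm z \<le> B"
    using compact_imp_bounded[OF compact_continuous_image[OF assms]] unfolding bounded_iff by blast
  then show ?thesis by (intro exI[of _ "max 0 B"]) (auto simp: le_max_iff_disj)
qed

section \<open>Partial derivatives and Laplacians of monomials\<close>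

lemma monomial_line:
  assumes "b \<in> Basis"
  shows "monomial e (x + t *\<^sub>R b) = (x \<bullet> b + t) ^ e b * (\<Prod>i\<in>Basis - {b}. (x \<bullet> i) ^ e i)"
proof -
  have "monomial e (x + t *\<^sub>R b)
      = ((x + t *\<^sub>R b) \<bullet> b) ^ e b * (\<Prod>i\<in>Basis - {b}. ((x + t *\<^sub>R b) \<bullet> i) ^ e i)"
    using assms by (simp add: monomial_def prod.remove)
  also have "\<dots> = (x \<bullet> b + t) ^ e b * (\<Prod>i\<in>Basis - {b}. (x \<bullet> i) ^ e i)"
    using assms by (auto simp: inner_add_left inner_Basis intro!: prod.cong)
  finally show ?thesis .
qed

text \<open>Along a coordinate line only one factor varies. When \<open>e b = 0\<close>, the
  truncated exponent \<open>e b - 1\<close> does no harm, since the factor \<open>real (e b)\<close>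
  vanishes.\<close>

lemma has_derivative_monomial_line:
  assumes "b \<in> Basis"
  shows "((\<lambda>t. monomial e (x + t *\<^sub>R b)) has_real_derivative
           real (e b) * monomial (e(b := e b - 1)) x) (at 0)"
proof -
  have eq: "monomial (e(b := e b - 1)) x = (x \<bullet> b) ^ (e b - 1) * (\<Prod>i\<in>Basis - {b}. (x \<bullet> i) ^ e i)"
    using monomial_line[OF assms, of "e(b := e b - 1)" x 0] by simp
  show ?thesis
    unfolding monomial_line[OF assms] eq by (rule derivative_eq_intros refl | simp)+
qed

lemma partial_deriv_eqI:
  "((\<lambda>t. f (x + t *\<^sub>R b)) has_real_derivative D) (at 0) \<Longrightarrow> partial_deriv b f x = D"
  unfolding partial_deriv_def by (rule DERIV_imp_deriv)

text \<open>\<open>partial_deriv\<close> rests on the total function \<open>deriv\<close>. This is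
  what makes it a genuine derivative for polynomials, so that sum and product rules may be applied
  to it.\<close>

lemma monomial_sum_has_partial_deriv:
  assumes "monomial_sum f" "b \<in> Basis"
  shows "((\<lambda>t. f (x + t *\<^sub>R b)) has_real_derivative partial_deriv b f x) (at 0)"
  using assms(1)
proof induction
  case zero
  show ?case by (simp add: partial_deriv_def)
next
  case (step f c e)
  have "((\<lambda>t. c * monomial e (x + t *\<^sub>R b) + f (x + t *\<^sub>R b)) has_real_derivative
      c * (real (e b) * monomial (e(b := e b - 1)) x) + partial_deriv b f x) (at 0)"
    by (intro DERIV_add DERIV_cmult has_derivative_monomial_line assms step.IH)
  with partial_deriv_eqI[of "\<lambda>y. c * monomial e y + f y", OF this] show ?case by simp
qed

lemma partial_deriv_add:
  assumes "monomial_sum f" "monomial_sum g" "b \<in> Basis"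
  shows "partial_deriv b (\<lambda>y. f y + g y) x = partial_deriv b f x + partial_deriv b g x"
  by (rule partial_deriv_eqI) (intro DERIV_add monomial_sum_has_partial_deriv assms)

lemma partial_deriv_monomial:
  assumes "b \<in> Basis"
  shows "partial_deriv b (\<lambda>y. c * monomial e y) = (\<lambda>x. (c * real (e b)) * monomial (e(b := e b - 1)) x)"
proof
  fix x :: 'a
  show "partial_deriv b (\<lambda>y. c * monomial e y) x = (c * real (e b)) * monomial (e(b := e b - 1)) x"
    unfolding mult.assoc by (intro partial_deriv_eqI DERIV_cmult has_derivative_monomial_line assms)
qed

lemma monomial_sum_partial_deriv:
  assumes "monomial_sum f" "b \<in> Basis"
  shows "monomial_sum (partial_deriv b f)"
  using assms(1)
proof induction
  case zero
  have "partial_deriv b (\<lambda>y. 0) = (\<lambda>y. 0)"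
    by (simp add: partial_deriv_def fun_eq_iff)
  then show ?case by (simp add: monomial_sum.zero)
next
  case (step f c e)
  have "partial_deriv b (\<lambda>y. c * monomial e y + f y)
      = (\<lambda>x. (c * real (e b)) * monomial (e(b := e b - 1)) x + partial_deriv b f x)"
    using partial_deriv_add[OF monomial_sum_monomial step.hyps assms(2), of c e]
      partial_deriv_monomial[OF assms(2), of c e] by (simp add: fun_eq_iff)
  then show ?case using monomial_sum.step[OF step.IH] by simp
qed

lemma laplacian_add:
  assumes "monomial_sum f" "monomial_sum g"
  shows "laplacian (\<lambda>y. f y + g y) x = laplacian f x + laplacian g x"
  unfolding laplacian_def sum.distrib[symmetric]
proof (rule sum.cong[OF refl])
  fix b :: 'a assume b: "b \<in> Basis"
  have "partial_deriv b (\<lambda>y. f y + g y) = (\<lambda>y. partial_deriv b f y + partial_deriv b g y)"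
    using partial_deriv_add[OF assms b] by blast
  then show "partial_deriv b (partial_deriv b (\<lambda>y. f y + g y)) x =
      partial_deriv b (partial_deriv b f) x + partial_deriv b (partial_deriv b g) x"
    using partial_deriv_add[OF monomial_sum_partial_deriv[OF assms(1) b]
        monomial_sum_partial_deriv[OF assms(2) b] b] by simp
qed

text \<open>Truncated subtraction is safe here too: for \<open>e b < 2\<close> the coefficient
  \<open>real (e b) * real (e b - 1)\<close> is zero.\<close>

lemma laplacian_monomial:
  "laplacian (\<lambda>y. c * monomial e y) x
   = c * (\<Sum>b\<in>Basis. real (e b) * real (e b - 1) * monomial (e(b := e b - 2)) x)"
proof -
  have "(e(b := e b - 1))(b := (e(b := e b - 1)) b - 1) = e(b := e b - 2)" for b by (simp add: numeral_2_eq_2)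
  then show ?thesis
    unfolding laplacian_def sum_distrib_left
    by (intro sum.cong) (auto simp: partial_deriv_monomial)
qed

section \<open>Gaussian means of harmonic polynomials\<close>

text \<open>The moments of a centred normal law of variance \<open>t\<close>; the recursion is
  Gaussian integration by parts. As polynomials in \<open>t\<close> they make sense at
  \<open>t = 0\<close>, where no density exists.\<close>

fun central_moment :: "nat \<Rightarrow> real \<Rightarrow> real" where
  "central_moment 0 t = 1"
| "central_moment (Suc 0) t = 0"
| "central_moment (Suc (Suc k)) t = real (Suc k) * t * central_moment k t"

lemma central_moment_0: "k > 0 \<Longrightarrow> central_moment k 0 = 0"
  by (cases "(k, 0::real)" rule: central_moment.cases) auto

lemma has_derivative_central_moment:
  "(central_moment k has_real_derivative real k * real (k - 1) / 2 * central_moment (k - 2) t) (at t)"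
proof (induction k t rule: central_moment.induct)
  case (3 k t)
  have "((\<lambda>t. real (Suc k) * (t * central_moment k t)) has_real_derivative
      real (Suc k) * (1 * central_moment k t + (real k * real (k - 1) / 2 * central_moment (k - 2) t) * t)) (at t)"
    by (intro DERIV_cmult DERIV_mult DERIV_ident 3)
  \<comment> \<open>The defining recursion read downwards. The common factor \<open>real k\<close>
    and the vanishing first moment cover \<open>k = 0\<close> and \<open>k = 1\<close>.\<close>
  moreover have "real k * (real (k - 1) * central_moment (k - 2) t * t) = real k * central_moment k t"
    by (cases "(k, t)" rule: central_moment.cases) auto
  then have "real (Suc k) * (1 * central_moment k t + (real k * real (k - 1) / 2 * central_moment (k - 2) t) * t)
      = real (Suc k) * (central_moment k t + real k * central_moment k t / 2)"
    by (simp only: mult.assoc times_divide_eq_left times_divide_eq_right mult_1)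
  then have "real (Suc k) * (1 * central_moment k t + (real k * real (k - 1) / 2 * central_moment (k - 2) t) * t)
      = real (Suc (Suc k)) * real (Suc k) / 2 * central_moment k t"
    by (simp add: field_simps)
  ultimately show ?case
    by (simp only: central_moment.simps diff_Suc_Suc diff_zero diff_Suc_1 numeral_2_eq_2 mult.assoc[of "real (Suc k)"])
qed auto

lemma central_moment_even: "central_moment (2 * k) t = t ^ k * fact (2 * k) / (2 ^ k * fact k)"
proof (induction k)
  case (Suc k)
  have "central_moment (2 * Suc k) t = (2 * real k + 1) * t * central_moment (2 * k) t" by simp
  also have "\<dots> = (2 * real k + 1) * t * (t ^ k * fact (2 * k) / (2 ^ k * fact k))"
    by (simp only: Suc)
  also have "\<dots> = t ^ Suc k * ((2 * real k + 2) * (2 * real k + 1) * fact (2 * k)) / (2 ^ Suc k * ((real k + 1) * fact k))"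
  proof -
    have "A * t * (T * F / (P * Q)) = T * t * ((2 * real k + 2) * A * F) / (P * 2 * ((real k + 1) * Q))" for A T F P Q
    proof -
      have "(2 * real k + 2) * A * F = (2 * (real k + 1)) * (A * F)" by (simp add: algebra_simps)
      then have "T * t * ((2 * real k + 2) * A * F) / (P * 2 * ((real k + 1) * Q))
          = ((2 * (real k + 1)) * (T * t * (A * F))) / ((2 * (real k + 1)) * (P * Q))"
        by (simp add: mult_ac)
      also have "\<dots> = T * t * (A * F) / (P * Q)"
        by (rule mult_divide_mult_cancel_left) simp
      finally show ?thesis by (simp add: mult_ac)
    qed
    from this[of "2 * real k + 1" "t ^ k" "fact (2 * k)" "2 ^ k" "fact k"] show ?thesis
      by (simp only: power_Suc2)
  qed
  also have "\<dots> = t ^ Suc k * fact (2 * Suc k) / (2 ^ Suc k * fact (Suc k))"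
    by (simp add: add.commute mult.assoc)
  finally show ?case .
qed simp

lemma central_moment_odd: "central_moment (Suc (2 * k)) t = 0"
  by (induction k) auto

lemma has_bochner_integral_central_moment:
  assumes "t > 0"
  shows "has_bochner_integral lborel (\<lambda>y. (y - z) ^ k * normal_density z (sqrt t) y) (central_moment k t)"
proof (cases "even k")
  case True
  then obtain j where "k = 2 * j" by blast
  with normal_moment_even[of "sqrt t" z j] assms show ?thesis
    by (simp add: central_moment_even power_divide mult.commute[of _ "normal_density _ _ _"] mult.commute[of _ "t ^ j"])
next
  case False
  then obtain j where "k = Suc (2 * j)" by (elim oddE) simp
  with normal_moment_odd[of "sqrt t" z j] assms show ?thesis
    by (simp add: central_moment_odd mult.commute[of _ "normal_density _ _ _"])
qed

text \<open>The heat polynomial with initial value \<open>z ^ n\<close>: the mean of the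
  \<open>n\<close>-th power under the normal law with mean \<open>z\<close> and variance
  \<open>t\<close>, expanded binomially around \<open>z\<close>.\<close>

definition heat_power :: "nat \<Rightarrow> real \<Rightarrow> real \<Rightarrow> real" where
  "heat_power n z t = (\<Sum>k\<le>n. real (n choose k) * z ^ (n - k) * central_moment k t)"

lemma heat_power_0: "heat_power n z 0 = z ^ n"
proof -
  have "heat_power n z 0 = (\<Sum>k\<le>n. if k = 0 then z ^ n else 0)"
    unfolding heat_power_def by (intro sum.cong) (auto simp: central_moment_0)
  then show ?thesis by simp
qed

lemma has_bochner_integral_heat_power:
  assumes "t > 0"
  shows "has_bochner_integral lborel (\<lambda>y. y ^ n * normal_density z (sqrt t) y) (heat_power n z t)"
proof -
  have "y ^ n = (\<Sum>k\<le>n. real (n choose k) * (y - z) ^ k * z ^ (n - k))" for y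
    using binomial_ring[of "y - z" z n] by simp
  then have "y ^ n * normal_density z (sqrt t) y
      = (\<Sum>k\<le>n. real (n choose k) * z ^ (n - k) * ((y - z) ^ k * normal_density z (sqrt t) y))" for y
    by (simp add: sum_distrib_right sum_distrib_left mult_ac)
  then show ?thesis
    unfolding heat_power_def
    by (auto intro!: has_bochner_integral_sum has_bochner_integral_mult_right
        has_bochner_integral_central_moment assms)
qed

text \<open>The absorption identity used twice. It turns the factor \<open>k (k - 1)\<close> from
  differentiating the \<open>k\<close>-th moment into the factor \<open>n (n - 1)\<close> in front
  of a heat polynomial of degree lower by two.\<close>

lemma choose_two_absorb:
  "real (Suc (Suc m) choose Suc (Suc j)) * (real (Suc (Suc j)) * real (Suc j))
   = real (Suc (Suc m)) * real (Suc m) * real (m choose j)"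
proof -
  have 1: "real (Suc (Suc m)) * real (Suc m choose Suc j) = real (Suc (Suc m) choose Suc (Suc j)) * real (Suc (Suc j))"
    unfolding of_nat_mult[symmetric] by (subst Suc_times_binomial_eq) (rule refl)
  have 2: "real (Suc m) * real (m choose j) = real (Suc m choose Suc j) * real (Suc j)"
    unfolding of_nat_mult[symmetric] by (subst Suc_times_binomial_eq) (rule refl)
  show ?thesis
    by (simp only: mult.assoc[symmetric] 1[symmetric]) (simp only: mult.assoc 2)
qed

lemma has_derivative_heat_power:
  "(heat_power n z has_real_derivative real n * real (n - 1) / 2 * heat_power (n - 2) z t) (at t)"
proof -
  have D: "((\<lambda>t. \<Sum>k\<le>n. real (n choose k) * z ^ (n - k) * central_moment k t) has_real_derivative
      (\<Sum>k\<le>n. real (n choose k) * z ^ (n - k) * (real k * real (k - 1) / 2 * central_moment (k - 2) t))) (at t)"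
    by (intro DERIV_sum DERIV_cmult has_derivative_central_moment)
  have "(\<Sum>k\<le>n. real (n choose k) * z ^ (n - k) * (real k * real (k - 1) / 2 * central_moment (k - 2) t))
      = real n * real (n - 1) / 2 * heat_power (n - 2) z t"
  proof (cases "n \<ge> 2")
    case True
    then obtain m where n: "n = Suc (Suc m)"
      using le_Suc_ex[of 2 n] by auto
    \<comment> \<open>The terms \<open>k = 0\<close> and \<open>k = 1\<close> vanish, so the sum is
      reindexed by two.\<close>
    have "(\<Sum>k\<le>n. real (n choose k) * z ^ (n - k) * (real k * real (k - 1) / 2 * central_moment (k - 2) t))
        = (\<Sum>k\<le>m. (real (Suc (Suc m) choose Suc (Suc k)) * (real (Suc (Suc k)) * real (Suc k))) * (z ^ (m - k) / 2 * central_moment k t))"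
      unfolding n sum.atMost_Suc_shift by (simp add: mult_ac del: binomial_Suc_Suc of_nat_Suc)
    also have "\<dots> = (\<Sum>k\<le>m. (real (Suc (Suc m)) * real (Suc m) * real (m choose k)) * (z ^ (m - k) / 2 * central_moment k t))"
      by (simp only: choose_two_absorb)
    also have "\<dots> = real n * real (n - 1) / 2 * heat_power m z t"
      unfolding heat_power_def sum_distrib_left n by (intro sum.cong) auto
    finally show ?thesis by (simp add: n)
  next
    case False
    then have "n = 0 \<or> n = 1" by auto
    then show ?thesis by auto
  qed
  with D show ?thesis unfolding heat_power_def[abs_def] by (simp only:)
qed

section \<open>Heat flow in several variables\<close>

definition gauss :: "real \<Rightarrow> 'a::euclidean_space \<Rightarrow> 'a \<Rightarrow> real" where
  "gauss t z y = (\<Prod>b\<in>Basis. normal_density (z \<bullet> b) (sqrt t) (y \<bullet> b))"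

text \<open>Lebesgue measure is the image of the product measure on coordinate tuples, so a product
  of functions of single coordinates integrates to the product of the integrals.\<close>

lemma has_bochner_integral_lborel_prod:
  fixes f :: "'a::euclidean_space \<Rightarrow> real \<Rightarrow> real"
  assumes "\<And>b. b \<in> Basis \<Longrightarrow> has_bochner_integral lborel (f b) (I b)"
  shows "has_bochner_integral lborel (\<lambda>y::'a. \<Prod>b\<in>Basis. f b (y \<bullet> b)) (\<Prod>b\<in>Basis. I b)"
proof -
  interpret product_sigma_finite "\<lambda>_::'a. lborel :: real measure"
    by standard
  have i: "b \<in> Basis \<Longrightarrow> integrable lborel (f b)" and I: "b \<in> Basis \<Longrightarrow> integral\<^sup>L lborel (f b) = I b" for b
    using assms has_bochner_integral_iff by blast+
  have m [measurable]: "b \<in> Basis \<Longrightarrow> f b \<in> borel_measurable borel" for b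
    using i borel_measurable_integrable by fastforce
  have [measurable]: "(\<lambda>g. \<Sum>b\<in>Basis. g b *\<^sub>R b) \<in> measurable (\<Pi>\<^sub>M b\<in>Basis. lborel) (borel :: 'a measure)"
    by measurable
  have inn: "b \<in> Basis \<Longrightarrow> (\<Sum>c\<in>Basis. g c *\<^sub>R c) \<bullet> b = g b" for b :: 'a and g
    by (simp add: inner_sum_left inner_Basis if_distrib cong: if_cong)
  have meas: "(\<lambda>y::'a. \<Prod>b\<in>Basis. f b (y \<bullet> b)) \<in> borel_measurable borel"
    by measurable
  have "has_bochner_integral (\<Pi>\<^sub>M b\<in>Basis. lborel) (\<lambda>g. \<Prod>b\<in>Basis. f b (g b)) (\<Prod>b\<in>Basis. I b)"
    using product_integrable_prod[OF finite_Basis i] product_integral_prod[OF finite_Basis i] I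
    by (simp add: has_bochner_integral_iff)
  then have "has_bochner_integral (\<Pi>\<^sub>M b\<in>Basis. lborel)
      (\<lambda>g. (\<lambda>y::'a. \<Prod>b\<in>Basis. f b (y \<bullet> b)) (\<Sum>b\<in>Basis. g b *\<^sub>R b)) (\<Prod>b\<in>Basis. I b)"
    by (simp add: inn cong: prod.cong)
  then show ?thesis
    by (subst lborel_eq, intro has_bochner_integral_distr) (use meas in auto)
qed

lemma has_bochner_integral_monomial_gauss:
  assumes "t > 0"
  shows "has_bochner_integral lborel (\<lambda>y. monomial e y * gauss t z y) (\<Prod>b\<in>Basis. heat_power (e b) (z \<bullet> b) t)"
  unfolding monomial_def gauss_def prod.distrib[symmetric]
  by (rule has_bochner_integral_lborel_prod, rule has_bochner_integral_heat_power, rule assms)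

text \<open>\<open>H t\<close> is the Gaussian mean of \<open>f\<close> around \<open>z\<close> with
  variance \<open>t\<close>, and the heat equation makes its derivative half the mean of the
  Laplacian. Because \<open>H\<close> is a polynomial in \<open>t\<close>, it is differentiable at 0
  with value \<open>f z\<close> there, and no limit of Gaussian integrals as \<open>t\<close> tends
  to 0 has to be taken.\<close>

lemma monomial_sum_heat_flow:
  assumes "monomial_sum f"
  shows "\<exists>H H'. H 0 = f z \<and> (\<forall>t. (H has_real_derivative H' t) (at t)) \<and>
    (\<forall>t>0. has_bochner_integral lborel (\<lambda>y. f y * gauss t z y) (H t)) \<and>
    (\<forall>t>0. has_bochner_integral lborel (\<lambda>y. laplacian f y * gauss t z y) (2 * H' t))"
  using assms
proof induction
  case zero
  have "laplacian (\<lambda>_. 0) y = 0" for y :: 'a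
    by (simp add: laplacian_def partial_deriv_def)
  then show ?case by (intro exI[of _ "\<lambda>_. 0"]) auto
next
  case (step f c e)
  then obtain H H' where H: "H 0 = f z" "\<And>t. (H has_real_derivative H' t) (at t)"
    "\<And>t. t > 0 \<Longrightarrow> has_bochner_integral lborel (\<lambda>y. f y * gauss t z y) (H t)"
    "\<And>t. t > 0 \<Longrightarrow> has_bochner_integral lborel (\<lambda>y. laplacian f y * gauss t z y) (2 * H' t)"
    by blast
  define G where "G e t = (\<Prod>b\<in>Basis. heat_power (e b) (z \<bullet> b) t)" for e t
  \<comment> \<open>The product rule over coordinates: each factor loses two degrees, which is half
    of the corresponding term of the Laplacian.\<close>
  define G' where "G' t = (\<Sum>b\<in>Basis. real (e b) * real (e b - 1) / 2 * G (e(b := e b - 2)) t)" for t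
  have G0: "G e 0 = monomial e z"
    by (simp add: G_def heat_power_0 monomial_def)
  have G: "t > 0 \<Longrightarrow> has_bochner_integral lborel (\<lambda>y. monomial e y * gauss t z y) (G e t)" for t e
    unfolding G_def by (rule has_bochner_integral_monomial_gauss)
  have dG: "(G e has_real_derivative G' t) (at t)" for t
  proof -
    have "((\<lambda>t. \<Prod>b\<in>Basis. heat_power (e b) (z \<bullet> b) t) has_real_derivative
        (\<Sum>b\<in>Basis. (real (e b) * real (e b - 1) / 2 * heat_power (e b - 2) (z \<bullet> b) t) *
          (\<Prod>i\<in>Basis - {b}. heat_power (e i) (z \<bullet> i) t))) (at t)"
      by (rule has_field_derivative_prod) (rule has_derivative_heat_power)
    moreover have "heat_power (e b - 2) (z \<bullet> b) t * (\<Prod>i\<in>Basis - {b}. heat_power (e i) (z \<bullet> i) t)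
        = G (e(b := e b - 2)) t" if "b \<in> Basis" for b
      unfolding G_def using that by (simp add: prod.remove[of Basis b])
    moreover have Ge: "G e = (\<lambda>t. \<Prod>b\<in>Basis. heat_power (e b) (z \<bullet> b) t)"
      by (simp add: G_def fun_eq_iff)
    ultimately show ?thesis
      unfolding Ge G'_def by (simp only: mult.assoc cong: sum.cong)
  qed
  have lap: "laplacian (\<lambda>y. c * monomial e y + f y) x
      = c * (\<Sum>b\<in>Basis. real (e b) * real (e b - 1) * monomial (e(b := e b - 2)) x) + laplacian f x" for x
    by (subst laplacian_add[OF monomial_sum_monomial step.hyps]) (simp only: laplacian_monomial)
  have lapG: "has_bochner_integral lborel (\<lambda>y. (\<Sum>b\<in>Basis. real (e b) * real (e b - 1) * monomial (e(b := e b - 2)) y)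
      * gauss t z y) (2 * G' t)" if "t > 0" for t
  proof -
    have "has_bochner_integral lborel (\<lambda>y. \<Sum>b\<in>Basis. real (e b) * real (e b - 1) * (monomial (e(b := e b - 2)) y
      * gauss t z y)) (\<Sum>b\<in>Basis. real (e b) * real (e b - 1) * G (e(b := e b - 2)) t)"
      by (intro has_bochner_integral_sum has_bochner_integral_mult_right G that)
    then show ?thesis
      by (simp add: G'_def sum_distrib_left sum_distrib_right mult_ac)
  qed
  have 1: "((\<lambda>t. c * G e t + H t) has_real_derivative c * G' t + H' t) (at t)" for t
    by (intro DERIV_add DERIV_cmult dG H)
  have 2: "has_bochner_integral lborel (\<lambda>y. (c * monomial e y + f y) * gauss t z y) (c * G e t + H t)"
    if "t > 0" for t
    using has_bochner_integral_add[OF has_bochner_integral_mult_right[OF G[OF that], where c=c] H(3)[OF that]]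
    by (simp add: algebra_simps)
  have 3: "has_bochner_integral lborel (\<lambda>y. laplacian (\<lambda>y. c * monomial e y + f y) y * gauss t z y)
        (2 * (c * G' t + H' t))" if "t > 0" for t
    unfolding lap
    using has_bochner_integral_add[OF has_bochner_integral_mult_right[OF lapG[OF that], where c=c] H(4)[OF that]]
    by (simp add: algebra_simps)
  show ?case
    using 1 2 3 by (intro exI[of _ "\<lambda>t. c * G e t + H t"] exI[of _ "\<lambda>t. c * G' t + H' t"]) (simp add: G0 H)
qed

text \<open>The derivative of the heat flow is half the mean of the Laplacian, hence zero for
  positive times, and the mean value theorem on the interval from 0 to \<open>t\<close> identifies
  the mean with the initial value.\<close>

lemma harmonic_gauss_mean:
  assumes "real_polynomial_function V" "\<And>x. laplacian V x = 0" "t > 0"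
  shows "has_bochner_integral lborel (\<lambda>y. V y * gauss t z y) (V z)"
proof -
  obtain H H' where H: "H 0 = V z" "\<And>t. (H has_real_derivative H' t) (at t)"
    "\<And>t. t > 0 \<Longrightarrow> has_bochner_integral lborel (\<lambda>y. V y * gauss t z y) (H t)"
    "\<And>t. t > 0 \<Longrightarrow> has_bochner_integral lborel (\<lambda>y. laplacian V y * gauss t z y) (2 * H' t)"
    using monomial_sum_heat_flow[OF real_polynomial_function_monomial_sum[OF assms(1)], of z] by blast
  have "H' s = 0" if "s > 0" for s
    using has_bochner_integral_eq[OF H(4)[OF that] has_bochner_integral_cong[THEN iffD2, OF refl _ refl has_bochner_integral_zero]] assms(2) by simp
  moreover obtain s where "s > 0" "H t - H 0 = (t - 0) * H' s"
    using MVT2[OF assms(3), of H H'] H(2) by blast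
  ultimately have "H t = V z" by (simp add: H(1))
  then show ?thesis using H(3)[OF assms(3)] by simp
qed

lemma gauss_eq:
  assumes "t > 0"
  shows "gauss t z (y::'a::euclidean_space) = exp (- (norm (y - z))\<^sup>2 / (2 * t)) / sqrt (2 * pi * t) ^ DIM('a)"
proof -
  have "(norm (y - z))\<^sup>2 = (\<Sum>b\<in>Basis. (y \<bullet> b - z \<bullet> b)\<^sup>2)"
    unfolding power2_norm_eq_inner by (subst euclidean_inner) (simp add: inner_diff_left power2_eq_square)
  moreover have "gauss t z y = (\<Prod>b\<in>(Basis::'a set). exp (- (y \<bullet> b - z \<bullet> b)\<^sup>2 / (2 * t))) * (\<Prod>b\<in>(Basis::'a set). 1 / sqrt (2 * pi * t))"
    unfolding gauss_def prod.distrib[symmetric] normal_density_def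
    using assms by (intro prod.cong) auto
  moreover have "(\<Prod>b\<in>(Basis::'a set). exp (- (y \<bullet> b - z \<bullet> b)\<^sup>2 / (2 * t))) = exp (- (\<Sum>b\<in>(Basis::'a set). (y \<bullet> b - z \<bullet> b)\<^sup>2) / (2 * t))"
    by (simp only: exp_sum[symmetric] finite_Basis sum_negf[symmetric] sum_divide_distrib)
  ultimately show ?thesis
    by (simp add: power_one_over)
qed

lemma harmonic_gaussian_integral:
  fixes V :: "'a::euclidean_space \<Rightarrow> real"
  assumes "real_polynomial_function V" "\<And>x. laplacian V x = 0" "s > 0"
  shows "has_bochner_integral lborel (\<lambda>y. V y * exp (- s * (norm (y - z))\<^sup>2)) ((pi / s) powr (DIM('a) / 2) * V z)"
proof -
  \<comment> \<open>The variance for which the normal density has exponent \<open>- s\<close> times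
    the squared distance; its normalising constant is then a power of \<open>pi / s\<close>.\<close>
  define t where "t = 1 / (2 * s)"
  have t: "t > 0" and ts: "1 / (2 * t) = s" "2 * pi * t = pi / s" using assms(3) by (auto simp: t_def)
  have "sqrt (pi / s) ^ DIM('a) = ((pi / s) powr (1 / 2)) powr DIM('a)"
    using assms(3) by (subst powr_realpow) (simp_all add: powr_half_sqrt)
  then have "sqrt (pi / s) ^ DIM('a) = (pi / s) powr (DIM('a) / 2)"
    by (simp add: powr_powr)
  moreover have "V y * gauss t z y * (pi / s) powr (DIM('a) / 2) = V y * exp (- s * (norm (y - z))\<^sup>2)" for y
  proof -
    have "- (norm (y - z))\<^sup>2 / (2 * t) = - s * (norm (y - z))\<^sup>2" using ts(1) by (simp add: t_def)
    then show ?thesis using assms(3) calculation unfolding gauss_eq[OF t] ts by simp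
  qed
  ultimately show ?thesis
    using has_bochner_integral_mult_left[OF harmonic_gauss_mean[OF assms(1,2) t, of z], of "(pi / s) powr (DIM('a) / 2)"]
    by (simp only: mult.commute[of "(pi / s) powr _"])
qed

section \<open>Radial integrals\<close>

text \<open>A bridge from gauge integrals, in which the explicit one-dimensional antiderivatives and
  the Beta and Gamma integrals are available, to Lebesgue integrals; nonnegativity is what makes it
  valid.\<close>

lemma has_bochner_integral_indicator_has_integral:
  fixes f :: "'b::euclidean_space \<Rightarrow> real"
  assumes "(f has_integral I) S" "\<And>x. x \<in> S \<Longrightarrow> 0 \<le> f x" "f \<in> borel_measurable borel" "S \<in> sets borel"
  shows "has_bochner_integral lborel (\<lambda>x. indicator S x * f x) I"
proof (rule has_bochner_integral_nn_integral)
  show "(\<lambda>x. indicator S x * f x) \<in> borel_measurable lborel"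
    using assms(3,4) by simp
  show "0 \<le> I" using has_integral_nonneg[OF assms(1,2)] .
  show "(\<integral>\<^sup>+ x. ennreal (indicator S x * f x) \<partial>lborel) = ennreal I"
    by (rule nn_integral_has_integral_lebesgue[OF assms(2,1)])
qed (use assms(2) in \<open>auto simp: indicator_def\<close>)

definition sphere_area :: "nat \<Rightarrow> real" where
  "sphere_area d = real d * unit_ball_vol (real d)"

lemma sphere_area_nonneg: "sphere_area d \<ge> 0"
  by (simp add: sphere_area_def)

text \<open>Polar coordinates for radial functions only. Both measures give the half-line up to
  \<open>r\<close> the volume of the ball of radius \<open>r\<close>, and these half-lines generate
  the Borel sets and are closed under intersection.\<close>

lemma distr_norm_lborel:
  "distr lborel borel (norm :: 'a::euclidean_space \<Rightarrow> real)
   = density lborel (\<lambda>r. ennreal (indicator {0..} r * (sphere_area DIM('a) * r ^ (DIM('a) - 1))))"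
  (is "?M = ?N")
proof -
  have eq: "emeasure ?M {..r} = ennreal (unit_ball_vol DIM('a) * (max 0 r) ^ DIM('a))" for r
  proof (cases "r \<ge> 0")
    case True
    have "norm -` {..r} = cball (0::'a) r" by auto
    then show ?thesis using True by (simp add: emeasure_distr emeasure_cball max_def)
  next
    case False
    then have "norm -` {..r} = ({}::'a set)" by (auto dest: order_trans[OF norm_ge_zero])
    then show ?thesis using False by (simp add: emeasure_distr max_def zero_power)
  qed
  have eq2: "emeasure ?N {..r} = ennreal (unit_ball_vol DIM('a) * (max 0 r) ^ DIM('a))" for r
  proof -
    have "((\<lambda>r. sphere_area DIM('a) * r ^ (DIM('a) - 1)) has_integral
        unit_ball_vol DIM('a) * (max 0 r) ^ DIM('a) - unit_ball_vol DIM('a) * 0 ^ DIM('a)) {0..max 0 r}"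
      by (intro fundamental_theorem_of_calculus)
         (auto simp: sphere_area_def has_real_derivative_iff_has_vector_derivative[symmetric]
            intro!: derivative_eq_intros)
    then have "(\<integral>\<^sup>+ x. ennreal (indicator {0..max 0 r} x * (sphere_area DIM('a) * x ^ (DIM('a) - 1))) \<partial>lborel)
        = ennreal (unit_ball_vol DIM('a) * (max 0 r) ^ DIM('a))"
      by (subst nn_integral_has_integral_lebesgue) (auto simp: sphere_area_nonneg zero_power)
    moreover have "(\<integral>\<^sup>+ x. ennreal (indicator {0..max 0 r} x * (sphere_area DIM('a) * x ^ (DIM('a) - 1))) \<partial>lborel)
        = emeasure ?N {..r}"
    \<comment> \<open>For negative \<open>r\<close> the interval on the left still contains the
      point 0, which is a null set.\<close>
    proof (subst emeasure_density)
      show "(\<integral>\<^sup>+ x. ennreal (indicator {0..max 0 r} x * (sphere_area DIM('a) * x ^ (DIM('a) - 1))) \<partial>lborel)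
        = (\<integral>\<^sup>+ x. ennreal (indicator {0..} x * (sphere_area DIM('a) * x ^ (DIM('a) - 1))) * indicator {..r} x \<partial>lborel)"
        by (rule nn_integral_cong_AE, rule AE_mp[OF AE_lborel_singleton[of 0]])
           (auto simp: indicator_def)
    qed auto
    ultimately show ?thesis by simp
  qed
  show ?thesis
  proof (rule measure_eqI_generator_eq[of "range (\<lambda>r::real. {..r})" UNIV _ _ "\<lambda>i. {..real i}"])
    show "Int_stable (range (\<lambda>r::real. {..r}))"
      by (auto simp: Int_stable_def)
    show "sets ?M = sigma_sets UNIV (range (\<lambda>r::real. {..r}))"
      "sets ?N = sigma_sets UNIV (range (\<lambda>r::real. {..r}))"
      by (simp_all add: borel_eq_atMost)
    show "(\<Union>i. {..real i}) = UNIV" by (auto intro: real_arch_simple)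
    show "emeasure ?M {..real i} \<noteq> \<infinity>" for i by (simp add: eq)
    show "emeasure ?M X = emeasure ?N X" if "X \<in> range (\<lambda>r::real. {..r})" for X
      using that eq eq2 by auto
  qed auto
qed

lemma has_bochner_integral_radial:
  assumes "has_bochner_integral lborel (\<lambda>r. indicator {0..} r * (f r * r ^ (DIM('a) - 1))) I"
    and [measurable]: "f \<in> borel_measurable borel"
  shows "has_bochner_integral lborel (\<lambda>x::'a::euclidean_space. f (norm x)) (sphere_area DIM('a) * I)"
proof -
  let ?g = "\<lambda>r. indicator {0..} r * (sphere_area DIM('a) * r ^ (DIM('a) - 1))"
  have "has_bochner_integral lborel (\<lambda>r. sphere_area DIM('a) * (indicator {0..} r * (f r * r ^ (DIM('a) - 1))))
      (sphere_area DIM('a) * I)"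
    by (rule has_bochner_integral_mult_right[OF assms(1)])
  then have "has_bochner_integral lborel (\<lambda>r. ?g r *\<^sub>R f r) (sphere_area DIM('a) * I)"
    by (simp add: mult_ac)
  then have "has_bochner_integral (density lborel (\<lambda>r. ennreal (?g r))) f (sphere_area DIM('a) * I)"
    by (subst has_bochner_integral_density) (auto simp: sphere_area_nonneg indicator_def)
  then have "has_bochner_integral (distr lborel borel (norm :: 'a \<Rightarrow> real)) f (sphere_area DIM('a) * I)"
    by (simp only: distr_norm_lborel)
  then show ?thesis
    by (simp add: has_bochner_integral_iff integrable_distr_eq integral_distr)
qed

text \<open>The exponent is measured by its excess \<open>c\<close> over the critical value
  \<open>- d\<close>. The kernel of negative order \<open>a\<close> has \<open>c = - a\<close>, and
  the kernel times a second difference has \<open>c = 2 - a\<close>.\<close>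

lemma has_bochner_integral_norm_powr_ball:
  fixes c \<delta> :: real
  assumes "c > 0" "\<delta> \<ge> 0"
  shows "has_bochner_integral lborel (\<lambda>h::'a::euclidean_space. indicator {h. norm h \<le> \<delta>} h * norm h powr (c - DIM('a)))
    (sphere_area DIM('a) * (\<delta> powr c / c))"
proof -
  have "((\<lambda>x. x powr (c - 1)) has_integral (\<delta> powr c / c)) {0..\<delta>}"
    using has_integral_powr_from_0[of "c - 1" \<delta>] assms by simp
  then have "has_bochner_integral lborel (\<lambda>r. indicator {0..\<delta>} r * r powr (c - 1)) (\<delta> powr c / c)"
    by (intro has_bochner_integral_indicator_has_integral) auto
  also have "?this \<longleftrightarrow> has_bochner_integral lborel
      (\<lambda>r. indicator {0..} r * ((indicator {..\<delta>} r * r powr (c - DIM('a))) * r ^ (DIM('a) - 1))) (\<delta> powr c / c)"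
  proof (rule has_bochner_integral_cong_AE)
    show "AE r in lborel. indicator {0..\<delta>} r * r powr (c - 1) =
        indicator {0..} r * ((indicator {..\<delta>} r * r powr (c - DIM('a))) * r ^ (DIM('a) - 1))"
    proof (rule AE_mp[OF AE_lborel_singleton[of 0]], rule AE_I2, rule impI)
      fix r :: real assume "r \<noteq> 0"
      have "r powr (c - DIM('a)) * r ^ (DIM('a) - 1) = r powr (c - 1)" if "r > 0"
        using that by (simp add: powr_realpow[symmetric] powr_add[symmetric] of_nat_diff DIM_positive Suc_leI)
      then show "indicator {0..\<delta>} r * r powr (c - 1) =
        indicator {0..} r * ((indicator {..\<delta>} r * r powr (c - DIM('a))) * r ^ (DIM('a) - 1))"
        using \<open>r \<noteq> 0\<close> by (auto simp: indicator_def)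
    qed
  qed auto
  finally have "has_bochner_integral lborel (\<lambda>h::'a. indicator {..\<delta>} (norm h) * norm h powr (c - DIM('a)))
      (sphere_area DIM('a) * (\<delta> powr c / c))"
    by (intro has_bochner_integral_radial[where f = "\<lambda>r. indicator {..\<delta>} r * r powr (c - DIM('a))"]) auto
  then show ?thesis by (simp add: indicator_def)
qed

lemma has_bochner_integral_norm_powr_outside:
  fixes a \<delta> :: real
  assumes "a > 0" "\<delta> > 0"
  shows "has_bochner_integral lborel (\<lambda>h::'a::euclidean_space. indicator {h. \<delta> < norm h} h * norm h powr (- a - DIM('a)))
    (sphere_area DIM('a) * (\<delta> powr (- a) / a))"
proof -
  have "((\<lambda>x. x powr (- a - 1)) has_integral (\<delta> powr (- a) / a)) {\<delta>..}"
    using has_integral_powr_to_inf[of "- a - 1" \<delta>] assms by simp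
  then have "has_bochner_integral lborel (\<lambda>r. indicator {\<delta>..} r * r powr (- a - 1)) (\<delta> powr (- a) / a)"
    by (intro has_bochner_integral_indicator_has_integral) auto
  also have "?this \<longleftrightarrow> has_bochner_integral lborel
      (\<lambda>r. indicator {0..} r * ((indicator {\<delta><..} r * r powr (- a - DIM('a))) * r ^ (DIM('a) - 1))) (\<delta> powr (- a) / a)"
  proof (rule has_bochner_integral_cong_AE)
    show "AE r in lborel. indicator {\<delta>..} r * r powr (- a - 1) =
        indicator {0..} r * ((indicator {\<delta><..} r * r powr (- a - DIM('a))) * r ^ (DIM('a) - 1))"
    proof (rule AE_mp[OF AE_lborel_singleton[of \<delta>]], rule AE_I2, rule impI)
      fix r :: real assume "r \<noteq> \<delta>"
      have "r powr (- a - DIM('a)) * r ^ (DIM('a) - 1) = r powr (- a - 1)" if "r > 0"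
        using that by (simp add: powr_realpow[symmetric] powr_add[symmetric] of_nat_diff DIM_positive Suc_leI)
      then show "indicator {\<delta>..} r * r powr (- a - 1) =
        indicator {0..} r * ((indicator {\<delta><..} r * r powr (- a - DIM('a))) * r ^ (DIM('a) - 1))"
        using \<open>r \<noteq> \<delta>\<close> assms by (auto simp: indicator_def)
    qed
  qed auto
  finally have "has_bochner_integral lborel (\<lambda>h::'a. indicator {\<delta><..} (norm h) * norm h powr (- a - DIM('a)))
      (sphere_area DIM('a) * (\<delta> powr (- a) / a))"
    by (intro has_bochner_integral_radial[where f = "\<lambda>r. indicator {\<delta><..} r * r powr (- a - DIM('a))"]) auto
  then show ?thesis by (simp add: indicator_def)
qed

lemma has_integral_one_minus_powr:
  assumes "p > -1"
  shows "((\<lambda>x. (1 - x) powr p) has_integral (1 / (p + 1))) {0..1::real}"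
proof -
  have "((\<lambda>x. x powr p) has_integral (1 / (p + 1))) {0..1::real}"
    using has_integral_powr_from_0[of p 1] assms by simp
  from has_integral_affinity[OF this[unfolded cbox_interval[symmetric]], of "-1" 1] show ?thesis
    by (simp add: image_affinity_atLeastAtMost_diff)
qed

text \<open>Factor \<open>1 - r\<^sup>2\<close> into \<open>1 - r\<close> and \<open>1 + r\<close>.
  The second factor lies between 1 and 2, so its power is at most \<open>max 1 (2 powr p)\<close>
  for either sign of \<open>p\<close>, and the first is integrable at 1 because
  \<open>p > -1\<close>.\<close>

lemma integrable_ball_powr:
  assumes "p > -1"
  shows "integrable lborel (\<lambda>y::'a::euclidean_space. if norm y < 1 then (1 - (norm y)\<^sup>2) powr p else 0)"
proof -
  define f where "f r = (if r < 1 then (1 - r\<^sup>2) powr p else 0 :: real)" for r :: real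
  have [measurable]: "f \<in> borel_measurable borel" unfolding f_def by measurable
  have 1: "integrable lborel (\<lambda>r. indicator {0..1} r * (1 - r) powr p)"
    using has_bochner_integral_indicator_has_integral[OF has_integral_one_minus_powr[OF assms]]
    by (auto simp: has_bochner_integral_iff)
  have "integrable lborel (\<lambda>r. indicator {0..} r * (f r * r ^ (DIM('a) - 1)))"
  proof (rule Bochner_Integration.integrable_bound[OF integrable_mult_right[OF 1, of "max 1 (2 powr p)"]])
    show "AE r in lborel. norm (indicator {0..} r * (f r * r ^ (DIM('a) - 1)))
        \<le> norm (max 1 (2 powr p) * (indicator {0..1} r * (1 - r) powr p))"
    proof (rule AE_I2)
      fix r :: real
      show "norm (indicator {0..} r * (f r * r ^ (DIM('a) - 1)))
        \<le> norm (max 1 (2 powr p) * (indicator {0..1} r * (1 - r) powr p))"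
      proof (cases "0 \<le> r \<and> r < 1")
        case True
        then have r: "0 \<le> r" "r < 1" by auto
        have "f r = (1 - r) powr p * (1 + r) powr p"
          using r by (simp add: f_def power2_eq_square powr_mult[symmetric] algebra_simps)
        also have "(1 + r) powr p \<le> max 1 (2 powr p)"
        proof (cases "p \<ge> 0")
          case True
          then have "(1 + r) powr p \<le> 2 powr p" using r by (intro powr_mono2) auto
          then show ?thesis by simp
        next
          case False
          then have "(1 + r) powr p \<le> 1 powr p" using r by (intro powr_mono2') auto
          then show ?thesis by simp
        qed
        finally have "f r \<le> (1 - r) powr p * max 1 (2 powr p)" by (simp add: mult_left_mono)
        moreover have "f r \<ge> 0" using r by (simp add: f_def)
        moreover have "f r * r ^ (DIM('a) - 1) \<le> f r * 1"
          using r \<open>f r \<ge> 0\<close> by (intro mult_left_mono power_le_one) auto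
        ultimately have "f r * r ^ (DIM('a) - 1) \<le> max 1 (2 powr p) * (1 - r) powr p"
          by (simp add: mult.commute)
        moreover have "0 \<le> f r * r ^ (DIM('a) - 1)" using r \<open>f r \<ge> 0\<close> by simp
        ultimately show ?thesis using r by (simp add: abs_mult)
      next
        case False
        then have "indicator {0..} r * (f r * r ^ (DIM('a) - 1)) = 0" by (auto simp: f_def indicator_def)
        then show ?thesis by (simp only: norm_zero) simp
      qed
    qed
  qed measurable
  then obtain I where "has_bochner_integral lborel (\<lambda>r. indicator {0..} r * (f r * r ^ (DIM('a) - 1))) I"
    by (auto simp: has_bochner_integral_iff)
  from has_bochner_integral_radial[where 'a='a, OF this] show ?thesis
    by (auto simp: has_bochner_integral_iff f_def)
qed

section \<open>Holomorphic dependence on the order\<close>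

lemma norm_integral_le:
  fixes f :: "'m \<Rightarrow> 'b::{banach, second_countable_topology}"
  assumes "integrable M f" "integrable M g" "\<And>x. norm (f x) \<le> g x"
  shows "norm (\<integral>x. f x \<partial>M) \<le> (\<integral>x. g x \<partial>M)"
  using assms by (intro order_trans[OF integral_norm_bound] integral_mono integrable_norm) auto

lemma norm_exp_minus_linear_le: "norm (exp z - 1 - z) \<le> exp (norm z) * (norm z)\<^sup>2" for z :: complex
proof -
  have "norm (exp z - (\<Sum>i\<le>1. z ^ i / fact i)) \<le> exp (norm z) * norm z ^ 2"
    using Taylor_exp_field[of z 1] by (simp add: numeral_2_eq_2)
  then show ?thesis by (simp add: algebra_simps)
qed

text \<open>Trades a polynomial factor for exponential growth of arbitrarily small rate. The squared
  logarithms produced by differentiating in the order are absorbed this way.\<close>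

lemma square_le_exp_abs:
  fixes x r :: real
  assumes "r > 0"
  shows "x\<^sup>2 \<le> 2 / r\<^sup>2 * exp (r * \<bar>x\<bar>)"
proof -
  have "(r * \<bar>x\<bar>)\<^sup>2 / 2 \<le> 1 + r * \<bar>x\<bar> + (r * \<bar>x\<bar>)\<^sup>2 / 2" using assms by simp
  also have "\<dots> \<le> exp (r * \<bar>x\<bar>)" using assms by (intro exp_lower_Taylor_quadratic) simp
  finally show ?thesis using assms by (simp add: field_simps)
qed

text \<open>The Taylor remainder in \<open>w\<close> is controlled by exponentials with real rates.
  Of the shift \<open>2 * r\<close>, one \<open>r\<close> bounds the size of \<open>w\<close> and
  the other pays for the factor \<open>x\<^sup>2\<close>; the sum of two exponentials covers both
  signs of \<open>x\<close>.\<close>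

lemma norm_exp_diff_quotient_le:
  fixes z w :: complex and x r :: real
  assumes "r > 0" "norm w \<le> r"
  shows "norm (exp ((z + w) * of_real x) - exp (z * of_real x) - w * (of_real x * exp (z * of_real x)))
    \<le> (norm w)\<^sup>2 * (2 / r\<^sup>2 * (exp ((Re z + 2 * r) * x) + exp ((Re z - 2 * r) * x)))"
proof -
  have "exp ((z + w) * of_real x) - exp (z * of_real x) - w * (of_real x * exp (z * of_real x))
      = exp (z * of_real x) * (exp (w * of_real x) - 1 - w * of_real x)"
    by (simp add: exp_add algebra_simps)
  then have eq: "norm (exp ((z + w) * of_real x) - exp (z * of_real x) - w * (of_real x * exp (z * of_real x)))
      = exp (Re z * x) * norm (exp (w * of_real x) - 1 - w * of_real x)"
    by (simp add: norm_mult)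
  have "norm (exp (w * of_real x) - 1 - w * of_real x)
      \<le> exp (norm (w * of_real x)) * (norm (w * of_real x))\<^sup>2"
    by (rule norm_exp_minus_linear_le)
  also have "\<dots> = (norm w)\<^sup>2 * (exp (norm w * \<bar>x\<bar>) * x\<^sup>2)"
    by (simp add: norm_mult power_mult_distrib)
  also have "\<dots> \<le> (norm w)\<^sup>2 * (exp (r * \<bar>x\<bar>) * (2 / r\<^sup>2 * exp (r * \<bar>x\<bar>)))"
    using assms by (intro mult_left_mono mult_mono square_le_exp_abs) (auto intro!: mult_right_mono)
  also have "\<dots> = (norm w)\<^sup>2 * (2 / r\<^sup>2 * exp (2 * r * \<bar>x\<bar>))"
    by (simp add: exp_add[symmetric])
  also have "\<dots> \<le> (norm w)\<^sup>2 * (2 / r\<^sup>2 * (exp (2 * r * x) + exp (- 2 * r * x)))"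
    by (intro mult_left_mono) (cases "x \<ge> 0", auto)
  finally have "exp (Re z * x) * norm (exp (w * of_real x) - 1 - w * of_real x)
      \<le> exp (Re z * x) * ((norm w)\<^sup>2 * (2 / r\<^sup>2 * (exp (2 * r * x) + exp (- 2 * r * x))))"
    by (intro mult_left_mono) auto
  also have "\<dots> = (norm w)\<^sup>2 * (2 / r\<^sup>2 * (exp (Re z * x) * exp (2 * r * x) + exp (Re z * x) * exp (- 2 * r * x)))"
    by (simp only: distrib_left mult_ac)
  also have "\<dots> = (norm w)\<^sup>2 * (2 / r\<^sup>2 * (exp ((Re z + 2 * r) * x) + exp ((Re z - 2 * r) * x)))"
    unfolding exp_add[symmetric] by (simp add: algebra_simps)
  finally show ?thesis unfolding eq .
qed

lemma has_field_derivative_quadratic_remainder: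
  fixes F :: "complex \<Rightarrow> complex"
  assumes "r > 0" "\<And>w. norm w \<le> r \<Longrightarrow> norm (F (z + w) - F z - w * D) \<le> K * (norm w)\<^sup>2"
  shows "(F has_field_derivative D) (at z)"
proof -
  have K: "K \<ge> 0"
    using order_trans[OF norm_ge_zero assms(2)[of "of_real r"]] assms(1) by (simp add: zero_le_mult_iff)
  have "(\<lambda>w. (F (z + w) - F z) / w - D) \<midarrow>0\<rightarrow> 0"
  proof (rule Lim_null_comparison)
    show "\<forall>\<^sub>F w in at 0. norm ((F (z + w) - F z) / w - D) \<le> K * norm w"
      unfolding eventually_at
    proof (intro exI[of _ r] conjI ballI impI)
      fix w :: complex assume w: "w \<noteq> 0 \<and> dist w 0 < r"
      then have "norm ((F (z + w) - F z) / w - D) = norm (F (z + w) - F z - w * D) / norm w"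
        by (simp add: norm_divide[symmetric] field_simps)
      also have "\<dots> \<le> K * (norm w)\<^sup>2 / norm w"
        using w assms(2)[of w] by (intro divide_right_mono) auto
      also have "\<dots> = K * norm w" using w by (simp add: power2_eq_square)
      finally show "norm ((F (z + w) - F z) / w - D) \<le> K * norm w" .
    qed (rule assms(1))
    show "((\<lambda>w::complex. K * norm w) \<longlongrightarrow> 0) (at 0)"
      by (rule tendsto_eq_intros refl | simp)+
  qed
  then show ?thesis unfolding DERIV_def by (rule LIM_zero_cancel)
qed

text \<open>Complex differentiability of a Mellin-type integral from absolute convergence at real
  exponents alone: the quadratic remainder bound survives integration, so it holds for the integral
  with a constant independent of \<open>w\<close>.\<close>

lemma holomorphic_on_exponential_integral:
  fixes f L :: "'m \<Rightarrow> real"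
  assumes int: "\<And>c. A < c \<Longrightarrow> c < B \<Longrightarrow> integrable M (\<lambda>x. f x * exp (c * L x))"
    and [measurable]: "f \<in> borel_measurable M" "L \<in> borel_measurable M"
  shows "(\<lambda>z. \<integral>x. of_real (f x) * exp (z * of_real (L x)) \<partial>M) holomorphic_on {z::complex. A < Re z \<and> Re z < B}"
    (is "?F holomorphic_on ?S")
proof -
  have "open ?S"
    by (intro open_Collect_conj open_halfspace_Re_gt open_halfspace_Re_lt)
  have intz: "integrable M (\<lambda>x. of_real (f x) * exp (z * of_real (L x)))" if "A < Re z" "Re z < B" for z
  proof (rule Bochner_Integration.integrable_bound[OF int[OF that]])
    show "AE x in M. norm (of_real (f x) * exp (z * of_real (L x))) \<le> norm (f x * exp (Re z * L x))"
      by (simp add: norm_mult)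
  qed measurable
  have "\<exists>D. (?F has_field_derivative D) (at z)" if z: "z \<in> ?S" for z
  proof -
    \<comment> \<open>A quarter of the distance to the boundary, so that the rates
      \<open>Re z + 2 * r\<close> and \<open>Re z - 2 * r\<close> used by the bound stay inside the
      strip.\<close>
    define r where "r = min (Re z - A) (B - Re z) / 4"
    have r: "r > 0" "Re z + 2 * r < B" "A < Re z - 2 * r" using z by (auto simp: r_def min_def field_simps)
    define G where "G x = \<bar>f x\<bar> * (2 / r\<^sup>2 * (exp ((Re z + 2 * r) * L x) + exp ((Re z - 2 * r) * L x)))" for x
    have "integrable M (\<lambda>x. 2 / r\<^sup>2 * (norm (f x * exp ((Re z + 2 * r) * L x)) + norm (f x * exp ((Re z - 2 * r) * L x))))"
      using r by (intro integrable_mult_right Bochner_Integration.integrable_add integrable_norm int) auto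
    also have "?this \<longleftrightarrow> integrable M G"
      by (rule Bochner_Integration.integrable_cong) (auto simp: G_def abs_mult algebra_simps)
    finally have G: "integrable M G" .
    define g where "g x = of_real (f x) * (of_real (L x) * exp (z * of_real (L x)))" for x
    have [measurable]: "g \<in> borel_measurable M" unfolding g_def by measurable
    have bnd: "norm (of_real (f x) * exp ((z + w) * of_real (L x)) - of_real (f x) * exp (z * of_real (L x)) - w * g x)
        \<le> (norm w)\<^sup>2 * G x" if "norm w \<le> r" for x w
    proof -
      have "of_real (f x) * exp ((z + w) * of_real (L x)) - of_real (f x) * exp (z * of_real (L x)) - w * g x
          = of_real (f x) * (exp ((z + w) * of_real (L x)) - exp (z * of_real (L x)) - w * (of_real (L x) * exp (z * of_real (L x))))"
        by (simp add: g_def algebra_simps)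
      then have "norm (of_real (f x) * exp ((z + w) * of_real (L x)) - of_real (f x) * exp (z * of_real (L x)) - w * g x)
          = \<bar>f x\<bar> * norm (exp ((z + w) * of_real (L x)) - exp (z * of_real (L x)) - w * (of_real (L x) * exp (z * of_real (L x))))"
        by (simp add: norm_mult)
      also have "\<dots> \<le> \<bar>f x\<bar> * ((norm w)\<^sup>2 * (2 / r\<^sup>2 * (exp ((Re z + 2 * r) * L x) + exp ((Re z - 2 * r) * L x))))"
        by (intro mult_left_mono norm_exp_diff_quotient_le r that) auto
      also have "\<dots> = (norm w)\<^sup>2 * G x" by (simp add: G_def)
      finally show ?thesis .
    qed
    have inzw: "integrable M (\<lambda>x. of_real (f x) * exp ((z + w) * of_real (L x)))" if "norm w \<le> r" for w
    proof (rule intz)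
      have "\<bar>Re w\<bar> \<le> r" using that abs_Re_le_cmod order_trans by blast
      then show "A < Re (z + w)" "Re (z + w) < B" using r by auto
    qed
    have inz: "integrable M (\<lambda>x. of_real (f x) * exp (z * of_real (L x)))" using intz z by auto
    \<comment> \<open>The candidate derivative is integrable because a single increment with step
      \<open>r\<close> is, and the remainder left after subtracting \<open>r\<close> times the
      candidate is dominated by \<open>r\<^sup>2 * G x\<close>.\<close>
    have ing: "integrable M g"
    proof -
      define h where "h x = of_real (f x) * exp ((z + of_real r) * of_real (L x)) - of_real (f x) * exp (z * of_real (L x))" for x
      have h: "integrable M h"
        unfolding h_def using r by (intro Bochner_Integration.integrable_diff inzw inz) auto
      then have [measurable]: "h \<in> borel_measurable M" by simp
      have "integrable M (\<lambda>x. h x - of_real r * g x)"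
      proof (rule Bochner_Integration.integrable_bound[OF integrable_mult_right[OF G, of "r\<^sup>2"]])
        have "norm (h x - of_real r * g x) \<le> r\<^sup>2 * G x" for x
          using bnd[of "of_real r" x] r by (simp add: h_def)
        then show "AE x in M. norm (h x - of_real r * g x) \<le> norm (r\<^sup>2 * G x)"
          by (intro AE_I2) (auto intro: order_trans[OF _ abs_ge_self])
      qed measurable
      from Bochner_Integration.integrable_diff[OF h this] have "integrable M (\<lambda>x. of_real r * g x)"
        by (simp only: diff_diff_eq2 add_diff_cancel_left')
      then have "integrable M (\<lambda>x. inverse (of_real r) * (of_real r * g x))" by (rule integrable_mult_right)
      then show ?thesis using r by (simp add: mult.assoc[symmetric])
    qed
    have "(?F has_field_derivative (\<integral>x. g x \<partial>M)) (at z)"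
    proof (rule has_field_derivative_quadratic_remainder[OF r(1)])
      fix w :: complex assume w: "norm w \<le> r"
      have "?F (z + w) - ?F z - w * (\<integral>x. g x \<partial>M)
          = (\<integral>x. of_real (f x) * exp ((z + w) * of_real (L x)) - of_real (f x) * exp (z * of_real (L x)) - w * g x \<partial>M)"
        by (simp only: Bochner_Integration.integral_diff Bochner_Integration.integrable_diff integral_mult_right_zero
            integrable_mult_right inzw[OF w] inz ing)
      also have "norm \<dots> \<le> (\<integral>x. (norm w)\<^sup>2 * G x \<partial>M)"
        by (intro norm_integral_le Bochner_Integration.integrable_diff integrable_mult_right inzw[OF w] inz ing G bnd[OF w])
      finally show "norm (?F (z + w) - ?F z - w * (\<integral>x. g x \<partial>M)) \<le> (\<integral>x. G x \<partial>M) * (norm w)\<^sup>2"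
        by (simp add: mult.commute)
    qed
    then show ?thesis by blast
  qed
  then show ?thesis
    using \<open>open ?S\<close> by (auto simp: holomorphic_on_open)
qed

section \<open>The hypergeometric series\<close>

lemma norm_pochhammer_le:
  fixes z :: complex
  assumes "norm z \<le> K"
  shows "norm (pochhammer z n) \<le> pochhammer K n"
proof -
  have "norm (pochhammer z n) = (\<Prod>i = 0..<n. norm (z + of_nat i))"
    by (simp add: pochhammer_prod prod_norm)
  also have "\<dots> \<le> (\<Prod>i = 0..<n. K + of_nat i)"
    using assms by (intro prod_mono) (auto intro: order_trans[OF norm_triangle_ineq])
  finally show ?thesis by (simp add: pochhammer_prod)
qed

lemma summable_hypergeometric:
  fixes K \<theta> X :: real
  assumes "K > 0" "\<theta> > 0" "0 \<le> X" "X < 1"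
  shows "summable (\<lambda>n. pochhammer K n * pochhammer K n / pochhammer \<theta> n * (X ^ n / fact n))"
proof -
  define a where "a n = pochhammer K n * pochhammer K n / pochhammer \<theta> n * (X ^ n / fact n)" for n
  \<comment> \<open>The quotient of consecutive terms. It tends to \<open>X\<close>, so the midpoint
    \<open>(1 + X) / 2\<close> eventually bounds it and is still below 1.\<close>
  define q where "q n = (K + real n)\<^sup>2 / ((\<theta> + real n) * (real n + 1)) * X" for n
  have a_nonneg: "a n \<ge> 0" for n
    using assms by (auto simp: a_def intro!: divide_nonneg_nonneg mult_nonneg_nonneg pochhammer_nonneg)
  have step: "a (Suc n) = q n * a n" for n
    using assms by (simp add: a_def q_def pochhammer_Suc power2_eq_square field_simps)
  have "(\<lambda>n. (K + real n)\<^sup>2 / ((\<theta> + real n) * (real n + 1))) \<longlonglongrightarrow> 1"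
    by real_asymp
  then have "q \<longlonglongrightarrow> 1 * X" unfolding q_def by (intro tendsto_intros)
  then have "\<forall>\<^sub>F n in sequentially. q n < (1 + X) / 2"
    using assms by (intro order_tendstoD) auto
  then obtain N where N: "\<And>n. n \<ge> N \<Longrightarrow> q n < (1 + X) / 2" by (auto simp: eventually_sequentially)
  show ?thesis
    unfolding a_def[symmetric]
  proof (rule summable_ratio_test[of "(1 + X) / 2" N])
    show "(1 + X) / 2 < 1" using assms by simp
    show "norm (a (Suc n)) \<le> (1 + X) / 2 * norm (a n)" if "n \<ge> N" for n
    proof -
      have "a (Suc n) \<le> (1 + X) / 2 * a n"
        unfolding step using N[OF that] a_nonneg[of n] by (intro mult_right_mono) auto
      then show ?thesis using a_nonneg[of n] a_nonneg[of "Suc n"] by simp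
    qed
  qed
qed

text \<open>Both upper parameters move with \<open>z\<close>, as they move with half the order in
  the final formula. The terms are polynomials in \<open>z\<close>, and on each closed unit disc one
  bound \<open>K\<close> on the parameters gives a summable majorant.\<close>

lemma holomorphic_hypergeometric:
  fixes a b \<theta> X :: real
  assumes "\<theta> > 0" "0 \<le> X" "X < 1"
  shows "(\<lambda>z. \<Sum>n. pochhammer (of_real a + z) n * pochhammer (of_real b + z) n
      / of_real (pochhammer \<theta> n) * of_real (X ^ n / fact n) :: complex) holomorphic_on UNIV"
    (is "(\<lambda>z. \<Sum>n. ?t n z) holomorphic_on UNIV")
proof (rule holomorphic_uniform_sequence[where f = "\<lambda>N z. \<Sum>n<N. ?t n z"])
  have nz: "complex_of_real (pochhammer \<theta> n) \<noteq> 0" for n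
    using pochhammer_pos[of \<theta> n] assms by simp
  have "?t n holomorphic_on UNIV" for n
    unfolding pochhammer_prod[of "_ + _"] by (intro holomorphic_intros nz)
  then show "(\<lambda>z. \<Sum>n<N. ?t n z) holomorphic_on UNIV" for N
    by (rule holomorphic_on_sum)
  fix z0 :: complex
  define K where "K = \<bar>a\<bar> + \<bar>b\<bar> + norm z0 + 1"
  have "uniform_limit (cball z0 1) (\<lambda>N z. \<Sum>n<N. ?t n z) (\<lambda>z. \<Sum>n. ?t n z) sequentially"
  proof (rule Weierstrass_m_test)
    show "summable (\<lambda>n. pochhammer K n * pochhammer K n / pochhammer \<theta> n * (X ^ n / fact n))"
      by (rule summable_hypergeometric) (use assms in \<open>auto simp: K_def intro!: add_nonneg_pos\<close>)
    fix n z assume "z \<in> cball z0 1"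
    then have "norm z \<le> norm z0 + 1" using norm_triangle_sub[of z z0] by (auto simp: dist_norm norm_minus_commute)
    moreover have "norm (of_real a + z) \<le> \<bar>a\<bar> + norm z" "norm (of_real b + z) \<le> \<bar>b\<bar> + norm z"
      using norm_triangle_ineq[of "of_real a" z] norm_triangle_ineq[of "of_real b" z] by auto
    ultimately have K: "norm (of_real a + z) \<le> K" "norm (of_real b + z) \<le> K"
      by (auto simp: K_def)
    have pos: "pochhammer \<theta> n > 0" using assms by (intro pochhammer_pos)
    have "norm (?t n z) = norm (pochhammer (of_real a + z) n) * norm (pochhammer (of_real b + z) n)
        / pochhammer \<theta> n * (X ^ n / fact n)"
      using assms pos by (simp add: norm_mult norm_divide norm_power)
    also have "\<dots> \<le> pochhammer K n * pochhammer K n / pochhammer \<theta> n * (X ^ n / fact n)"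
      using assms pos
      by (intro mult_right_mono divide_right_mono mult_mono norm_pochhammer_le K)
         (auto simp: K_def intro!: pochhammer_nonneg add_nonneg_pos)
    finally show "norm (?t n z) \<le> pochhammer K n * pochhammer K n / pochhammer \<theta> n * (X ^ n / fact n)" .
  qed
  then show "\<exists>d>0. cball z0 d \<subseteq> UNIV \<and> uniform_limit (cball z0 d) (\<lambda>N z. \<Sum>n<N. ?t n z) (\<lambda>z. \<Sum>n. ?t n z) sequentially"
    by (intro exI[of _ 1]) simp
qed simp

section \<open>Binomial series and Euler's integral\<close>

lemma Beta_plus_nat:
  fixes a b :: real
  assumes "a > 0" "b > 0"
  shows "Beta (a + real n) b = Beta a b * pochhammer a n / pochhammer (a + b) n"
proof -
  have "pochhammer (a + b) n > 0" "Gamma (a + b + real n) > 0" "Gamma (a + b) > 0" "Gamma a > 0"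
    using assms by (auto intro!: pochhammer_pos Gamma_real_pos)
  moreover have "pochhammer a n = Gamma (a + real n) / Gamma a" "pochhammer (a + b) n = Gamma (a + b + real n) / Gamma (a + b)"
    using assms by (auto intro!: pochhammer_Gamma simp: nonpos_Ints_def)
  ultimately show ?thesis
    by (simp add: Beta_def field_simps)
qed

lemma pochhammer_binomial_series:
  fixes c y :: real
  assumes "\<bar>y\<bar> < 1"
  shows "(\<lambda>n. pochhammer c n / fact n * y ^ n) sums (1 - y) powr (- c)"
proof -
  have "(\<lambda>n. (- c gchoose n) * (- y) ^ n) sums (1 + - y) powr (- c)"
    by (rule gen_binomial_real) (use assms in simp)
  moreover have "(- c gchoose n) * (- y) ^ n = pochhammer c n / fact n * y ^ n" for n
    by (simp add: gbinomial_pochhammer power_minus[of y] mult_ac)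
  ultimately show ?thesis by simp
qed

text \<open>Expand the factor containing \<open>X\<close> in its binomial series and integrate
  termwise; each term is a Beta integral whose first argument is shifted by \<open>n\<close>. Since
  these Beta values decrease in \<open>n\<close>, absolute convergence of the binomial series
  justifies the exchange.\<close>

lemma Euler_integral_hyp2F1:
  fixes \<nu> b c X :: real
  assumes "\<nu> > 0" "b > 0" "0 \<le> X" "X < 1"
  shows "has_bochner_integral lborel
    (\<lambda>w. indicator {0..1} w * (w powr (\<nu> - 1) * (1 - w) powr (b - 1) * (1 - X * w) powr (- c)))
    (Beta \<nu> b * hyp2F1 \<nu> c (\<nu> + b) X)"
proof -
  define k where "k n = pochhammer c n / fact n * X ^ n" for n
  define f where "f n w = k n * (indicator {0..1} w * (w powr (\<nu> + real n - 1) * (1 - w) powr (b - 1)))" for n w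
  have fint: "has_bochner_integral lborel (f n) (k n * Beta (\<nu> + real n) b)" for n
    unfolding f_def
  proof (rule has_bochner_integral_mult_right, rule has_bochner_integral_indicator_has_integral)
    show "((\<lambda>w. w powr (\<nu> + real n - 1) * (1 - w) powr (b - 1)) has_integral Beta (\<nu> + real n) b) {0..1}"
      using assms by (intro has_integral_Beta_real) auto
  qed auto
  have abs_k: "summable (\<lambda>n. \<bar>k n\<bar>)"
  proof -
    \<comment> \<open>A point strictly between \<open>X\<close> and 1: convergence of the power
      series there gives absolute convergence at \<open>X\<close>.\<close>
    define y where "y = (X + 1) / 2"
    have "summable (\<lambda>n. pochhammer c n / fact n * y ^ n)"
      using pochhammer_binomial_series[of y c] assms by (auto simp: y_def sums_iff)
    then have "summable (\<lambda>n. norm (pochhammer c n / fact n * X ^ n))"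
      by (rule powser_insidea) (use assms in \<open>auto simp: y_def\<close>)
    then show ?thesis by (simp add: k_def)
  qed
  have f_sums: "(\<lambda>n. f n w) sums
      (indicator {0..1} w * (w powr (\<nu> - 1) * (1 - w) powr (b - 1) * (1 - X * w) powr (- c)))"
    if "w \<noteq> 0" for w
  proof (cases "w \<in> {0..1}")
    case True
    have Xw: "X * w \<le> X" "0 \<le> X * w" using assms True by (auto intro: mult_left_le)
    then have "(\<lambda>n. pochhammer c n / fact n * (X * w) ^ n) sums (1 - X * w) powr (- c)"
      using assms by (intro pochhammer_binomial_series) auto
    then have "(\<lambda>n. (w powr (\<nu> - 1) * (1 - w) powr (b - 1)) * (pochhammer c n / fact n * (X * w) ^ n))
        sums ((w powr (\<nu> - 1) * (1 - w) powr (b - 1)) * (1 - X * w) powr (- c))"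
      by (rule sums_mult)
    moreover have "w powr (\<nu> + real n - 1) = w powr (\<nu> - 1) * w ^ n" for n
      using True that by (simp add: powr_realpow[symmetric] powr_add[symmetric] algebra_simps)
    ultimately show ?thesis
      using True by (simp add: f_def k_def power_mult_distrib mult_ac)
  next
    case False
    then show ?thesis by (simp add: f_def)
  qed
  have beta_le: "Beta (\<nu> + real n) b \<le> Beta \<nu> b" "0 \<le> Beta (\<nu> + real n) b" for n
  proof -
    show "Beta (\<nu> + real n) b \<le> Beta \<nu> b"
      by (cases "n = 0") (use assms in \<open>auto intro!: Beta_real_mono\<close>)
    show "0 \<le> Beta (\<nu> + real n) b"
      using assms by (auto simp: Beta_def intro!: divide_nonneg_nonneg mult_nonneg_nonneg less_imp_le[OF Gamma_real_pos])
  qed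
  have norm_int: "(\<integral>w. norm (f n w) \<partial>lborel) = \<bar>k n\<bar> * Beta (\<nu> + real n) b" for n
  proof -
    have "norm (f n w) = \<bar>k n\<bar> * (indicator {0..1} w * (w powr (\<nu> + real n - 1) * (1 - w) powr (b - 1)))" for w
      by (simp add: f_def abs_mult indicator_def)
    moreover have "has_bochner_integral lborel (\<lambda>w. \<bar>k n\<bar> * (indicator {0..1} w * (w powr (\<nu> + real n - 1) * (1 - w) powr (b - 1))))
        (\<bar>k n\<bar> * Beta (\<nu> + real n) b)"
    proof (rule has_bochner_integral_mult_right, rule has_bochner_integral_indicator_has_integral)
      show "((\<lambda>w. w powr (\<nu> + real n - 1) * (1 - w) powr (b - 1)) has_integral Beta (\<nu> + real n) b) {0..1}"
        using assms by (intro has_integral_Beta_real) auto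
    qed auto
    ultimately show ?thesis by (simp only: has_bochner_integral_integral_eq)
  qed
  have sum_int: "summable (\<lambda>n. \<integral>w. norm (f n w) \<partial>lborel)"
    unfolding norm_int
  proof (rule summable_comparison_test'[OF summable_mult2[OF abs_k, of "Beta \<nu> b"], of 0])
    show "norm (\<bar>k n\<bar> * Beta (\<nu> + real n) b) \<le> \<bar>k n\<bar> * Beta \<nu> b" for n
      using beta_le[of n] by (simp add: abs_mult mult_left_mono)
  qed
  have ae_sum: "AE w in lborel. summable (\<lambda>n. norm (f n w))"
  proof (rule AE_mp[OF AE_lborel_singleton[of 0]], rule AE_I2, rule impI)
    fix w :: real assume "w \<noteq> 0"
    define C where "C = indicator {0..1} w * (w powr (\<nu> - 1) * (1 - w) powr (b - 1))"
    have "norm (f n w) \<le> \<bar>k n\<bar> * C" for n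
    proof (cases "w \<in> {0..1}")
      case True
      with \<open>w \<noteq> 0\<close> have "w powr (\<nu> + real n - 1) \<le> w powr (\<nu> - 1)"
        by (intro powr_mono') auto
      then show ?thesis
        using True by (auto simp: f_def C_def abs_mult intro!: mult_left_mono mult_right_mono)
    qed (simp add: f_def C_def)
    then show "summable (\<lambda>n. norm (f n w))"
      by (intro summable_comparison_test'[OF summable_mult2[OF abs_k, of C], of 0]) auto
  qed
  have f_integrable: "integrable lborel (f n)" for n using fint[of n] by (simp add: has_bochner_integral_iff)
  note suminf = integrable_suminf[OF f_integrable ae_sum sum_int] integral_suminf[OF f_integrable ae_sum sum_int]
  have "has_bochner_integral lborel (\<lambda>w. \<Sum>n. f n w) (\<Sum>n. k n * Beta (\<nu> + real n) b)"
    using suminf fint by (simp add: has_bochner_integral_iff)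
  also have "(\<Sum>n. k n * Beta (\<nu> + real n) b) = Beta \<nu> b * hyp2F1 \<nu> c (\<nu> + b) X"
  proof -
    have eq: "k n * Beta (\<nu> + real n) b
        = Beta \<nu> b * (pochhammer \<nu> n * pochhammer c n / pochhammer (\<nu> + b) n * (X ^ n / fact n))" for n
      using assms by (simp add: k_def Beta_plus_nat field_simps)
    have "summable (\<lambda>n. k n * Beta (\<nu> + real n) b)"
      using sum_int unfolding norm_int
      by (rule summable_comparison_test'[of _ 0]) (use beta_le in \<open>auto simp: abs_mult\<close>)
    then have "summable (\<lambda>n. inverse (Beta \<nu> b) * (k n * Beta (\<nu> + real n) b))" by (rule summable_mult)
    moreover have "Beta \<nu> b > 0" using assms by (auto simp: Beta_def intro!: divide_pos_pos mult_pos_pos Gamma_real_pos)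
    ultimately have "summable (\<lambda>n. pochhammer \<nu> n * pochhammer c n / pochhammer (\<nu> + b) n * (X ^ n / fact n))"
      unfolding eq mult.assoc[symmetric] by simp
    then show ?thesis
      unfolding hyp2F1_def eq by (rule suminf_mult)
  qed
  finally show ?thesis
  proof (rule has_bochner_integral_cong_AE[THEN iffD1, rotated -1])
    show "AE w in lborel. (\<Sum>n. f n w) = indicator {0..1} w * (w powr (\<nu> - 1) * (1 - w) powr (b - 1) * (1 - X * w) powr (- c))"
      by (rule AE_mp[OF AE_lborel_singleton[of 0]], rule AE_I2) (use f_sums in \<open>auto simp: sums_iff\<close>)
  qed (use f_integrable in \<open>auto intro!: borel_measurable_suminf borel_measurable_integrable\<close>)
qed

section \<open>Determinacy of moments\<close>

text \<open>A uniform error \<open>e\<close> on the unit interval costs at most \<open>e\<close>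
  times the total mass of the signed weight \<open>g\<close>; the approximating polynomial sees only
  the moments of the image under \<open>T\<close>.\<close>

lemma integral_polynomial_approximation:
  fixes g T :: "'m \<Rightarrow> real" and f P :: "real \<Rightarrow> real"
  assumes g: "integrable M g" and [measurable]: "T \<in> borel_measurable M" and T: "\<And>x. T x \<in> {0..1}"
    and f: "continuous_on {0..1} f" and P: "P = (\<lambda>t. \<Sum>i\<le>N. c i * t ^ i)"
    and e: "\<And>t. t \<in> {0..1} \<Longrightarrow> \<bar>f t - P t\<bar> < e"
  shows "\<bar>(\<integral>x. g x * f (T x) \<partial>M) - (\<Sum>i\<le>N. c i * (\<integral>x. g x * T x ^ i \<partial>M))\<bar> \<le> e * (\<integral>x. \<bar>g x\<bar> \<partial>M)"
proof -
  have [measurable]: "g \<in> borel_measurable M" using g by simp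
  have [measurable]: "(\<lambda>x. f (T x)) \<in> borel_measurable M"
  proof -
    have [measurable]: "(\<lambda>t. indicator {0..1} t *\<^sub>R f t) \<in> borel_measurable borel"
      by (rule borel_measurable_continuous_on_indicator) (use f in auto)
    have "(\<lambda>x. f (T x)) = (\<lambda>x. indicator {0..1} (T x) *\<^sub>R f (T x))"
      using T by (auto simp: indicator_def fun_eq_iff)
    also have "\<dots> \<in> borel_measurable M"
      by (rule measurable_compose[OF assms(2), where g = "\<lambda>t. indicator {0..1} t *\<^sub>R f t"]) measurable
    finally show ?thesis .
  qed
  obtain B where "B \<ge> 0" and B: "\<And>t. t \<in> {0..1} \<Longrightarrow> \<bar>f t\<bar> \<le> B"
    using continuous_on_compact_abs_bounded[OF f compact_Icc] by blast
  have gf: "integrable M (\<lambda>x. g x * f (T x))"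
  proof (rule Bochner_Integration.integrable_bound[OF integrable_mult_right[OF g, of B] _ AE_I2])
    fix x
    have "\<bar>f (T x)\<bar> * \<bar>g x\<bar> \<le> \<bar>B\<bar> * \<bar>g x\<bar>"
      by (intro mult_right_mono order_trans[OF B[OF T] abs_ge_self]) auto
    then show "norm (g x * f (T x)) \<le> norm (B * g x)" by (simp add: abs_mult mult.commute)
  qed measurable
  have gT: "integrable M (\<lambda>x. g x * T x ^ n)" for n
  proof (rule Bochner_Integration.integrable_bound[OF g])
    show "AE x in M. norm (g x * T x ^ n) \<le> norm (g x)"
      using T by (intro AE_I2) (auto simp: abs_mult power_abs intro!: mult_left_le power_le_one)
  qed measurable
  have "g x * P (T x) = (\<Sum>i\<le>N. c i * (g x * T x ^ i))" for x
    by (simp add: P sum_distrib_left mult_ac)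
  then have gP: "integrable M (\<lambda>x. g x * P (T x))" "(\<integral>x. g x * P (T x) \<partial>M) = (\<Sum>i\<le>N. c i * (\<integral>x. g x * T x ^ i \<partial>M))"
    using gT by simp_all
  have "norm (\<integral>x. g x * f (T x) - g x * P (T x) \<partial>M) \<le> (\<integral>x. e * \<bar>g x\<bar> \<partial>M)"
  proof (rule norm_integral_le)
    show "integrable M (\<lambda>x. g x * f (T x) - g x * P (T x))"
      by (intro Bochner_Integration.integrable_diff gf gP(1))
    show "integrable M (\<lambda>x. e * \<bar>g x\<bar>)"
      using g by simp
    have "\<bar>f (T x) - P (T x)\<bar> * \<bar>g x\<bar> \<le> e * \<bar>g x\<bar>" for x
      by (intro mult_right_mono less_imp_le[OF e[OF T]]) auto
    then show "norm (g x * f (T x) - g x * P (T x)) \<le> e * \<bar>g x\<bar>" for x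
      by (simp add: right_diff_distrib[symmetric] abs_mult mult.commute)
  qed
  then show ?thesis using gf gP by simp
qed

text \<open>Two finite signed measures on the unit interval with equal moments agree on continuous
  functions, by Weierstrass. They are given as images from different spaces, because one will live
  on the Euclidean space and the other on the plane.\<close>

lemma moments_determine_integrals:
  fixes g1 T1 :: "'m \<Rightarrow> real" and g2 T2 :: "'n \<Rightarrow> real"
  assumes int: "integrable M1 g1" "integrable M2 g2"
    and meas: "T1 \<in> borel_measurable M1" "T2 \<in> borel_measurable M2"
    and T: "\<And>x. T1 x \<in> {0..1}" "\<And>x. T2 x \<in> {0..1}"
    and moments: "\<And>n. (\<integral>x. g1 x * T1 x ^ n \<partial>M1) = (\<integral>x. g2 x * T2 x ^ n \<partial>M2)"
    and f: "continuous_on {0..1} f"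
  shows "(\<integral>x. g1 x * f (T1 x) \<partial>M1) = (\<integral>x. g2 x * f (T2 x) \<partial>M2)"
proof -
  define K where "K = (\<integral>x. \<bar>g1 x\<bar> \<partial>M1) + (\<integral>x. \<bar>g2 x\<bar> \<partial>M2)"
  have "K \<ge> 0" unfolding K_def by (intro add_nonneg_nonneg integral_nonneg) auto
  have diff: "\<bar>(\<integral>x. g1 x * f (T1 x) \<partial>M1) - (\<integral>x. g2 x * f (T2 x) \<partial>M2)\<bar> \<le> e * K" if "e > 0" for e
  proof -
    obtain P where "real_polynomial_function P" and P: "\<And>t. t \<in> {0..1} \<Longrightarrow> \<bar>f t - P t\<bar> < e"
      using Stone_Weierstrass_real_polynomial_function[OF compact_Icc f \<open>e > 0\<close>] by auto
    then obtain c N where Pc: "P = (\<lambda>t. \<Sum>i\<le>N. c i * t ^ i)"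
      using real_polynomial_function_iff_sum by blast
    show ?thesis
      using integral_polynomial_approximation[OF int(1) meas(1) T(1) f Pc P]
        integral_polynomial_approximation[OF int(2) meas(2) T(2) f Pc P]
      unfolding K_def moments by (simp add: distrib_left)
  qed
  have "\<bar>(\<integral>x. g1 x * f (T1 x) \<partial>M1) - (\<integral>x. g2 x * f (T2 x) \<partial>M2)\<bar> \<le> 0 + e" if "e > 0" for e
  proof -
    \<comment> \<open>Adding 1 to the total mass guards against \<open>K = 0\<close>.\<close>
    have "e / (K + 1) * K \<le> e"
      using that \<open>K \<ge> 0\<close> by (simp add: field_simps)
    with diff[of "e / (K + 1)"] that \<open>K \<ge> 0\<close> show ?thesis by simp
  qed
  then have "\<bar>(\<integral>x. g1 x * f (T1 x) \<partial>M1) - (\<integral>x. g2 x * f (T2 x) \<partial>M2)\<bar> \<le> 0"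
    by (rule field_le_epsilon)
  then show ?thesis by simp
qed

section \<open>Riesz potentials of Gaussian profiles\<close>

lemma lborel_translate:
  fixes f :: "'a::euclidean_space \<Rightarrow> 'b::{banach, second_countable_topology}" and x :: 'a
  assumes "f \<in> borel_measurable borel"
  shows "integrable lborel (\<lambda>h. f (x + h)) \<longleftrightarrow> integrable lborel f"
    and "(\<integral>h. f (x + h) \<partial>lborel) = (\<integral>y. f y \<partial>lborel)"
proof -
  have m: "(+) x \<in> borel_measurable lborel" by measurable
  show "integrable lborel (\<lambda>h. f (x + h)) \<longleftrightarrow> integrable lborel f"
    using integrable_distr_eq[OF m assms] by (simp add: lborel_distr_plus)
  show "(\<integral>h. f (x + h) \<partial>lborel) = (\<integral>y. f y \<partial>lborel)"
    using integral_distr[OF m assms] by (simp add: lborel_distr_plus)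
qed

text \<open>Near \<open>x\<close> the function is bounded and the kernel integrable because
  \<open>c > 0\<close>; farther away the kernel is bounded by its value at distance \<delta> because
  \<open>c\<close> does not exceed the dimension, and the function is integrable.\<close>

lemma integrable_riesz_kernel:
  fixes F :: "'a::euclidean_space \<Rightarrow> real"
  fixes c \<delta> B :: real
  assumes "integrable lborel F" "0 < c" "c \<le> DIM('a)" "\<delta> > 0" "\<And>y. norm (y - x) \<le> \<delta> \<Longrightarrow> \<bar>F y\<bar> \<le> B"
  shows "integrable lborel (\<lambda>y. F y * norm (y - x) powr (c - DIM('a)))"
proof -
  have [measurable]: "F \<in> borel_measurable borel" using assms(1) by simp
  have "integrable lborel (\<lambda>h::'a. indicator {h. norm h \<le> \<delta>} h * norm h powr (c - DIM('a)))"
    using has_bochner_integral_norm_powr_ball[of c \<delta>, where 'a = 'a] assms by (auto simp: has_bochner_integral_iff)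
  then have near: "integrable lborel (\<lambda>y::'a. indicator {h. norm h \<le> \<delta>} (- x + y) * norm (- x + y) powr (c - DIM('a)))"
    by (subst lborel_translate) auto
  show ?thesis
  proof (rule Bochner_Integration.integrable_bound[OF Bochner_Integration.integrable_add[OF
        integrable_mult_right[OF near, of B] integrable_mult_right[OF integrable_norm[OF assms(1)], of "\<delta> powr (c - DIM('a))"]]])
    show "AE y in lborel. norm (F y * norm (y - x) powr (c - DIM('a)))
      \<le> norm (B * (indicator {h. norm h \<le> \<delta>} (- x + y) * norm (- x + y) powr (c - DIM('a))) + \<delta> powr (c - DIM('a)) * norm (F y))"
    proof (rule AE_I2)
      fix y
      have xy: "- x + y = y - x" by simp
      have "\<bar>F y\<bar> * norm (y - x) powr (c - DIM('a))
        \<le> B * (indicator {h. norm h \<le> \<delta>} (y - x) * norm (y - x) powr (c - DIM('a))) + \<delta> powr (c - DIM('a)) * norm (F y)"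
      proof (cases "norm (y - x) \<le> \<delta>")
        case True
        then have "\<bar>F y\<bar> * norm (y - x) powr (c - DIM('a)) \<le> B * norm (y - x) powr (c - DIM('a))"
          by (intro mult_right_mono assms(5)) auto
        then show ?thesis using True by (simp add: add_increasing2)
      next
        case False
        then have "norm (y - x) powr (c - DIM('a)) \<le> \<delta> powr (c - DIM('a))"
          using assms by (intro powr_mono2') auto
        then have "\<bar>F y\<bar> * norm (y - x) powr (c - DIM('a)) \<le> \<bar>F y\<bar> * \<delta> powr (c - DIM('a))"
          by (intro mult_left_mono) auto
        then show ?thesis using False by (simp add: mult.commute)
      qed
      then show "norm (F y * norm (y - x) powr (c - DIM('a)))
        \<le> norm (B * (indicator {h. norm h \<le> \<delta>} (- x + y) * norm (- x + y) powr (c - DIM('a))) + \<delta> powr (c - DIM('a)) * norm (F y))"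
        unfolding xy by (simp add: abs_mult)
    qed
  qed measurable
qed

section \<open>Subordination to Gaussians\<close>

lemma has_bochner_integral_Gamma_scaled:
  fixes z A :: real
  assumes "z > 0" "A > 0"
  shows "has_bochner_integral lborel (\<lambda>s. indicator {0..} s * (s powr (z - 1) * exp (- A * s))) (Gamma z * A powr (- z))"
proof -
  have "has_bochner_integral lborel (\<lambda>t. indicator {0..} t * (t powr (z - 1) / exp t)) (Gamma z)"
    by (intro has_bochner_integral_indicator_has_integral Gamma_integral_real assms) auto
  then have "has_bochner_integral lborel (\<lambda>t. indicator {0..} (0 + A * t) * ((0 + A * t) powr (z - 1) / exp (0 + A * t))) (Gamma z /\<^sub>R \<bar>A\<bar>)"
    using assms by (subst (asm) lborel_has_bochner_integral_real_affine_iff[of A _ _ 0]) auto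
  then have "has_bochner_integral lborel (\<lambda>t. A powr (1 - z) * (indicator {0..} (0 + A * t) * ((0 + A * t) powr (z - 1) / exp (0 + A * t))))
      (A powr (1 - z) * (Gamma z /\<^sub>R \<bar>A\<bar>))"
    by (rule has_bochner_integral_mult_right)
  moreover have "A powr (1 - z) * (Gamma z /\<^sub>R \<bar>A\<bar>) = Gamma z * A powr (- z)"
    using assms by (simp add: powr_diff powr_minus field_simps)
  moreover have "A powr (1 - z) * (indicator {0..} (0 + A * t) * ((0 + A * t) powr (z - 1) / exp (0 + A * t)))
      = indicator {0..} t * (t powr (z - 1) * exp (- A * t))" for t
  proof (cases "t \<ge> 0")
    case True
    have "A powr (1 - z) * A powr (z - 1) = 1" using assms by (simp add: powr_add[symmetric])
    then have "A powr (1 - z) * (A powr (z - 1) * t powr (z - 1) / exp (A * t)) = t powr (z - 1) / exp (A * t)"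
      by (simp add: mult.assoc[symmetric])
    then show ?thesis
      using assms True by (simp add: powr_mult exp_minus divide_inverse indicator_def)
  next
    case False
    then show ?thesis using assms by (simp add: indicator_def zero_le_mult_iff)
  qed
  ultimately show ?thesis by (simp only:)
qed

lemma subordination_substitution:
  fixes \<nu> b \<eta> X :: real
  assumes "\<nu> > 0" "b > 0" "\<eta> > 0" "X \<ge> 0"
  shows "(\<integral>s. indicator {0..} s * (s powr (\<nu> - 1) * (s + \<eta>) powr (- (\<nu> + b)) * exp (- (s * \<eta> * X / (s + \<eta>)))) \<partial>lborel)
    = \<eta> powr (- b) * (\<integral>w. indicator {0..1} w * (w powr (\<nu> - 1) * (1 - w) powr (b - 1)) * exp (- (\<eta> * X * w)) \<partial>lborel)"
proof -
  define f where "f s = s powr (\<nu> - 1) * (s + \<eta>) powr (- (\<nu> + b)) * exp (- (s * \<eta> * X / (s + \<eta>)))" for s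
  \<comment> \<open>The inverse of \<open>w = s / (s + \<eta>)\<close>, a bijection from the unit
    interval to the half-line. It turns the exponent into a linear function of \<open>w\<close>;
    collecting powers leaves \<eta> to \<open>- b\<close> and \<open>1 - w\<close> to
    \<open>b - 1\<close>.\<close>
  define g where "g w = \<eta> * w / (1 - w)" for w
  define g' where "g' w = \<eta> / (1 - w)\<^sup>2" for w
  define k where "k w = \<eta> powr (- b) * (w powr (\<nu> - 1) * (1 - w) powr (b - 1) * exp (- (\<eta> * X * w)))" for w
  have fg: "f (g w) * g' w = k w" if w: "0 < w" "w < 1" for w
  proof -
    have s: "g w + \<eta> = \<eta> / (1 - w)" using w by (simp add: g_def field_simps)
    have e: "g w * \<eta> * X / (g w + \<eta>) = \<eta> * X * w"
      unfolding s using w assms by (simp add: g_def field_simps)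
    have "g w powr (\<nu> - 1) = \<eta> powr (\<nu> - 1) * w powr (\<nu> - 1) * (1 - w) powr (- (\<nu> - 1))"
      unfolding g_def powr_minus_divide using w assms by (simp add: powr_mult powr_divide)
    moreover have "(g w + \<eta>) powr (- (\<nu> + b)) = \<eta> powr (- (\<nu> + b)) * (1 - w) powr (\<nu> + b)"
      unfolding s powr_minus_divide using w assms by (simp add: powr_divide)
    moreover have "g' w = \<eta> powr 1 * (1 - w) powr (-2)"
      using w assms by (simp add: g'_def powr_minus powr_numeral divide_inverse)
    ultimately have "f (g w) * g' w = (\<eta> powr (\<nu> - 1) * \<eta> powr (- (\<nu> + b)) * \<eta> powr 1)
        * ((1 - w) powr (- (\<nu> - 1)) * (1 - w) powr (\<nu> + b) * (1 - w) powr (-2)) * w powr (\<nu> - 1) * exp (- (\<eta> * X * w))"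
      unfolding f_def e by (simp only: mult_ac)
    also have "\<eta> powr (\<nu> - 1) * \<eta> powr (- (\<nu> + b)) * \<eta> powr 1 = \<eta> powr (- b)"
      using assms by (simp only: powr_add[symmetric]) (simp add: algebra_simps)
    also have "(1 - w) powr (- (\<nu> - 1)) * (1 - w) powr (\<nu> + b) * (1 - w) powr (-2) = (1 - w) powr (b - 1)"
      using w by (simp only: powr_add[symmetric]) (simp add: algebra_simps)
    finally show ?thesis by (simp add: k_def mult_ac)
  qed
  have kint: "integrable lborel (\<lambda>w. indicator {0..1} w * k w)"
  proof -
    have "integrable lborel (\<lambda>w. indicator {0..1} w * (w powr (\<nu> - 1) * (1 - w) powr (b - 1)))"
      using has_bochner_integral_indicator_has_integral[OF has_integral_Beta_real[OF assms(1,2)]]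
      by (auto simp: has_bochner_integral_iff)
    then have i: "integrable lborel (\<lambda>w. \<eta> powr (- b) * (indicator {0..1} w * (w powr (\<nu> - 1) * (1 - w) powr (b - 1))))"
      by (rule integrable_mult_right)
    show ?thesis
    proof (rule Bochner_Integration.integrable_bound[OF i])
      show "AE w in lborel. norm (indicator {0..1} w * k w)
          \<le> norm (\<eta> powr (- b) * (indicator {0..1} w * (w powr (\<nu> - 1) * (1 - w) powr (b - 1))))"
        using assms by (intro AE_I2) (auto simp: k_def indicator_def abs_mult intro!: mult_left_mono mult_left_le)
    qed (auto simp: k_def)
  qed
  have ein: "einterval 0 1 = {0<..<1}" "einterval 0 \<infinity> = {0<..}"
    by (auto simp: einterval_def)
  have sub: "set_integrable lborel (einterval 0 1) (\<lambda>w. f (g w) * g' w)"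
    unfolding set_integrable_def
  proof (rule integrable_cong_AE_imp[OF kint])
    show "AE w in lborel. indicator {0..1} w * k w = indicator (einterval 0 1) w *\<^sub>R (f (g w) * g' w)"
      using AE_lborel_singleton[of 0] AE_lborel_singleton[of 1]
      by eventually_elim (auto simp: ein indicator_def fg)
  qed (auto simp: f_def g_def g'_def ein)
  have "(LBINT s=0..\<infinity>. f s) = (LBINT w=0..1. f (g w) * g' w)"
  proof (rule interval_integral_substitution_nonneg(2)[where a = 0 and b = 1 and g = g and g' = g'])
    show "DERIV g w :> g' w" if "0 < ereal w" "ereal w < 1" for w
      unfolding g_def g'_def using that
      by (auto intro!: derivative_eq_intros simp: power2_eq_square field_simps)
    show "isCont f (g w)" if "0 < ereal w" "ereal w < 1" for w
    proof -
      have "g w > 0" using that assms by (simp add: g_def)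
      then show ?thesis unfolding f_def using assms by (intro continuous_intros) auto
    qed
    show "isCont g' w" if "0 < ereal w" "ereal w < 1" for w
      unfolding g'_def using that by (intro continuous_intros) auto
    show "0 \<le> f (g w)" if "0 < ereal w" "ereal w < 1" for w
      unfolding f_def by simp
    show "0 \<le> g' w" for w using assms by (simp add: g'_def)
    show "((ereal \<circ> g \<circ> real_of_ereal) \<longlongrightarrow> 0) (at_right 0)"
    proof -
      have "(g \<longlongrightarrow> g 0) (at_right 0)"
        unfolding g_def by (intro tendsto_intros) auto
      then have "((ereal \<circ> g \<circ> real_of_ereal) \<longlongrightarrow> ereal 0) (at_right (ereal 0))"
        by (simp only: ereal_tendsto_simps) (simp add: g_def)
      then show ?thesis by (simp only: zero_ereal_def)
    qed
    show "((ereal \<circ> g \<circ> real_of_ereal) \<longlongrightarrow> \<infinity>) (at_left 1)"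
    proof -
      have "filterlim g at_top (at_left 1)"
        unfolding g_def using assms(3) by real_asymp
      then have "((ereal \<circ> g \<circ> real_of_ereal) \<longlongrightarrow> \<infinity>) (at_left (ereal 1))"
        by (simp only: ereal_tendsto_simps)
      then show ?thesis by (simp only: one_ereal_def)
    qed
    show "set_integrable lborel (einterval 0 1) (\<lambda>w. f (g w) * g' w)" by (rule sub)
  qed auto
  then have "(\<integral>s. indicator {0<..} s * f s \<partial>lborel) = (\<integral>w. indicator {0<..<1} w * (f (g w) * g' w) \<partial>lborel)"
    by (simp add: interval_lebesgue_integral_def ein set_lebesgue_integral_def)
  also have "\<dots> = (\<integral>w. \<eta> powr (- b) * (indicator {0..1} w * (w powr (\<nu> - 1) * (1 - w) powr (b - 1)) * exp (- (\<eta> * X * w))) \<partial>lborel)"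
  proof (rule integral_cong_AE)
    show "AE w in lborel. indicator {0<..<1} w * (f (g w) * g' w)
        = \<eta> powr (- b) * (indicator {0..1} w * (w powr (\<nu> - 1) * (1 - w) powr (b - 1)) * exp (- (\<eta> * X * w)))"
      using AE_lborel_singleton[of 0] AE_lborel_singleton[of 1]
      by eventually_elim (auto simp: indicator_def fg k_def)
  qed (auto simp: f_def g_def g'_def)
  also have "(\<integral>s. indicator {0<..} s * f s \<partial>lborel) = (\<integral>s. indicator {0..} s * f s \<partial>lborel)"
  proof (rule integral_cong_AE)
    show "AE s in lborel. indicator {0<..} s * f s = indicator {0..} s * f s"
      using AE_lborel_singleton[of 0] by eventually_elim (auto simp: indicator_def)
  qed (auto simp: f_def)
  finally show ?thesis by (simp add: f_def)
qed

text \<open>Completing the square: the product of Gaussians centred at 0 and at \<open>x\<close> is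
  a Gaussian centred at a multiple of \<open>x\<close>. A centre on the ray of \<open>x\<close> is
  what makes homogeneity of \<open>V\<close> usable afterwards.\<close>

lemma gaussian_shift:
  fixes x y :: "'a::real_inner"
  assumes "\<eta> > 0" "s > 0"
  shows "\<eta> * (norm y)\<^sup>2 + s * (norm (y - x))\<^sup>2
    = (s + \<eta>) * (norm (y - (s / (s + \<eta>)) *\<^sub>R x))\<^sup>2 + s * \<eta> * (norm x)\<^sup>2 / (s + \<eta>)"
proof -
  have sq: "(norm (y - k *\<^sub>R x))\<^sup>2 = (norm y)\<^sup>2 - 2 * k * (y \<bullet> x) + k\<^sup>2 * (norm x)\<^sup>2" for k :: real
    unfolding power2_norm_eq_inner
    by (simp add: inner_diff_left inner_diff_right inner_commute power2_eq_square algebra_simps)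
  show ?thesis
  proof -
    define \<sigma> where "\<sigma> = s + \<eta>"
    have \<sigma>: "\<sigma> > 0" using assms by (simp add: \<sigma>_def)
    have "\<sigma> * ((norm y)\<^sup>2 - 2 * (s / \<sigma>) * (y \<bullet> x) + (s / \<sigma>)\<^sup>2 * (norm x)\<^sup>2) + s * \<eta> * (norm x)\<^sup>2 / \<sigma>
        = \<sigma> * (norm y)\<^sup>2 - 2 * s * (y \<bullet> x) + (s * (s + \<eta>) / \<sigma>) * (norm x)\<^sup>2"
      using \<sigma> by (simp add: field_simps power2_eq_square)
    also have "s * (s + \<eta>) / \<sigma> = s" using \<sigma> by (simp add: \<sigma>_def)
    finally show ?thesis
      unfolding sq sq[of 1, simplified] \<sigma>_def by (simp add: algebra_simps)
  qed
qed

text \<open>The kernel is written as a Gamma integral of Gaussians and the order of integration is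
  exchanged. Each inner integral is then a Gaussian integral of \<open>V\<close>, and what remains
  is a one-dimensional integral in the subordination variable.\<close>

lemma riesz_potential_gaussian:
  fixes V :: "'a::euclidean_space \<Rightarrow> real" and x :: 'a and b \<eta> :: real
  assumes V: "solid_harmonic l V" and b: "0 < b" "2 * b < DIM('a)" and \<eta>: "\<eta> > 0"
  defines "\<nu> \<equiv> real DIM('a) / 2 + real l - b"
  shows "integrable lborel (\<lambda>y. V y * norm (y - x) powr (2 * b - DIM('a)) * exp (- \<eta> * (norm y)\<^sup>2))"
    and "(\<integral>y. V y * norm (y - x) powr (2 * b - DIM('a)) * exp (- \<eta> * (norm y)\<^sup>2) \<partial>lborel)
      = pi powr (DIM('a) / 2) / Gamma (DIM('a) / 2 - b) * V x * \<eta> powr (- b) *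
        (\<integral>w. indicator {0..1} w * (w powr (\<nu> - 1) * (1 - w) powr (b - 1)) * exp (- (\<eta> * (norm x)\<^sup>2 * w)) \<partial>lborel)"
proof -
  define \<mu> where "\<mu> = real DIM('a) / 2 - b"
  have \<mu>: "\<mu> > 0" using b by (simp add: \<mu>_def)
  have pol: "real_polynomial_function V" and harm: "\<And>x. laplacian V x = 0" and hom: "\<And>c x. V (c *\<^sub>R x) = c ^ l * V x"
    using V by (auto simp: solid_harmonic_def)
  have [measurable]: "V \<in> borel_measurable borel"
    by (rule borel_measurable_real_polynomial[OF pol])
  have Fint: "integrable lborel (\<lambda>y. V y * exp (- \<eta> * (norm y)\<^sup>2))"
    using harmonic_gaussian_integral[OF pol harm \<eta>, of 0] by (auto simp: has_bochner_integral_iff)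
  obtain B where "B \<ge> 0" and B: "\<And>y. y \<in> cball x 1 \<Longrightarrow> \<bar>V y\<bar> \<le> B"
    using continuous_on_compact_abs_bounded[OF continuous_on_real_polynomial[OF pol] compact_cball] by blast
  have "\<bar>V y * exp (- \<eta> * (norm y)\<^sup>2)\<bar> \<le> B" if "norm (y - x) \<le> 1" for y
  proof -
    have "\<bar>V y * exp (- \<eta> * (norm y)\<^sup>2)\<bar> \<le> \<bar>V y\<bar>"
      using \<eta> by (simp add: abs_mult mult_left_le)
    also have "\<dots> \<le> B" using that by (intro B) (simp add: dist_norm norm_minus_commute)
    finally show ?thesis .
  qed
  then have kint: "integrable lborel (\<lambda>y. V y * exp (- \<eta> * (norm y)\<^sup>2) * norm (y - x) powr (2 * b - DIM('a)))"
    using b by (intro integrable_riesz_kernel[OF Fint, of _ 1]) auto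
  then show "integrable lborel (\<lambda>y. V y * norm (y - x) powr (2 * b - DIM('a)) * exp (- \<eta> * (norm y)\<^sup>2))"
    by (simp add: mult_ac)
  define \<Phi> where "\<Phi> y s = V y * exp (- \<eta> * (norm y)\<^sup>2) * (indicator {0..} s * (s powr (\<mu> - 1) * exp (- (norm (y - x))\<^sup>2 * s)))" for y and s :: real
  have inner: "has_bochner_integral lborel (\<lambda>s. indicator {0..} s * (s powr (\<mu> - 1) * exp (- (norm (y - x))\<^sup>2 * s)))
      (Gamma \<mu> * norm (y - x) powr (2 * b - DIM('a)))" if "y \<noteq> x" for y
  proof -
    have "((norm (y - x))\<^sup>2) powr (- \<mu>) = norm (y - x) powr (2 * b - DIM('a))"
      using that by (simp add: powr_powr \<mu>_def flip: powr_numeral)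
    then show ?thesis
      using has_bochner_integral_Gamma_scaled[OF \<mu>, of "(norm (y - x))\<^sup>2"] that by simp
  qed
  \<comment> \<open>The Gamma integrand is nonnegative, so integrating the absolute value over
    \<open>s\<close> returns \<open>Gamma \<mu>\<close> times the absolute value of the original
    integrand, already known to be integrable.\<close>
  have prod_int: "integrable (lborel \<Otimes>\<^sub>M lborel) (case_prod \<Phi>)"
  proof (rule lborel_pair.Fubini_integrable)
    show "case_prod \<Phi> \<in> borel_measurable (lborel \<Otimes>\<^sub>M lborel)"
      unfolding \<Phi>_def by measurable
    have "integrable lborel (\<lambda>y. Gamma \<mu> * norm (V y * exp (- \<eta> * (norm y)\<^sup>2) * norm (y - x) powr (2 * b - DIM('a))))"
      by (intro integrable_mult_right integrable_norm kint)
    then show "integrable lborel (\<lambda>y. \<integral>s. norm (case_prod \<Phi> (y, s)) \<partial>lborel)"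
    proof (rule integrable_cong_AE_imp)
      show "AE y in lborel. Gamma \<mu> * norm (V y * exp (- \<eta> * (norm y)\<^sup>2) * norm (y - x) powr (2 * b - DIM('a)))
          = (\<integral>s. norm (case_prod \<Phi> (y, s)) \<partial>lborel)"
        using AE_lborel_singleton[of x]
      proof eventually_elim
        case (elim y)
        have "norm (case_prod \<Phi> (y, s)) = \<bar>V y * exp (- \<eta> * (norm y)\<^sup>2)\<bar> * (indicator {0..} s * (s powr (\<mu> - 1) * exp (- (norm (y - x))\<^sup>2 * s)))" for s
          by (simp add: \<Phi>_def abs_mult indicator_def)
        then show ?case
          using has_bochner_integral_integral_eq[OF inner[OF elim]] by (simp add: abs_mult)
      qed
    qed (auto simp: \<Phi>_def)
    show "AE y in lborel. integrable lborel (\<lambda>s. case_prod \<Phi> (y, s))"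
      using AE_lborel_singleton[of x]
    proof eventually_elim
      case (elim y)
      show ?case using inner[OF elim] unfolding \<Phi>_def
        by (auto simp: has_bochner_integral_iff intro!: integrable_mult_right)
    qed
  qed
  have "(\<integral>y. (\<integral>s. \<Phi> y s \<partial>lborel) \<partial>lborel) = (\<integral>y. Gamma \<mu> * (V y * norm (y - x) powr (2 * b - DIM('a)) * exp (- \<eta> * (norm y)\<^sup>2)) \<partial>lborel)"
  proof (rule integral_cong_AE)
    show "AE y in lborel. (\<integral>s. \<Phi> y s \<partial>lborel) = Gamma \<mu> * (V y * norm (y - x) powr (2 * b - DIM('a)) * exp (- \<eta> * (norm y)\<^sup>2))"
      using AE_lborel_singleton[of x]
    proof eventually_elim
      case (elim y)
      show ?case
        unfolding \<Phi>_def integral_mult_right_zero has_bochner_integral_integral_eq[OF inner[OF elim]]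
        by (simp only: mult_ac)
    qed
  qed (auto simp: \<Phi>_def)
  then have "Gamma \<mu> * (\<integral>y. V y * norm (y - x) powr (2 * b - DIM('a)) * exp (- \<eta> * (norm y)\<^sup>2) \<partial>lborel)
      = (\<integral>y. (\<integral>s. \<Phi> y s \<partial>lborel) \<partial>lborel)" by simp
  also have "\<dots> = (\<integral>s. (\<integral>y. \<Phi> y s \<partial>lborel) \<partial>lborel)"
    by (rule lborel_pair.Fubini_integral[OF prod_int, symmetric])
  also have "\<dots> = (\<integral>s. pi powr (DIM('a) / 2) * V x *
      (indicator {0..} s * (s powr (\<nu> - 1) * (s + \<eta>) powr (- (\<nu> + b)) * exp (- (s * \<eta> * (norm x)\<^sup>2 / (s + \<eta>))))) \<partial>lborel)"
  proof (rule integral_cong_AE)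
    show "AE s in lborel. (\<integral>y. \<Phi> y s \<partial>lborel) = pi powr (DIM('a) / 2) * V x *
      (indicator {0..} s * (s powr (\<nu> - 1) * (s + \<eta>) powr (- (\<nu> + b)) * exp (- (s * \<eta> * (norm x)\<^sup>2 / (s + \<eta>)))))"
      using AE_lborel_singleton[of 0]
    proof eventually_elim
      case (elim s)
      show ?case
      proof (cases "s > 0")
        case True
        define E where "E = exp (- (s * \<eta> * (norm x)\<^sup>2 / (s + \<eta>)))"
        have "\<Phi> y s = (s powr (\<mu> - 1) * E) * (V y * exp (- (s + \<eta>) * (norm (y - (s / (s + \<eta>)) *\<^sub>R x))\<^sup>2))" for y
        proof -
          have "exp (- \<eta> * (norm y)\<^sup>2) * exp (- (norm (y - x))\<^sup>2 * s)
              = exp (- (\<eta> * (norm y)\<^sup>2 + s * (norm (y - x))\<^sup>2))"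
            by (simp add: exp_add[symmetric] mult.commute)
          also have "\<dots> = E * exp (- (s + \<eta>) * (norm (y - (s / (s + \<eta>)) *\<^sub>R x))\<^sup>2)"
            unfolding gaussian_shift[OF \<eta> True] E_def by (simp add: exp_add[symmetric] algebra_simps)
          finally have "exp (- \<eta> * (norm y)\<^sup>2) * exp (- (norm (y - x))\<^sup>2 * s)
            = E * exp (- (s + \<eta>) * (norm (y - (s / (s + \<eta>)) *\<^sub>R x))\<^sup>2)" .
          moreover have "\<Phi> y s = V y * s powr (\<mu> - 1) * (exp (- \<eta> * (norm y)\<^sup>2) * exp (- (norm (y - x))\<^sup>2 * s))"
            using True by (simp add: \<Phi>_def)
          ultimately show ?thesis by (simp only: mult_ac)
        qed
        \<comment> \<open>Harmonicity enters here: the Gaussian integral evaluates \<open>V\<close>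
          at the shifted centre. Homogeneity then extracts \<open>V x\<close> with the
          \<open>l\<close>-th power of \<open>s / (s + \<eta>)\<close>, which raises the exponent
          from \<mu> to \<nu>.\<close>
        then have "(\<integral>y. \<Phi> y s \<partial>lborel) = s powr (\<mu> - 1) * E *
            ((pi / (s + \<eta>)) powr (DIM('a) / 2) * V ((s / (s + \<eta>)) *\<^sub>R x))"
          using harmonic_gaussian_integral[OF pol harm, of "s + \<eta>" "(s / (s + \<eta>)) *\<^sub>R x"] True \<eta>
          by (simp add: has_bochner_integral_iff)
        also have "(pi / (s + \<eta>)) powr (DIM('a) / 2) * V ((s / (s + \<eta>)) *\<^sub>R x)
            = pi powr (DIM('a) / 2) * V x * ((s + \<eta>) powr (- (DIM('a) / 2)) * (s powr l * (s + \<eta>) powr (- real l)))"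
        proof -
          have "(pi / (s + \<eta>)) powr (DIM('a) / 2) = pi powr (DIM('a) / 2) * (s + \<eta>) powr (- (DIM('a) / 2))"
            unfolding powr_minus_divide using True \<eta> by (simp add: powr_divide)
          moreover have "(s / (s + \<eta>)) ^ l = s powr l * (s + \<eta>) powr (- real l)"
            unfolding powr_minus_divide using True \<eta> by (simp add: powr_realpow power_divide)
          ultimately show ?thesis unfolding hom by (simp only: mult_ac)
        qed
        also have "s powr (\<mu> - 1) * E * (pi powr (DIM('a) / 2) * V x * ((s + \<eta>) powr (- (DIM('a) / 2)) * (s powr l * (s + \<eta>) powr (- real l))))
            = pi powr (DIM('a) / 2) * V x * ((s powr (\<mu> - 1) * s powr l) * ((s + \<eta>) powr (- (DIM('a) / 2)) * (s + \<eta>) powr (- real l)) * E)"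
          by (simp only: mult_ac)
        also have "s powr (\<mu> - 1) * s powr l = s powr (\<nu> - 1)"
          unfolding powr_add[symmetric] by (simp add: \<mu>_def \<nu>_def algebra_simps)
        also have "(s + \<eta>) powr (- (DIM('a) / 2)) * (s + \<eta>) powr (- real l) = (s + \<eta>) powr (- (\<nu> + b))"
          unfolding powr_add[symmetric] by (simp add: \<nu>_def algebra_simps)
        finally show ?thesis using True by (simp add: E_def)
      next
        case False
        with elim show ?thesis by (simp add: \<Phi>_def)
      qed
    qed
  qed (auto simp: \<Phi>_def)
  also have "\<dots> = pi powr (DIM('a) / 2) * V x * (\<eta> powr (- b) *
      (\<integral>w. indicator {0..1} w * (w powr (\<nu> - 1) * (1 - w) powr (b - 1)) * exp (- (\<eta> * (norm x)\<^sup>2 * w)) \<partial>lborel))"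
    using b \<eta> by (subst integral_mult_right_zero, subst subordination_substitution) (auto simp: \<nu>_def)
  finally show "(\<integral>y. V y * norm (y - x) powr (2 * b - DIM('a)) * exp (- \<eta> * (norm y)\<^sup>2) \<partial>lborel)
      = pi powr (DIM('a) / 2) / Gamma (DIM('a) / 2 - b) * V x * \<eta> powr (- b) *
        (\<integral>w. indicator {0..1} w * (w powr (\<nu> - 1) * (1 - w) powr (b - 1)) * exp (- (\<eta> * (norm x)\<^sup>2 * w)) \<partial>lborel)"
    using Gamma_real_pos[OF \<mu>] by (simp add: \<mu>_def field_simps)
qed

section \<open>Riesz potentials of powers supported in the ball\<close>

lemma has_bochner_integral_pair:
  fixes f :: "real \<Rightarrow> real \<Rightarrow> real"
  assumes [measurable]: "case_prod f \<in> borel_measurable (lborel \<Otimes>\<^sub>M lborel)"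
    and nonneg: "\<And>w r. 0 \<le> f w r"
    and inner: "\<And>w. has_bochner_integral lborel (f w) (J w)"
    and outer: "has_bochner_integral lborel J I"
  shows "has_bochner_integral (lborel \<Otimes>\<^sub>M lborel) (case_prod f) I"
proof -
  have J: "J = (\<lambda>w. \<integral>r. f w r \<partial>lborel)"
    using has_bochner_integral_integral_eq[OF inner] by auto
  have int: "integrable (lborel \<Otimes>\<^sub>M lborel) (case_prod f)"
  proof (rule lborel_pair.Fubini_integrable)
    show "integrable lborel (\<lambda>w. \<integral>r. norm (case_prod f (w, r)) \<partial>lborel)"
      using outer nonneg unfolding J by (simp add: has_bochner_integral_iff)
    show "AE w in lborel. integrable lborel (\<lambda>r. case_prod f (w, r))"
      using inner by (simp add: has_bochner_integral_iff)
  qed measurable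
  with lborel_pair.integral_fst[OF int] outer show ?thesis
    unfolding J by (simp add: has_bochner_integral_iff)
qed

text \<open>The Beta integral under \<open>r = m t\<close>. Since \<open>0 powr p = 0\<close>, the
  expression \<open>max 0 (m - r) powr p\<close> is the power cut off at \<open>m\<close>, also for
  \<open>p \<le> 0\<close>.\<close>

lemma has_bochner_integral_Beta_scaled:
  fixes b p m :: real
  assumes "b > 0" "p > -1" "m > 0"
  shows "has_bochner_integral lborel (\<lambda>r. indicator {0..} r * r powr (b - 1) * max 0 (m - r) powr p)
    (Beta b (p + 1) * m powr (p + b))"
proof -
  have "has_bochner_integral lborel (\<lambda>t. indicator {0..1} t * (t powr (b - 1) * (1 - t) powr (p + 1 - 1))) (Beta b (p + 1))"
    using assms by (intro has_bochner_integral_indicator_has_integral has_integral_Beta_real) auto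
  then have "has_bochner_integral lborel (\<lambda>r. indicator {0..1} (0 + inverse m * r) * ((0 + inverse m * r) powr (b - 1) * (1 - (0 + inverse m * r)) powr (p + 1 - 1)))
      (Beta b (p + 1) /\<^sub>R \<bar>inverse m\<bar>)"
    using assms by (subst (asm) lborel_has_bochner_integral_real_affine_iff[of "inverse m" _ _ 0]) auto
  from has_bochner_integral_mult_right[OF this, of "m powr (p + b - 1)"]
  have "has_bochner_integral lborel (\<lambda>r. m powr (p + b - 1) * (indicator {0..1} (r / m) * ((r / m) powr (b - 1) * (1 - r / m) powr p)))
      (m powr (p + b - 1) * (Beta b (p + 1) * m))"
    using assms by (simp add: divide_inverse mult.commute)
  moreover have "m powr (p + b - 1) * (Beta b (p + 1) * m) = Beta b (p + 1) * m powr (p + b)"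
    using assms by (simp add: powr_diff)
  moreover have "m powr (p + b - 1) * (indicator {0..1} (r / m) * ((r / m) powr (b - 1) * (1 - r / m) powr p))
      = indicator {0..} r * r powr (b - 1) * max 0 (m - r) powr p" for r
  proof (cases "0 \<le> r \<and> r \<le> m")
    case True
    then have r: "0 \<le> r" "r \<le> m" by auto
    have "1 - r / m = (m - r) / m" using assms by (simp add: field_simps)
    then have "m powr (p + b - 1) * ((r / m) powr (b - 1) * (1 - r / m) powr p)
        = (m powr (p + b - 1) / (m powr (b - 1) * m powr p)) * (r powr (b - 1) * (m - r) powr p)"
      using r assms by (simp add: powr_divide)
    also have "m powr (p + b - 1) / (m powr (b - 1) * m powr p) = 1"
      using assms by (simp add: powr_add[symmetric] algebra_simps)
    finally show ?thesis using r assms by (simp add: indicator_def max_def)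
  next
    case False
    then show ?thesis using assms by (auto simp: indicator_def max_def field_simps)
  qed
  ultimately show ?thesis by (simp only:)
qed

text \<open>For \<open>p \<le> 0\<close> the power \<open>s powr p\<close> is not continuous at 0.
  Since \<open>p + 1\<close> is positive where this is used, the quotients are continuous in
  \<open>s\<close>, and they converge to the power while staying below it, which supplies a
  dominating function.\<close>

lemma power_approximation:
  fixes p s :: real
  assumes "s \<ge> 0"
  shows "(\<lambda>n. s powr (p + 1) / max s (1 / real (Suc n))) \<longlonglongrightarrow> s powr p"
    and "0 \<le> s powr (p + 1) / max s (1 / real (Suc n))"
    and "s powr (p + 1) / max s (1 / real (Suc n)) \<le> s powr p"
proof -
  show "0 \<le> s powr (p + 1) / max s (1 / real (Suc n))"
    using assms by (intro divide_nonneg_nonneg) auto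
  show "s powr (p + 1) / max s (1 / real (Suc n)) \<le> s powr p"
  proof (cases "s = 0")
    case False
    then have "s > 0" using assms by simp
    then have "s powr (p + 1) / max s (1 / real (Suc n)) \<le> s powr (p + 1) / s"
      by (intro divide_left_mono) (auto simp: max_def)
    then show ?thesis using \<open>s > 0\<close> by (simp add: powr_add)
  qed simp
  show "(\<lambda>n. s powr (p + 1) / max s (1 / real (Suc n))) \<longlonglongrightarrow> s powr p"
  proof (cases "s = 0")
    case False
    then have "s > 0" using assms by simp
    have "(\<lambda>n. 1 / real (Suc n)) \<longlonglongrightarrow> 0" by (rule LIMSEQ_Suc[OF lim_const_over_n])
    then have "(\<lambda>n. s powr (p + 1) / max s (1 / real (Suc n))) \<longlonglongrightarrow> s powr (p + 1) / max s 0"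
      using \<open>s > 0\<close> by (intro tendsto_intros) auto
    then show ?thesis using \<open>s > 0\<close> by (simp add: powr_add)
  qed simp
qed

text \<open>The approximating function in the variable \<open>v = exp (- t)\<close>, where
  \<open>1 - t\<close> reads \<open>1 + ln v\<close>. Clamping \<open>v\<close> at
  \<open>exp (-1)\<close> implements the cut-off at \<open>t = 1\<close> and keeps the logarithm
  away from 0; the last division cancels the weight \<open>exp (- t)\<close>.\<close>

lemma continuous_on_power_approximation:
  fixes p :: real
  assumes "p > -1"
  shows "continuous_on {0..1} (\<lambda>v. ((1 + ln (max v (exp (-1)))) powr (p + 1) / max (1 + ln (max v (exp (-1)))) (1 / real (Suc n)))
    / max v (exp (-1)))"
proof -
  have pos: "max v (exp (-1)) > 0" for v :: real by (simp add: less_max_iff_disj)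
  have ge: "1 + ln (max v (exp (-1))) \<ge> 0" for v :: real
  proof -
    have "ln (max v (exp (-1))) \<ge> ln (exp (-1))"
      using pos by (subst ln_le_cancel_iff) auto
    then show ?thesis by simp
  qed
  have m: "max s (1 / real (Suc n)) \<noteq> 0" for s :: real
    by (auto simp: max_def)
  have c: "continuous_on {0..1} (\<lambda>v. max v (exp (-1)) :: real)"
    by (intro continuous_intros)
  then have c2: "continuous_on {0..1} (\<lambda>v. 1 + ln (max v (exp (-1))) :: real)"
    using pos by (intro continuous_intros) (auto simp: less_le)
  have "continuous_on {0..1} (\<lambda>v. (1 + ln (max v (exp (-1)))) powr (p + 1) :: real)"
    using assms ge by (intro continuous_on_powr' c2 continuous_intros) auto
  then show ?thesis
    using m pos by (intro continuous_on_divide continuous_on_max continuous_on_const c c2) (auto simp: less_le)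
qed

lemma exp_power_approximation:
  fixes t p :: real
  assumes "t \<ge> 0"
  shows "exp (- t) * (((1 + ln (max (exp (- t)) (exp (-1)))) powr (p + 1) / max (1 + ln (max (exp (- t)) (exp (-1)))) c) / max (exp (- t)) (exp (-1)))
    = max 0 (1 - t) powr (p + 1) / max (max 0 (1 - t)) c"
  using assms by (cases "t \<le> 1") (auto simp: max_def)

text \<open>For Gaussian profiles the potential is a product of two Laplace transforms, those of
  \<open>r powr (b - 1)\<close> and of a Beta weight in \<open>w\<close>, hence the transform of the
  law of \<open>X * w + r\<close>. Testing this law with the cut-off power instead of an exponential
  gives the potential of the ball profile.\<close>

lemma riesz_potential_ball:
  fixes V :: "'a::euclidean_space \<Rightarrow> real" and x :: 'a and b p :: real
  assumes V: "solid_harmonic l V" and b: "0 < b" "2 * b < DIM('a)" and p: "p > -1" and x: "norm x < 1"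
  defines "\<nu> \<equiv> real DIM('a) / 2 + real l - b"
  shows "integrable lborel (\<lambda>y. V y * norm (y - x) powr (2 * b - DIM('a)) * max 0 (1 - (norm y)\<^sup>2) powr p)"
    and "(\<integral>y. V y * norm (y - x) powr (2 * b - DIM('a)) * max 0 (1 - (norm y)\<^sup>2) powr p \<partial>lborel)
      = pi powr (DIM('a) / 2) / (Gamma (DIM('a) / 2 - b) * Gamma b) * V x *
        (Beta b (p + 1) * (Beta \<nu> b * hyp2F1 \<nu> (- p - b) (DIM('a) / 2 + real l) ((norm x)\<^sup>2)))"
proof -
  define X where "X = (norm x)\<^sup>2"
  have X: "0 \<le> X" "X < 1" using x by (auto simp: X_def power_less_one_iff)
  have \<nu>: "\<nu> > 0" using b by (simp add: \<nu>_def)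
  have pol: "real_polynomial_function V"
    using V by (auto simp: solid_harmonic_def)
  note contV = continuous_on_real_polynomial[OF pol]
  have [measurable]: "V \<in> borel_measurable borel"
    by (rule borel_measurable_real_polynomial[OF pol])
  obtain B where "B \<ge> 0" and B: "\<And>y. y \<in> cball 0 1 \<Longrightarrow> \<bar>V y\<bar> \<le> B"
    using continuous_on_compact_abs_bounded[OF contV compact_cball] by blast
  define P where "P y = max 0 (1 - (norm y)\<^sup>2) powr p" for y :: 'a
  have P_eq: "P y = (if norm y < 1 then (1 - (norm y)\<^sup>2) powr p else 0)" for y
    by (auto simp: P_def max_def power_le_one_iff abs_square_less_1 not_less power_less_one_iff)
  have P: "integrable lborel P" "P y \<ge> 0" for y
    using integrable_ball_powr[OF p, where 'a = 'a] by (auto simp: P_eq[abs_def])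
  then have [measurable]: "P \<in> borel_measurable borel" by simp
  have VP: "integrable lborel (\<lambda>y. V y * P y)"
  proof (rule Bochner_Integration.integrable_bound[OF integrable_mult_right[OF P(1), of B]])
    have "\<bar>V y\<bar> * P y \<le> B * P y" for y
      using B[of y] P(2)[of y] by (cases "norm y < 1") (auto simp: P_eq intro!: mult_right_mono)
    then show "AE y in lborel. norm (V y * P y) \<le> norm (B * P y)"
      using P(2) \<open>B \<ge> 0\<close> by (simp add: abs_mult)
  qed measurable
  \<comment> \<open>Half the distance to the unit sphere: on this ball the profile is bounded even
    if \<open>p < 0\<close>.\<close>
  define \<delta> where "\<delta> = (1 - norm x) / 2"
  have \<delta>: "\<delta> > 0" using x by (simp add: \<delta>_def)
  have cont: "continuous_on (cball x \<delta>) (\<lambda>y. V y * (1 - (norm y)\<^sup>2) powr p)"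
  proof -
    have "1 - (norm y)\<^sup>2 \<noteq> 0" if "y \<in> cball x \<delta>" for y
    proof -
      have "norm y \<le> norm x + \<delta>" using that norm_triangle_sub[of y x] by (simp add: dist_norm norm_minus_commute)
      also have "norm x + \<delta> < 1" using x by (simp add: \<delta>_def field_simps)
      finally have "norm y < 1" .
      then have "(norm y)\<^sup>2 < 1" by (simp add: power_less_one_iff)
      then show ?thesis by simp
    qed
    then show ?thesis
      by (intro continuous_intros contV) auto
  qed
  obtain B' where "B' \<ge> 0" and B': "\<And>y. y \<in> cball x \<delta> \<Longrightarrow> \<bar>V y * (1 - (norm y)\<^sup>2) powr p\<bar> \<le> B'"
    using continuous_on_compact_abs_bounded[OF cont compact_cball] by blast
  have near: "\<bar>V y * P y\<bar> \<le> B'" if "norm (y - x) \<le> \<delta>" for y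
  proof -
    have "y \<in> cball x \<delta>" using that by (simp add: dist_norm norm_minus_commute)
    from B'[OF this] show ?thesis
      by (auto simp: P_eq intro: order_trans[OF abs_ge_zero])
  qed
  define h where "h y = V y * norm (y - x) powr (2 * b - DIM('a))" for y
  have [measurable]: "h \<in> borel_measurable borel" unfolding h_def by measurable
  have "integrable lborel (\<lambda>y. V y * P y * norm (y - x) powr (2 * b - DIM('a)))"
    using b by (intro integrable_riesz_kernel[OF VP _ _ \<delta> near]) auto
  then have hP: "integrable lborel (\<lambda>y. h y * P y)"
    by (simp add: h_def mult_ac)
  then show "integrable lborel (\<lambda>y. V y * norm (y - x) powr (2 * b - DIM('a)) * max 0 (1 - (norm y)\<^sup>2) powr p)"
    by (simp add: h_def P_def)
  define k where "k = pi powr (DIM('a) / 2) / (Gamma (DIM('a) / 2 - b) * Gamma b) * V x"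
  (* The image of W(w) R(r) dw dr under (w, r) \<mapsto> X w + r is, up to the factor k, the image of h(y) dy under |y|^2. *)
  define W where "W w = indicator {0..1} w * (w powr (\<nu> - 1) * (1 - w) powr (b - 1))" for w :: real
  define R where "R r = indicator {0..} r * r powr (b - 1)" for r :: real
  have [measurable]: "W \<in> borel_measurable borel" "R \<in> borel_measurable borel"
    unfolding W_def R_def by measurable
  have W0: "W w \<ge> 0" "w \<notin> {0..1} \<Longrightarrow> W w = 0" and R0: "R r \<ge> 0" "r < 0 \<Longrightarrow> R r = 0" for w r
    by (auto simp: W_def R_def)
  \<comment> \<open>Truncation at 0 changes nothing where \<open>W w * R r\<close> is nonzero, but
    makes \<open>exp (- \<tau> z)\<close> lie in the unit interval for every \<open>z\<close>, as
    the moment lemma demands.\<close>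
  define \<tau> where "\<tau> = (\<lambda>(w, r). max 0 (X * w + r))"
  have [measurable]: "\<tau> \<in> borel_measurable (lborel \<Otimes>\<^sub>M lborel)" unfolding \<tau>_def by measurable
  have \<tau>: "\<tau> (w, r) = X * w + r" if "W w * R r \<noteq> 0" for w r
  proof -
    have "w \<in> {0..1}" "r \<ge> 0" using that W0(2)[of w] R0(2)[of r] by (auto simp: not_less[symmetric])
    then show ?thesis using X by (simp add: \<tau>_def)
  qed
  have \<tau>0: "\<tau> z \<ge> 0" for z by (cases z) (simp add: \<tau>_def)
  have expint: "has_bochner_integral (lborel \<Otimes>\<^sub>M lborel) (\<lambda>(w, r). W w * R r * exp (- \<eta> * \<tau> (w, r)))
      (Gamma b * \<eta> powr (- b) * (\<integral>w. W w * exp (- (\<eta> * X * w)) \<partial>lborel))" if "\<eta> > 0" for \<eta>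
  proof (rule has_bochner_integral_pair)
    show "has_bochner_integral lborel (\<lambda>r. W w * R r * exp (- \<eta> * \<tau> (w, r)))
        (Gamma b * \<eta> powr (- b) * (W w * exp (- (\<eta> * X * w))))" for w
    proof -
      have "has_bochner_integral lborel (\<lambda>r. W w * exp (- (\<eta> * X * w)) * (indicator {0..} r * (r powr (b - 1) * exp (- \<eta> * r))))
          (W w * exp (- (\<eta> * X * w)) * (Gamma b * \<eta> powr (- b)))"
        by (intro has_bochner_integral_mult_right has_bochner_integral_Gamma_scaled b that)
      moreover have "W w * exp (- (\<eta> * X * w)) * (indicator {0..} r * (r powr (b - 1) * exp (- \<eta> * r)))
          = W w * R r * exp (- \<eta> * \<tau> (w, r))" for r
      proof (cases "W w * R r = 0")
        case False
        have "exp (- (\<eta> * X * w)) * exp (- \<eta> * r) = exp (- \<eta> * \<tau> (w, r))"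
          unfolding \<tau>[OF False] by (simp add: exp_add[symmetric] algebra_simps)
        then show ?thesis by (simp add: R_def)
      qed (auto simp: R_def)
      ultimately have "has_bochner_integral lborel (\<lambda>r. W w * R r * exp (- \<eta> * \<tau> (w, r)))
          (W w * exp (- (\<eta> * X * w)) * (Gamma b * \<eta> powr (- b)))"
        by (simp only:)
      then show ?thesis by (simp only: mult_ac)
    qed
    have "integrable lborel W"
      using has_bochner_integral_indicator_has_integral[OF has_integral_Beta_real[OF \<nu> b(1)]]
      by (auto simp: has_bochner_integral_iff W_def[abs_def])
    then have "integrable lborel (\<lambda>w. W w * exp (- (\<eta> * X * w)))"
    proof (rule Bochner_Integration.integrable_bound)
      have "W w * exp (- (\<eta> * X * w)) \<le> W w" for w
        using W0[of w] X that by (cases "w \<in> {0..1}") (auto intro!: mult_left_le)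
      then show "AE w in lborel. norm (W w * exp (- (\<eta> * X * w))) \<le> norm (W w)"
        using W0(1) by (simp add: abs_mult)
    qed measurable
    then show "has_bochner_integral lborel (\<lambda>w. Gamma b * \<eta> powr (- b) * (W w * exp (- (\<eta> * X * w))))
        (Gamma b * \<eta> powr (- b) * (\<integral>w. W w * exp (- (\<eta> * X * w)) \<partial>lborel))"
      by (intro has_bochner_integral_mult_right) (simp add: has_bochner_integral_iff)
  qed (use W0 R0 in auto)
  \<comment> \<open>Integrating over \<open>r\<close> first is a Beta integral up to
    \<open>1 - X * w\<close>; its power \<open>p + b\<close> supplies the remaining factor of
    Euler's integral.\<close>
  have powint: "has_bochner_integral (lborel \<Otimes>\<^sub>M lborel) (\<lambda>(w, r). W w * R r * max 0 (1 - \<tau> (w, r)) powr p)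
      (Beta b (p + 1) * (Beta \<nu> b * hyp2F1 \<nu> (- p - b) (\<nu> + b) X))"
  proof (rule has_bochner_integral_pair)
    show "has_bochner_integral lborel (\<lambda>r. W w * R r * max 0 (1 - \<tau> (w, r)) powr p)
        (Beta b (p + 1) * (indicator {0..1} w * (w powr (\<nu> - 1) * (1 - w) powr (b - 1) * (1 - X * w) powr (- (- p - b)))))" for w
    proof (cases "w \<in> {0..1}")
      case True
      then have "X * w \<le> X" using X by (intro mult_left_le) auto
      then have m: "1 - X * w > 0" using X by linarith
      have "has_bochner_integral lborel (\<lambda>r. W w * (indicator {0..} r * r powr (b - 1) * max 0 ((1 - X * w) - r) powr p))
          (W w * (Beta b (p + 1) * (1 - X * w) powr (p + b)))"
        by (intro has_bochner_integral_mult_right has_bochner_integral_Beta_scaled b p m)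
      moreover have "W w * (indicator {0..} r * r powr (b - 1) * max 0 ((1 - X * w) - r) powr p)
          = W w * R r * max 0 (1 - \<tau> (w, r)) powr p" for r
      proof (cases "W w * R r = 0")
        case False
        show ?thesis unfolding \<tau>[OF False] by (simp add: R_def algebra_simps)
      qed (auto simp: R_def)
      ultimately have "has_bochner_integral lborel (\<lambda>r. W w * R r * max 0 (1 - \<tau> (w, r)) powr p)
          (W w * (Beta b (p + 1) * (1 - X * w) powr (p + b)))"
        by (simp only:)
      moreover have "- (- p - b) = p + b" by simp
      ultimately show ?thesis unfolding W_def by (simp only: mult_ac)
    next
      case False
      then show ?thesis using W0(2)[OF False] by (simp add: has_bochner_integral_zero)
    qed
    show "has_bochner_integral lborel (\<lambda>w. Beta b (p + 1) * (indicator {0..1} w *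
        (w powr (\<nu> - 1) * (1 - w) powr (b - 1) * (1 - X * w) powr (- (- p - b)))))
        (Beta b (p + 1) * (Beta \<nu> b * hyp2F1 \<nu> (- p - b) (\<nu> + b) X))"
      by (intro has_bochner_integral_mult_right Euler_integral_hyp2F1 \<nu> b X)
  qed (use W0 R0 in auto)
  \<comment> \<open>The weight \<open>exp (- t)\<close> makes both densities integrable. It also
    shifts the index: the \<open>n\<close>-th moment in \<open>exp (- t)\<close> is the Laplace
    transform at \<open>n + 1\<close>, so only positive values of \<eta> occur.\<close>
  define g1 where "g1 y = h y * exp (- (norm y)\<^sup>2)" for y
  define g2 where "g2 = (\<lambda>(w, r). k * (W w * R r * exp (- \<tau> (w, r))))"
  have g1_int: "integrable lborel g1"
    using riesz_potential_gaussian(1)[OF V b, of 1 x] by (simp add: g1_def[abs_def] h_def)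
  have g2_int: "integrable (lborel \<Otimes>\<^sub>M lborel) g2"
  proof -
    have "integrable (lborel \<Otimes>\<^sub>M lborel) (\<lambda>z. k * (case z of (w, r) \<Rightarrow> W w * R r * exp (- 1 * \<tau> (w, r))))"
      using expint[of 1] by (intro integrable_mult_right) (auto simp: has_bochner_integral_iff)
    then show ?thesis by (simp add: g2_def case_prod_unfold)
  qed
  have moments: "(\<integral>y. g1 y * exp (- (norm y)\<^sup>2) ^ n \<partial>lborel) = (\<integral>z. g2 z * exp (- \<tau> z) ^ n \<partial>(lborel \<Otimes>\<^sub>M lborel))" for n
  proof -
    define \<eta> where "\<eta> = real n + 1"
    have \<eta>: "\<eta> > 0" by (simp add: \<eta>_def)
    have e: "exp (- t) * exp (- t) ^ n = exp (- \<eta> * t)" for t :: real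
      by (simp add: \<eta>_def exp_of_nat_mult[symmetric] exp_add[symmetric] algebra_simps)
    have "g1 y * exp (- (norm y)\<^sup>2) ^ n = V y * norm (y - x) powr (2 * b - DIM('a)) * exp (- \<eta> * (norm y)\<^sup>2)" for y
      unfolding g1_def h_def mult.assoc e ..
    then have "(\<integral>y. g1 y * exp (- (norm y)\<^sup>2) ^ n \<partial>lborel) = pi powr (DIM('a) / 2) / Gamma (DIM('a) / 2 - b) * V x * \<eta> powr (- b) *
        (\<integral>w. W w * exp (- (\<eta> * X * w)) \<partial>lborel)"
      using riesz_potential_gaussian(2)[OF V b \<eta>, of x] by (simp add: W_def X_def \<nu>_def)
    also have "\<dots> = k * (Gamma b * \<eta> powr (- b) * (\<integral>w. W w * exp (- (\<eta> * X * w)) \<partial>lborel))"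
      using Gamma_real_pos[OF b(1)] by (simp add: k_def)
    also have "\<dots> = (\<integral>z. k * (case z of (w, r) \<Rightarrow> W w * R r * exp (- \<eta> * \<tau> (w, r))) \<partial>(lborel \<Otimes>\<^sub>M lborel))"
      using has_bochner_integral_integral_eq[OF expint[OF \<eta>]] by simp
    also have "(\<lambda>z. k * (case z of (w, r) \<Rightarrow> W w * R r * exp (- \<eta> * \<tau> (w, r)))) = (\<lambda>z. g2 z * exp (- \<tau> z) ^ n)"
      unfolding g2_def e[symmetric] by (auto simp: fun_eq_iff)
    finally show ?thesis .
  qed
  define \<psi> where "\<psi> n s = s powr (p + 1) / max s (1 / real (Suc n))" for n :: nat and s :: real
  have [measurable]: "\<psi> n \<in> borel_measurable borel" for n unfolding \<psi>_def by measurable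
  have approx: "(\<integral>y. h y * \<psi> n (max 0 (1 - (norm y)\<^sup>2)) \<partial>lborel)
      = (\<integral>z. k * (case z of (w, r) \<Rightarrow> W w * R r * \<psi> n (max 0 (1 - \<tau> (w, r)))) \<partial>(lborel \<Otimes>\<^sub>M lborel))" for n
  proof -
    define f where "f v = ((1 + ln (max v (exp (-1)))) powr (p + 1) / max (1 + ln (max v (exp (-1)))) (1 / real (Suc n))) / max v (exp (-1))" for v
    have f: "exp (- t) * f (exp (- t)) = \<psi> n (max 0 (1 - t))" if "t \<ge> 0" for t
      unfolding f_def \<psi>_def by (rule exp_power_approximation[OF that])
    have "(\<integral>y. g1 y * f (exp (- (norm y)\<^sup>2)) \<partial>lborel) = (\<integral>z. g2 z * f (exp (- \<tau> z)) \<partial>(lborel \<Otimes>\<^sub>M lborel))"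
    proof (rule moments_determine_integrals[OF g1_int g2_int _ _ _ _ moments])
      show "continuous_on {0..1} f"
        unfolding f_def by (rule continuous_on_power_approximation[OF p])
    qed (use \<tau>0 in auto)
    moreover have "g1 y * f (exp (- (norm y)\<^sup>2)) = h y * \<psi> n (max 0 (1 - (norm y)\<^sup>2))" for y
      using f[of "(norm y)\<^sup>2"] by (simp add: g1_def)
    moreover have "g2 z * f (exp (- \<tau> z)) = k * (case z of (w, r) \<Rightarrow> W w * R r * \<psi> n (max 0 (1 - \<tau> (w, r))))" for z
      using f[OF \<tau>0, of z] by (cases z) (simp add: g2_def mult.assoc)
    ultimately show ?thesis by simp
  qed
  have \<psi>_le: "\<bar>\<psi> n s\<bar> \<le> s powr p" if "s \<ge> 0" for n s
    unfolding \<psi>_def by (simp only: abs_of_nonneg power_approximation(2,3)[OF that])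
  \<comment> \<open>Dominated convergence removes the regularisation; the majorant is the integrand
    with the true power, integrable although that power may blow up at the sphere.\<close>
  have lim1: "(\<lambda>n. \<integral>y. h y * \<psi> n (max 0 (1 - (norm y)\<^sup>2)) \<partial>lborel) \<longlonglongrightarrow> (\<integral>y. h y * P y \<partial>lborel)"
  proof (rule integral_dominated_convergence)
    show "integrable lborel (\<lambda>y. norm (h y * P y))" by (rule integrable_norm[OF hP])
    show "AE y in lborel. (\<lambda>n. h y * \<psi> n (max 0 (1 - (norm y)\<^sup>2))) \<longlonglongrightarrow> h y * P y"
      unfolding \<psi>_def P_def by (intro AE_I2 tendsto_intros power_approximation) auto
    show "AE y in lborel. norm (h y * \<psi> n (max 0 (1 - (norm y)\<^sup>2))) \<le> norm (h y * P y)" for n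
      unfolding P_def by (intro AE_I2) (auto simp: abs_mult \<psi>_le intro!: mult_left_mono)
  qed measurable
  have lim2: "(\<lambda>n. \<integral>z. k * (case z of (w, r) \<Rightarrow> W w * R r * \<psi> n (max 0 (1 - \<tau> (w, r)))) \<partial>(lborel \<Otimes>\<^sub>M lborel))
      \<longlonglongrightarrow> (\<integral>z. k * (case z of (w, r) \<Rightarrow> W w * R r * max 0 (1 - \<tau> (w, r)) powr p) \<partial>(lborel \<Otimes>\<^sub>M lborel))"
  proof (rule integral_dominated_convergence)
    show "integrable (lborel \<Otimes>\<^sub>M lborel) (\<lambda>z. norm (k * (case z of (w, r) \<Rightarrow> W w * R r * max 0 (1 - \<tau> (w, r)) powr p)))"
      using powint by (intro integrable_norm integrable_mult_right) (simp add: has_bochner_integral_iff)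
    show "AE z in lborel \<Otimes>\<^sub>M lborel. (\<lambda>n. k * (case z of (w, r) \<Rightarrow> W w * R r * \<psi> n (max 0 (1 - \<tau> (w, r)))))
        \<longlonglongrightarrow> k * (case z of (w, r) \<Rightarrow> W w * R r * max 0 (1 - \<tau> (w, r)) powr p)"
      unfolding \<psi>_def case_prod_unfold by (intro AE_I2 tendsto_intros power_approximation) auto
    show "AE z in lborel \<Otimes>\<^sub>M lborel. norm (k * (case z of (w, r) \<Rightarrow> W w * R r * \<psi> n (max 0 (1 - \<tau> (w, r)))))
        \<le> norm (k * (case z of (w, r) \<Rightarrow> W w * R r * max 0 (1 - \<tau> (w, r)) powr p))" for n
      unfolding case_prod_unfold by (intro AE_I2) (auto simp: abs_mult \<psi>_le intro!: mult_left_mono)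
  qed measurable
  have "(\<integral>y. h y * P y \<partial>lborel) = (\<integral>z. k * (case z of (w, r) \<Rightarrow> W w * R r * max 0 (1 - \<tau> (w, r)) powr p) \<partial>(lborel \<Otimes>\<^sub>M lborel))"
    using LIMSEQ_unique[OF lim1[unfolded approx] lim2] .
  also have "\<dots> = k * (Beta b (p + 1) * (Beta \<nu> b * hyp2F1 \<nu> (- p - b) (\<nu> + b) X))"
    using has_bochner_integral_integral_eq[OF powint] by simp
  finally show "(\<integral>y. V y * norm (y - x) powr (2 * b - DIM('a)) * max 0 (1 - (norm y)\<^sup>2) powr p \<partial>lborel)
      = pi powr (DIM('a) / 2) / (Gamma (DIM('a) / 2 - b) * Gamma b) * V x *
        (Beta b (p + 1) * (Beta \<nu> b * hyp2F1 \<nu> (- p - b) (DIM('a) / 2 + real l) ((norm x)\<^sup>2)))"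
    by (simp add: h_def P_def k_def X_def \<nu>_def)
qed

section \<open>Analytic continuation of singular integrals\<close>

lemma lborel_reflect:
  fixes f :: "'a::euclidean_space \<Rightarrow> 'b::{banach, second_countable_topology}"
  assumes "f \<in> borel_measurable borel"
  shows "integrable lborel (\<lambda>h. f (- h)) \<longleftrightarrow> integrable lborel f"
    and "(\<integral>h. f (- h) \<partial>lborel) = (\<integral>h. f h \<partial>lborel)"
proof -
  have m: "(\<lambda>h::'a. - h) \<in> borel_measurable lborel" by measurable
  have d: "distr lborel borel (\<lambda>h::'a. - h) = lborel"
    using lborel_affine[of "-1" "0::'a"] by (simp add: density_1)
  show "integrable lborel (\<lambda>h. f (- h)) \<longleftrightarrow> integrable lborel f"
    using integrable_distr_eq[OF m assms] by (simp add: d)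
  show "(\<integral>h. f (- h) \<partial>lborel) = (\<integral>h. f h \<partial>lborel)"
    using integral_distr[OF m assms] by (simp add: d)
qed

text \<open>Averaging over \<open>h\<close> and \<open>- h\<close> cancels first-order terms and
  replaces increments of \<open>u\<close> by second differences.\<close>

lemma lborel_symmetrize:
  fixes f :: "'a::euclidean_space \<Rightarrow> real"
  assumes "integrable lborel f"
  shows "(\<integral>h. f h \<partial>lborel) = (\<integral>h. f h + f (- h) \<partial>lborel) / 2"
proof -
  have m: "f \<in> borel_measurable borel" using assms by simp
  have "(\<integral>h. f h + f (- h) \<partial>lborel) = (\<integral>h. f h \<partial>lborel) + (\<integral>h. f (- h) \<partial>lborel)"
    using assms lborel_reflect(1)[OF m] by (intro Bochner_Integration.integral_add) auto
  then show ?thesis using lborel_reflect(2)[OF m] by simp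
qed

text \<open>Only integrability, bounded support around \<open>x\<close> and a quadratic bound on
  second differences at \<open>x\<close> are recorded, since the ball profile may be unbounded near
  the unit sphere.\<close>

locale singular_integral =
  fixes u :: "'a::euclidean_space \<Rightarrow> real" and x :: 'a and C \<delta> M :: real
  assumes u_integrable: "integrable lborel u"
    and support: "\<And>h. norm h > M \<Longrightarrow> u (x + h) = 0"
    and \<delta>_pos: "\<delta> > 0"
    and second_difference: "\<And>h. norm h \<le> \<delta> \<Longrightarrow> \<bar>u (x + h) + u (x - h) - 2 * u x\<bar> \<le> C * (norm h)\<^sup>2"
begin

definition kernel :: "real \<Rightarrow> 'a \<Rightarrow> real" where
  "kernel a h = norm h powr (- a - DIM('a))"

definition diff2 :: "'a \<Rightarrow> real" where
  "diff2 h = u (x + h) + u (x - h) - 2 * u x"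

definition far :: "real \<Rightarrow> real" where
  "far a = (\<integral>h. indicator {h. \<delta> < norm h} h * (u (x + h) * kernel a h) \<partial>lborel)"

definition near :: "real \<Rightarrow> real" where
  "near a = (\<integral>h. indicator {h. norm h \<le> \<delta>} h * (diff2 h * kernel a h) \<partial>lborel)"

text \<open>
  \<open>continued a / a\<close> is the analytic continuation of \<open>a \<mapsto> \<integral> u(y) |y - x|\<^sup>-\<^sup>d\<^sup>-\<^sup>a dy\<close> from \<open>a < 0\<close>
  to \<open>0 < a < 2\<close>, where it becomes minus the principal value integral.
\<close>

definition continued :: "real \<Rightarrow> real" where
  "continued a = a * (far a + near a / 2) - u x * sphere_area DIM('a) * \<delta> powr (- a)"

section \<open>Integrability near and away from the singularity\<close>

lemma u_measurable [measurable]: "u \<in> borel_measurable borel"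
  using u_integrable by simp

lemma kernel_measurable [measurable]: "kernel a \<in> borel_measurable borel"
  unfolding kernel_def by measurable

lemma diff2_measurable [measurable]: "diff2 \<in> borel_measurable borel"
  unfolding diff2_def by measurable

lemma kernel_nonneg: "kernel a h \<ge> 0"
  by (simp add: kernel_def)

lemma kernel_minus: "kernel a (- h) = kernel a h"
  by (simp add: kernel_def)

lemma integrable_kernel_outside:
  "a > 0 \<Longrightarrow> \<epsilon> > 0 \<Longrightarrow> integrable lborel (\<lambda>h. indicator {h. \<epsilon> < norm h} h * kernel a h)"
  using has_bochner_integral_norm_powr_outside[of a \<epsilon>, where 'a = 'a]
  by (auto simp: has_bochner_integral_iff kernel_def)

text \<open>On the shell between \<epsilon> and \<open>M\<close> the kernel is bounded by one of its
  two boundary values, whichever sign the exponent has. No restriction on \<open>a\<close> arises,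
  so the far part exists for all orders.\<close>

lemma integrable_u_kernel_outside:
  assumes "\<epsilon> > 0"
  shows "integrable lborel (\<lambda>h. indicator {h. \<epsilon> < norm h} h * (u (x + h) * kernel a h))"
proof -
  define e where "e = - a - DIM('a)"
  have "integrable lborel (\<lambda>h. u (x + h))" using lborel_translate(1)[of u x] u_integrable by simp
  from integrable_mult_right[OF integrable_norm[OF this], of "max (\<epsilon> powr e) (M powr e)"]
  show ?thesis
  proof (rule Bochner_Integration.integrable_bound)
    have "norm (indicator {h. \<epsilon> < norm h} h * (u (x + h) * kernel a h)) \<le> max (\<epsilon> powr e) (M powr e) * norm (u (x + h))" for h
    proof (cases "\<epsilon> < norm h \<and> norm h \<le> M")
      case True
      have "kernel a h \<le> max (\<epsilon> powr e) (M powr e)"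
      proof (cases "e \<ge> 0")
        case True
        then have "norm h powr e \<le> M powr e" using \<open>\<epsilon> < norm h \<and> norm h \<le> M\<close> assms by (intro powr_mono2) auto
        then show ?thesis by (simp add: kernel_def e_def)
      next
        case False
        then have "norm h powr e \<le> \<epsilon> powr e" using \<open>\<epsilon> < norm h \<and> norm h \<le> M\<close> assms by (intro powr_mono2') auto
        then show ?thesis by (simp add: kernel_def e_def)
      qed
      then have "\<bar>u (x + h)\<bar> * kernel a h \<le> \<bar>u (x + h)\<bar> * max (\<epsilon> powr e) (M powr e)"
        by (intro mult_left_mono) auto
      then show ?thesis using True kernel_nonneg[of a h] by (simp add: abs_mult mult.commute)
    next
      case False
      then have "indicator {h. \<epsilon> < norm h} h * (u (x + h) * kernel a h) = 0"
        using support[of h] by (auto simp: indicator_def)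
      then show ?thesis by (simp only: norm_zero) (simp add: le_max_iff_disj)
    qed
    then show "AE h in lborel. norm (indicator {h. \<epsilon> < norm h} h * (u (x + h) * kernel a h))
      \<le> norm (max (\<epsilon> powr e) (M powr e) * norm (u (x + h)))"
      by (intro AE_I2) (auto intro: order_trans[OF _ abs_ge_self])
  qed measurable
qed

text \<open>A second difference gains two powers of the distance. The resulting excess
  \<open>2 - a\<close> over the critical exponent is positive exactly below order 2.\<close>

lemma diff2_kernel_le:
  assumes "norm h \<le> \<delta>"
  shows "\<bar>diff2 h * kernel a h\<bar> \<le> C * norm h powr ((2 - a) - DIM('a))"
proof -
  have "\<bar>diff2 h\<bar> * kernel a h \<le> (C * (norm h)\<^sup>2) * kernel a h"
    using second_difference[OF assms] unfolding diff2_def by (intro mult_right_mono kernel_nonneg)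
  also have "(norm h)\<^sup>2 * kernel a h = norm h powr ((2 - a) - DIM('a))"
  proof (cases "h = 0")
    case False
    have "(norm h)\<^sup>2 * kernel a h = norm h powr 2 * norm h powr (- a - DIM('a))"
      using False by (simp add: kernel_def)
    also have "\<dots> = norm h powr (2 + (- a - DIM('a)))" by (simp only: powr_add)
    also have "2 + (- a - DIM('a)) = (2 - a) - DIM('a)" by simp
    finally show ?thesis .
  qed (simp add: kernel_def)
  then have "(C * (norm h)\<^sup>2) * kernel a h = C * norm h powr ((2 - a) - DIM('a))"
    by (simp add: mult.assoc)
  finally show ?thesis using kernel_nonneg[of a h] by (simp add: abs_mult)
qed

lemma diff2_kernel_inside:
  assumes "a < 2" "0 < \<epsilon>" "\<epsilon> \<le> \<delta>"
  shows "integrable lborel (\<lambda>h. indicator {h. norm h \<le> \<epsilon>} h * (diff2 h * kernel a h))"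
    and "\<bar>\<integral>h. indicator {h. norm h \<le> \<epsilon>} h * (diff2 h * kernel a h) \<partial>lborel\<bar>
      \<le> C * (sphere_area DIM('a) * (\<epsilon> powr (2 - a) / (2 - a)))"
proof -
  have hb: "has_bochner_integral lborel (\<lambda>h::'a. C * (indicator {h. norm h \<le> \<epsilon>} h * norm h powr ((2 - a) - DIM('a))))
      (C * (sphere_area DIM('a) * (\<epsilon> powr (2 - a) / (2 - a))))"
    using assms by (intro has_bochner_integral_mult_right has_bochner_integral_norm_powr_ball) auto
  then have int: "integrable lborel (\<lambda>h::'a. C * (indicator {h. norm h \<le> \<epsilon>} h * norm h powr ((2 - a) - DIM('a))))"
    by (simp add: has_bochner_integral_iff)
  have le: "norm (indicator {h. norm h \<le> \<epsilon>} h * (diff2 h * kernel a h))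
      \<le> C * (indicator {h. norm h \<le> \<epsilon>} h * norm h powr ((2 - a) - DIM('a)))" for h
    using diff2_kernel_le[of h a] assms by (auto simp: indicator_def)
  show int2: "integrable lborel (\<lambda>h. indicator {h. norm h \<le> \<epsilon>} h * (diff2 h * kernel a h))"
    by (rule Bochner_Integration.integrable_bound[OF int _ AE_I2])
       (use le in \<open>auto intro: order_trans[OF _ abs_ge_self]\<close>)
  show "\<bar>\<integral>h. indicator {h. norm h \<le> \<epsilon>} h * (diff2 h * kernel a h) \<partial>lborel\<bar>
      \<le> C * (sphere_area DIM('a) * (\<epsilon> powr (2 - a) / (2 - a)))"
    using norm_integral_le[OF int2 int le] has_bochner_integral_integral_eq[OF hb] by simp
qed

text \<open>On the inner ball, symmetrising turns \<open>u (x + h)\<close> into half the second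
  difference plus \<open>u x\<close>. The constant part integrates, because \<open>a < 0\<close>, to
  a multiple of \<open>\<delta> powr (- a) / (- a)\<close>: this is the pole at
  \<open>a = 0\<close>, removed by the factor \<open>a\<close>.\<close>

lemma continued_eq_Riesz_potential:
  fixes a :: real
  assumes a: "- DIM('a) < a" "a < 0" and int: "integrable lborel (\<lambda>y. u y * norm (y - x) powr (- a - DIM('a)))"
  shows "a * (\<integral>y. u y * norm (y - x) powr (- a - DIM('a)) \<partial>lborel) = continued a"
proof -
  define g where "g h = u (x + h) * kernel a h" for h
  have [measurable]: "g \<in> borel_measurable borel" unfolding g_def by measurable
  have tr: "integrable lborel (\<lambda>h. u (x + h) * norm (x + h - x) powr (- a - DIM('a)))"
      "(\<integral>h. u (x + h) * norm (x + h - x) powr (- a - DIM('a)) \<partial>lborel) = (\<integral>y. u y * norm (y - x) powr (- a - DIM('a)) \<partial>lborel)"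
    using lborel_translate[of "\<lambda>y. u y * norm (y - x) powr (- a - DIM('a))" x] int by auto
  then have g: "integrable lborel g" "(\<integral>h. g h \<partial>lborel) = (\<integral>y. u y * norm (y - x) powr (- a - DIM('a)) \<partial>lborel)"
    by (simp_all add: g_def[abs_def] kernel_def)
  define gi where "gi h = indicator {h. norm h \<le> \<delta>} h * g h" for h
  define go where "go h = indicator {h. \<delta> < norm h} h * g h" for h
  have gi: "integrable lborel gi" and go: "integrable lborel go"
    unfolding gi_def go_def using integrable_mult_indicator[OF _ g(1)] by auto
  have "g h = go h + gi h" for h by (auto simp: gi_def go_def indicator_def)
  then have "(\<integral>h. g h \<partial>lborel) = (\<integral>h. go h \<partial>lborel) + (\<integral>h. gi h \<partial>lborel)"
    using gi go by simp
  also have "(\<integral>h. go h \<partial>lborel) = far a" by (simp add: go_def g_def far_def)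
  also have "(\<integral>h. gi h \<partial>lborel) = (\<integral>h. gi h + gi (- h) \<partial>lborel) / 2"
    by (rule lborel_symmetrize[OF gi])
  also have "(\<lambda>h. gi h + gi (- h)) = (\<lambda>h. indicator {h. norm h \<le> \<delta>} h * (diff2 h * kernel a h)
      + 2 * u x * (indicator {h. norm h \<le> \<delta>} h * norm h powr (- a - DIM('a))))"
    by (auto simp: fun_eq_iff gi_def g_def diff2_def kernel_minus indicator_def kernel_def algebra_simps)
  also have "(\<integral>h. indicator {h. norm h \<le> \<delta>} h * (diff2 h * kernel a h)
      + 2 * u x * (indicator {h. norm h \<le> \<delta>} h * norm h powr (- a - DIM('a))) \<partial>lborel)
      = near a + 2 * u x * (sphere_area DIM('a) * (\<delta> powr (- a) / (- a)))"
  proof -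
    have "has_bochner_integral lborel (\<lambda>h::'a. 2 * u x * (indicator {h. norm h \<le> \<delta>} h * norm h powr (- a - DIM('a))))
        (2 * u x * (sphere_area DIM('a) * (\<delta> powr (- a) / (- a))))"
      using a \<delta>_pos by (intro has_bochner_integral_mult_right has_bochner_integral_norm_powr_ball[of "- a"]) auto
    then show ?thesis
      using diff2_kernel_inside(1)[of a \<delta>] a \<delta>_pos
      by (subst Bochner_Integration.integral_add) (auto simp: has_bochner_integral_iff near_def)
  qed
  finally show ?thesis
    unfolding g(2) continued_def using a by (simp add: field_simps)
qed

text \<open>For \<open>a > 0\<close> the kernel is integrated outside the ball, giving
  \<open>\<delta> powr (- a) / a\<close>, the negative of what the inner ball gives for
  \<open>a < 0\<close>. The principal value carries the opposite sign of \<open>u (x + h)\<close>,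
  so one expression serves both ranges of the order.\<close>

lemma has_principal_value_frac_lap_integrand:
  fixes a :: real
  assumes a: "0 < a" "a < 2"
  shows "has_principal_value (frac_lap_integrand a u x) x (- continued a / a)"
proof -
  define g where "g h = (u x - u (x + h)) * kernel a h" for h
  have [measurable]: "g \<in> borel_measurable borel" unfolding g_def by measurable
  have [measurable]: "frac_lap_integrand a u x \<in> borel_measurable borel"
    unfolding frac_lap_integrand_def by measurable
  have eq: "indicator {y. \<epsilon> < dist x y} (x + h) *\<^sub>R frac_lap_integrand a u x (x + h)
      = indicator {h. \<epsilon> < norm h} h * g h" for h \<epsilon>
  proof -
    have "- a - DIM('a) = - (DIM('a) + a)" by simp
    then show ?thesis
      unfolding g_def kernel_def frac_lap_integrand_def powr_minus
      by (simp only: powr_minus) (simp add: indicator_def dist_norm divide_inverse)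
  qed
  have gK: "indicator {h. \<epsilon> < norm h} h * g h
      = u x * (indicator {h. \<epsilon> < norm h} h * kernel a h) - indicator {h. \<epsilon> < norm h} h * (u (x + h) * kernel a h)" for h \<epsilon>
    by (simp add: g_def algebra_simps)
  have int: "integrable lborel (\<lambda>h. indicator {h. \<epsilon> < norm h} h * g h)" if "\<epsilon> > 0" for \<epsilon>
    unfolding gK by (intro Bochner_Integration.integrable_diff integrable_mult_right
        integrable_kernel_outside integrable_u_kernel_outside a that)
  have m: "(\<lambda>y. indicator {y. \<epsilon> < dist x y} y *\<^sub>R frac_lap_integrand a u x y) \<in> borel_measurable borel" for \<epsilon>
    by measurable
  define PV where "PV \<epsilon> = (\<integral>h. indicator {h. \<epsilon> < norm h} h * g h \<partial>lborel)" for \<epsilon>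
  have PV: "(LINT y:{y. \<epsilon> < dist x y}|lborel. frac_lap_integrand a u x y) = PV \<epsilon>" for \<epsilon>
    unfolding set_lebesgue_integral_def PV_def using lborel_translate(2)[OF m, of \<epsilon> x] by (simp only: eq)
  have si: "set_integrable lborel {y. \<epsilon> < dist x y} (frac_lap_integrand a u x)" if "\<epsilon> > 0" for \<epsilon>
    unfolding set_integrable_def using lborel_translate(1)[OF m, of \<epsilon> x] int[OF that] by (simp only: eq)
  define b where "b \<epsilon> = C * (sphere_area DIM('a) * (\<epsilon> powr (2 - a) / (2 - a))) / 2" for \<epsilon>
  \<comment> \<open>The deviation from the limit is half the second-difference integral over the
    ball of radius \<epsilon>, which is of order \<epsilon> to the power
    \<open>2 - a\<close>.\<close>
  have bound: "\<bar>PV \<epsilon> - (- continued a / a)\<bar> \<le> b \<epsilon>" if \<epsilon>: "0 < \<epsilon>" "\<epsilon> < \<delta>" for \<epsilon>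
  proof -
    define gi where "gi h = indicator {h. \<epsilon> < norm h \<and> norm h \<le> \<delta>} h * g h" for h
    have gi: "gi h = indicator {h. norm h \<le> \<delta>} h *\<^sub>R (indicator {h. \<epsilon> < norm h} h * g h)" for h
      by (auto simp: gi_def indicator_def)
    have gi_int: "integrable lborel gi"
      unfolding gi[abs_def] by (rule integrable_mult_indicator[OF _ int[OF \<epsilon>(1)]]) simp
    have "PV \<epsilon> = (\<integral>h. indicator {h. \<delta> < norm h} h * g h + gi h \<partial>lborel)"
      unfolding PV_def using \<epsilon> by (intro Bochner_Integration.integral_cong) (auto simp: gi_def indicator_def)
    also have "\<dots> = (\<integral>h. indicator {h. \<delta> < norm h} h * g h \<partial>lborel) + (\<integral>h. gi h \<partial>lborel)"
      by (rule Bochner_Integration.integral_add[OF int[OF \<delta>_pos] gi_int])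
    also have "(\<integral>h. indicator {h. \<delta> < norm h} h * g h \<partial>lborel) = u x * (sphere_area DIM('a) * (\<delta> powr (- a) / a)) - far a"
      unfolding gK far_def
      using has_bochner_integral_integral_eq[OF has_bochner_integral_norm_powr_outside[OF a(1) \<delta>_pos, where 'a = 'a]]
        integrable_kernel_outside[OF a(1) \<delta>_pos] integrable_u_kernel_outside[OF \<delta>_pos]
      by (simp add: kernel_def)
    also have "(\<integral>h. gi h \<partial>lborel) = (\<integral>h. gi h + gi (- h) \<partial>lborel) / 2"
      by (rule lborel_symmetrize[OF gi_int])
    \<comment> \<open>On the shell the symmetrised integrand is minus the second difference times
      the kernel, written as the ball of radius \<epsilon> minus the ball of radius
      \<delta>.\<close>
    also have "(\<lambda>h. gi h + gi (- h)) = (\<lambda>h. indicator {h. norm h \<le> \<epsilon>} h * (diff2 h * kernel a h)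
        - indicator {h. norm h \<le> \<delta>} h * (diff2 h * kernel a h))"
      using \<epsilon> by (auto simp: fun_eq_iff gi_def g_def diff2_def kernel_minus indicator_def algebra_simps)
    also have "(\<integral>h. indicator {h. norm h \<le> \<epsilon>} h * (diff2 h * kernel a h)
        - indicator {h. norm h \<le> \<delta>} h * (diff2 h * kernel a h) \<partial>lborel)
        = (\<integral>h. indicator {h. norm h \<le> \<epsilon>} h * (diff2 h * kernel a h) \<partial>lborel) - near a"
      unfolding near_def using diff2_kernel_inside(1)[of a \<epsilon>] diff2_kernel_inside(1)[of a \<delta>] a \<epsilon> \<delta>_pos
      by (intro Bochner_Integration.integral_diff) auto
    finally have "PV \<epsilon> - (- continued a / a) = (\<integral>h. indicator {h. norm h \<le> \<epsilon>} h * (diff2 h * kernel a h) \<partial>lborel) / 2"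
      unfolding continued_def using a by (simp add: field_simps)
    then have "\<bar>PV \<epsilon> - (- continued a / a)\<bar> = \<bar>\<integral>h. indicator {h. norm h \<le> \<epsilon>} h * (diff2 h * kernel a h) \<partial>lborel\<bar> / 2"
      by (simp only: abs_divide abs_numeral)
    also have "\<dots> \<le> b \<epsilon>"
      unfolding b_def using a \<epsilon> by (intro divide_right_mono diff2_kernel_inside(2)) auto
    finally show ?thesis .
  qed
  have "(PV \<longlongrightarrow> - continued a / a) (at_right 0)"
  proof (rule Lim_transform[OF tendsto_const], rule Lim_null_comparison)
    have "\<forall>\<^sub>F \<epsilon> in at_right 0. 0 < \<epsilon> \<and> \<epsilon> < \<delta>"
      using \<delta>_pos by (auto simp: eventually_at_right_field)
    then show "\<forall>\<^sub>F \<epsilon> in at_right 0. norm (PV \<epsilon> - (- continued a / a)) \<le> b \<epsilon>"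
      by eventually_elim (use bound in auto)
    have "((\<lambda>\<epsilon>. \<epsilon> powr (2 - a)) \<longlongrightarrow> 0) (at_right 0)"
      using a by real_asymp
    then have "(b \<longlongrightarrow> C * (sphere_area DIM('a) * (0 / (2 - a))) / 2) (at_right 0)"
      unfolding b_def[abs_def] using a by (intro tendsto_intros) auto
    then show "(b \<longlongrightarrow> 0) (at_right 0)" by simp
  qed
  then show ?thesis
    unfolding has_principal_value_def using si PV by simp
qed

text \<open>Every power of the distance is split into the kernel of order 0 and an exponential in
  \<open>z\<close>, the shape required for holomorphy. At \<open>h = 0\<close> the kernel of order 0
  is 0, so the value of \<open>ln\<close> there is irrelevant.\<close>

definition continued_complex :: "complex \<Rightarrow> complex" where
  "continued_complex z =
     z * ((\<integral>h. of_real (indicator {h. \<delta> < norm h} h * (u (x + h) * kernel 0 h)) * exp (z * of_real (- ln (norm h))) \<partial>lborel)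
       + (\<integral>h. of_real (indicator {h. norm h \<le> \<delta>} h * (diff2 h * kernel 0 h)) * exp (z * of_real (- ln (norm h))) \<partial>lborel) / 2)
     - of_real (u x * sphere_area DIM('a)) * exp (z * of_real (- ln \<delta>))"

lemma kernel_eq_exp: "kernel 0 h * exp (a * - ln (norm h)) = kernel a h"
  by (cases "h = 0") (simp_all add: kernel_def powr_def exp_add[symmetric] algebra_simps)

lemma continued_complex_of_real: "continued_complex (of_real a) = of_real (continued a)"
proof -
  have e: "of_real (i * (v * kernel 0 h)) * exp (of_real a * of_real (- ln (norm h))) = complex_of_real (i * (v * kernel a h))"
    for i v h
    unfolding kernel_eq_exp[of h a, symmetric] by (simp add: exp_of_real[symmetric])
  have "exp (of_real a * of_real (- ln \<delta>)) = complex_of_real (\<delta> powr (- a))"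
    using \<delta>_pos by (simp add: powr_def exp_of_real[symmetric])
  then show ?thesis
    unfolding continued_complex_def e integral_complex_of_real continued_def far_def near_def by simp
qed

text \<open>Both integrals converge for arbitrarily negative orders, so the left bound is free; the
  right bound 2 comes from the near part.\<close>

lemma holomorphic_continued_complex: "continued_complex holomorphic_on {z. - B < Re z \<and> Re z < 2}"
proof -
  have L: "(\<lambda>h::'a. - ln (norm h)) \<in> borel_measurable lborel" by measurable
  have e: "(i * (v * kernel 0 h)) * exp (c * - ln (norm h)) = i * (v * kernel c h)" for i v h c
    unfolding kernel_eq_exp[of h c, symmetric] by (simp only: mult.assoc)
  have 1: "(\<lambda>z. \<integral>h. of_real (indicator {h. \<delta> < norm h} h * (u (x + h) * kernel 0 h)) * exp (z * of_real (- ln (norm h))) \<partial>lborel)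
      holomorphic_on {z. - B < Re z \<and> Re z < 2}"
  proof (rule holomorphic_on_exponential_integral[OF _ _ L])
    show "integrable lborel (\<lambda>h. indicator {h. \<delta> < norm h} h * (u (x + h) * kernel 0 h) * exp (c * - ln (norm h)))" for c
      unfolding e by (rule integrable_u_kernel_outside[OF \<delta>_pos])
  qed measurable
  have 2: "(\<lambda>z. \<integral>h. of_real (indicator {h. norm h \<le> \<delta>} h * (diff2 h * kernel 0 h)) * exp (z * of_real (- ln (norm h))) \<partial>lborel)
      holomorphic_on {z. - B < Re z \<and> Re z < 2}"
  proof (rule holomorphic_on_exponential_integral[OF _ _ L])
    show "integrable lborel (\<lambda>h. indicator {h. norm h \<le> \<delta>} h * (diff2 h * kernel 0 h) * exp (c * - ln (norm h)))" if "c < 2" for c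
      unfolding e by (rule diff2_kernel_inside(1)[OF that \<delta>_pos order_refl])
  qed measurable
  show ?thesis
    unfolding continued_complex_def[abs_def] by (intro holomorphic_intros 1 2) auto
qed

end

section \<open>First-order expansions with quadratic remainder\<close>

text \<open>A pointwise substitute for twice continuous differentiability. The linear parts at
  \<open>h\<close> and \<open>- h\<close> cancel in a second difference, and the notion is stable
  under sums, products and composition, so the profile can be treated factor by factor.\<close>

definition quadratic_expansion :: "('a::real_normed_vector \<Rightarrow> real) \<Rightarrow> 'a \<Rightarrow> bool" where
  "quadratic_expansion f x \<longleftrightarrow> (\<exists>L C \<delta>. bounded_linear L \<and> 0 \<le> C \<and> 0 < \<delta> \<and>
     (\<forall>h. norm h \<le> \<delta> \<longrightarrow> \<bar>f (x + h) - f x - L h\<bar> \<le> C * (norm h)\<^sup>2))"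

lemma quadratic_expansionI:
  assumes "bounded_linear L" "0 \<le> C" "0 < \<delta>"
    "\<And>h. norm h \<le> \<delta> \<Longrightarrow> \<bar>f (x + h) - f x - L h\<bar> \<le> C * (norm h)\<^sup>2"
  shows "quadratic_expansion f x"
  using assms unfolding quadratic_expansion_def by blast

text \<open>Besides the expansion itself, products and compositions need a linear bound on the
  increment; its constant is the bound of \<open>L\<close> plus the remainder constant times the
  radius.\<close>

lemma quadratic_expansionE:
  fixes f :: "'a::real_normed_vector \<Rightarrow> real"
  assumes "quadratic_expansion f x"
  obtains L C N \<delta> where "bounded_linear L" "0 \<le> C" "0 \<le> N" "0 < \<delta>"
    "\<And>h. norm h \<le> \<delta> \<Longrightarrow> \<bar>f (x + h) - f x - L h\<bar> \<le> C * (norm h)\<^sup>2"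
    "\<And>h. norm h \<le> \<delta> \<Longrightarrow> \<bar>f (x + h) - f x\<bar> \<le> N * norm h"
proof -
  obtain L C \<delta> where L: "bounded_linear L" "0 \<le> C" "0 < \<delta>"
    "\<And>h. norm h \<le> \<delta> \<Longrightarrow> \<bar>f (x + h) - f x - L h\<bar> \<le> C * (norm h)\<^sup>2"
    using assms unfolding quadratic_expansion_def by blast
  obtain K where K: "0 \<le> K" "\<And>h. norm (L h) \<le> norm h * K"
    using bounded_linear.nonneg_bounded[OF L(1)] by blast
  have "\<bar>f (x + h) - f x\<bar> \<le> (K + C * \<delta>) * norm h" if "norm h \<le> \<delta>" for h :: 'a
  proof -
    have "\<bar>f (x + h) - f x\<bar> \<le> \<bar>f (x + h) - f x - L h\<bar> + \<bar>L h\<bar>" by simp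
    also have "\<dots> \<le> C * (norm h)\<^sup>2 + norm h * K"
      using L(4)[OF that] K(2)[of h] by simp
    also have "C * (norm h)\<^sup>2 \<le> C * (\<delta> * norm h)"
      using that L(2) by (simp add: power2_eq_square mult_left_mono mult_right_mono)
    finally show ?thesis by (simp add: algebra_simps)
  qed
  with L K that[of L C "K + C * \<delta>" \<delta>] show thesis by simp
qed

lemma quadratic_expansion_add:
  fixes f g :: "'a::real_normed_vector \<Rightarrow> real"
  assumes "quadratic_expansion f x" "quadratic_expansion g x"
  shows "quadratic_expansion (\<lambda>y. f y + g y) x"
proof -
  obtain L C \<delta> where f: "bounded_linear L" "0 \<le> C" "0 < \<delta>"
    "\<And>h. norm h \<le> \<delta> \<Longrightarrow> \<bar>f (x + h) - f x - L h\<bar> \<le> C * (norm h)\<^sup>2"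
    using assms(1) unfolding quadratic_expansion_def by blast
  obtain L' C' \<delta>' where g: "bounded_linear L'" "0 \<le> C'" "0 < \<delta>'"
    "\<And>h. norm h \<le> \<delta>' \<Longrightarrow> \<bar>g (x + h) - g x - L' h\<bar> \<le> C' * (norm h)\<^sup>2"
    using assms(2) unfolding quadratic_expansion_def by blast
  show ?thesis
  proof (rule quadratic_expansionI[of "\<lambda>h. L h + L' h" "C + C'" "min \<delta> \<delta>'"])
    fix h :: 'a assume "norm h \<le> min \<delta> \<delta>'"
    then have "\<bar>f (x + h) - f x - L h\<bar> \<le> C * (norm h)\<^sup>2" "\<bar>g (x + h) - g x - L' h\<bar> \<le> C' * (norm h)\<^sup>2"
      using f(4) g(4) by auto
    then show "\<bar>(f (x + h) + g (x + h)) - (f x + g x) - (L h + L' h)\<bar> \<le> (C + C') * (norm h)\<^sup>2"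
      unfolding distrib_right by linarith
  qed (use f g in \<open>auto intro: bounded_linear_add\<close>)
qed

lemma quadratic_expansion_mult:
  fixes f g :: "'a::real_normed_vector \<Rightarrow> real"
  assumes "quadratic_expansion f x" "quadratic_expansion g x"
  shows "quadratic_expansion (\<lambda>y. f y * g y) x"
proof -
  obtain L C N \<delta> where f: "bounded_linear L" "0 \<le> C" "0 \<le> N" "0 < \<delta>"
    "\<And>h. norm h \<le> \<delta> \<Longrightarrow> \<bar>f (x + h) - f x - L h\<bar> \<le> C * (norm h)\<^sup>2"
    "\<And>h. norm h \<le> \<delta> \<Longrightarrow> \<bar>f (x + h) - f x\<bar> \<le> N * norm h"
    using assms(1) by (rule quadratic_expansionE) blast
  obtain L' C' N' \<delta>' where g: "bounded_linear L'" "0 \<le> C'" "0 \<le> N'" "0 < \<delta>'"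
    "\<And>h. norm h \<le> \<delta>' \<Longrightarrow> \<bar>g (x + h) - g x - L' h\<bar> \<le> C' * (norm h)\<^sup>2"
    "\<And>h. norm h \<le> \<delta>' \<Longrightarrow> \<bar>g (x + h) - g x\<bar> \<le> N' * norm h"
    using assms(2) by (rule quadratic_expansionE) blast
  show ?thesis
  proof (rule quadratic_expansionI[of "\<lambda>h. f x * L' h + L h * g x" "\<bar>f x\<bar> * C' + C * \<bar>g x\<bar> + N * N'" "min \<delta> \<delta>'"])
    fix h :: 'a assume "norm h \<le> min \<delta> \<delta>'"
    then have h: "norm h \<le> \<delta>" "norm h \<le> \<delta>'" by auto
    define A where "A = f (x + h) - f x"
    define B where "B = g (x + h) - g x"
    have "\<bar>f x * (B - L' h)\<bar> \<le> \<bar>f x\<bar> * (C' * (norm h)\<^sup>2)"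
      unfolding abs_mult B_def by (intro mult_left_mono g(5) h) auto
    moreover have "\<bar>(A - L h) * g x\<bar> \<le> (C * (norm h)\<^sup>2) * \<bar>g x\<bar>"
      unfolding abs_mult A_def by (intro mult_right_mono f(5) h) auto
    moreover have "\<bar>A * B\<bar> \<le> (N * norm h) * (N' * norm h)"
      unfolding abs_mult A_def B_def using f(3) by (intro mult_mono f(6) g(6) h) auto
    moreover have "f (x + h) * g (x + h) - f x * g x - (f x * L' h + L h * g x)
        = f x * (B - L' h) + (A - L h) * g x + A * B"
      by (simp add: A_def B_def algebra_simps)
    ultimately have "\<bar>f (x + h) * g (x + h) - f x * g x - (f x * L' h + L h * g x)\<bar>
        \<le> \<bar>f x\<bar> * (C' * (norm h)\<^sup>2) + (C * (norm h)\<^sup>2) * \<bar>g x\<bar> + (N * norm h) * (N' * norm h)"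
      by linarith
    then show "\<bar>f (x + h) * g (x + h) - f x * g x - (f x * L' h + L h * g x)\<bar> \<le> (\<bar>f x\<bar> * C' + C * \<bar>g x\<bar> + N * N') * (norm h)\<^sup>2"
      by (simp add: algebra_simps power2_eq_square)
  qed (use f g in \<open>auto intro!: bounded_linear_add bounded_linear_const_mult bounded_linear_mult_const\<close>)
qed

lemma quadratic_expansion_compose:
  fixes f :: "'a::real_normed_vector \<Rightarrow> real" and \<phi> :: "real \<Rightarrow> real"
  assumes "quadratic_expansion f x" "quadratic_expansion \<phi> (f x)"
  shows "quadratic_expansion (\<lambda>y. \<phi> (f y)) x"
proof -
  obtain L C N \<delta> where f: "bounded_linear L" "0 \<le> C" "0 \<le> N" "0 < \<delta>"
    "\<And>h. norm h \<le> \<delta> \<Longrightarrow> \<bar>f (x + h) - f x - L h\<bar> \<le> C * (norm h)\<^sup>2"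
    "\<And>h. norm h \<le> \<delta> \<Longrightarrow> \<bar>f (x + h) - f x\<bar> \<le> N * norm h"
    using assms(1) by (rule quadratic_expansionE) blast
  obtain L' C' \<delta>' where g: "bounded_linear L'" "0 \<le> C'" "0 < \<delta>'"
    "\<And>h. norm h \<le> \<delta>' \<Longrightarrow> \<bar>\<phi> (f x + h) - \<phi> (f x) - L' h\<bar> \<le> C' * (norm h)\<^sup>2"
    using assms(2) unfolding quadratic_expansion_def by blast
  obtain K where K: "0 \<le> K" "\<And>h. norm (L' h) \<le> norm h * K"
    using bounded_linear.nonneg_bounded[OF g(1)] by blast
  show ?thesis
  \<comment> \<open>The radius keeps the increment of \<open>f\<close> within the radius valid for
    the outer function; adding 1 to \<open>N\<close> avoids a division by zero.\<close>
  proof (rule quadratic_expansionI[of "\<lambda>h. L' (L h)" "C' * N\<^sup>2 + C * K" "min \<delta> (\<delta>' / (N + 1))"])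
    show "bounded_linear (\<lambda>h. L' (L h))" by (rule bounded_linear_compose[OF g(1) f(1)])
    fix h :: 'a assume "norm h \<le> min \<delta> (\<delta>' / (N + 1))"
    then have h: "norm h \<le> \<delta>" "norm h \<le> \<delta>' / (N + 1)" by auto
    define k where "k = f (x + h) - f x"
    have k: "\<bar>k\<bar> \<le> N * norm h" unfolding k_def by (rule f(6)[OF h(1)])
    also have "N * norm h \<le> (N + 1) * norm h" by (simp add: distrib_right)
    also have "\<dots> \<le> \<delta>'" using h(2) f(3) by (simp add: field_simps)
    finally have "\<bar>\<phi> (f x + k) - \<phi> (f x) - L' k\<bar> \<le> C' * (norm k)\<^sup>2" by (intro g(4)) simp
    also have "\<dots> \<le> C' * (N * norm h)\<^sup>2"
      using k g(2) by (intro mult_left_mono) (auto intro: abs_le_square_iff[THEN iffD1] order_trans[OF _ abs_ge_self])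
    finally have 1: "\<bar>\<phi> (f x + k) - \<phi> (f x) - L' k\<bar> \<le> C' * (N * norm h)\<^sup>2" .
    have "L' k - L' (L h) = L' (k - L h)" by (simp add: linear_diff[OF bounded_linear.linear[OF g(1)]])
    also have "\<bar>\<dots>\<bar> \<le> \<bar>k - L h\<bar> * K" using K(2)[of "k - L h"] by simp
    also have "\<dots> \<le> C * (norm h)\<^sup>2 * K" unfolding k_def by (intro mult_right_mono f(5) h K)
    finally have "\<bar>L' k - L' (L h)\<bar> \<le> C * (norm h)\<^sup>2 * K" .
    moreover have "\<phi> (f (x + h)) - \<phi> (f x) - L' (L h) = (\<phi> (f x + k) - \<phi> (f x) - L' k) + (L' k - L' (L h))"
      by (simp add: k_def)
    ultimately have "\<bar>\<phi> (f (x + h)) - \<phi> (f x) - L' (L h)\<bar> \<le> C' * (N * norm h)\<^sup>2 + C * (norm h)\<^sup>2 * K"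
      using 1 by linarith
    then show "\<bar>\<phi> (f (x + h)) - \<phi> (f x) - L' (L h)\<bar> \<le> (C' * N\<^sup>2 + C * K) * (norm h)\<^sup>2"
      by (simp add: algebra_simps power_mult_distrib)
  qed (use f g K in auto)
qed

lemma quadratic_expansion_polynomial:
  assumes "real_polynomial_function f"
  shows "quadratic_expansion f x"
  using assms
proof induction
  case (linear f)
  then show ?case
    by (intro quadratic_expansionI[of f 0 1]) (simp_all add: linear_add[OF bounded_linear.linear])
next
  case (const c)
  then show ?case by (intro quadratic_expansionI[of "\<lambda>_. 0" 0 1]) auto
qed (auto intro: quadratic_expansion_add quadratic_expansion_mult)

lemma quadratic_expansion_norm_square:
  fixes x :: "'a::real_inner"
  shows "quadratic_expansion (\<lambda>y. (norm y)\<^sup>2) x"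
proof (rule quadratic_expansionI[of "\<lambda>h. 2 * (x \<bullet> h)" 1 1])
  show "bounded_linear (\<lambda>h. 2 * (x \<bullet> h))"
    by (intro bounded_linear_const_mult bounded_linear_inner_right)
  show "\<bar>(norm (x + h))\<^sup>2 - (norm x)\<^sup>2 - 2 * (x \<bullet> h)\<bar> \<le> 1 * (norm h)\<^sup>2" for h
    by (simp add: power2_norm_eq_inner inner_add_left inner_add_right inner_commute)
qed auto

lemma quadratic_expansion_one_minus_powr:
  fixes p s :: real
  assumes "s < 1"
  shows "quadratic_expansion (\<lambda>t. (1 - t) powr p) s"
proof -
  \<comment> \<open>Half the distance to the singular point 1, so that the second derivative is
    bounded on the ball used for Taylor's theorem.\<close>
  define \<delta> where "\<delta> = (1 - s) / 2"
  have \<delta>: "\<delta> > 0" using assms by (simp add: \<delta>_def)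
  define F where "F i t = (if i = 0 then (1 - t) powr p else if i = 1 then - p * (1 - t) powr (p - 1)
    else p * (p - 1) * (1 - t) powr (p - 2))" for i :: nat and t :: real
  have lt: "t < 1" if "t \<in> cball s \<delta>" for t
  proof -
    have "t - s \<le> \<delta>" using that by (simp add: dist_real_def)
    then show ?thesis using assms by (simp add: \<delta>_def field_simps)
  qed
  have cont: "continuous_on (cball s \<delta>) (F 2)"
  proof -
    have "continuous_on (cball s \<delta>) (\<lambda>t. p * (p - 1) * (1 - t) powr (p - 2))"
      using lt by (intro continuous_intros) force
    then show ?thesis by (simp add: F_def[abs_def])
  qed
  obtain B where "B \<ge> 0" and B: "\<And>t. t \<in> cball s \<delta> \<Longrightarrow> \<bar>F 2 t\<bar> \<le> B"
    using continuous_on_compact_abs_bounded[OF cont compact_cball] by blast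
  have D: "(F i has_field_derivative F (Suc i) t) (at t within cball s \<delta>)" if "t \<in> cball s \<delta>" "i \<le> 1" for i t
  proof -
    have "i = 0 \<or> i = 1" using that(2) by auto
    then show ?thesis
      using lt[OF that(1)]
      by (auto simp: F_def[abs_def] intro!: derivative_eq_intros)
  qed
  show ?thesis
  proof (rule quadratic_expansionI[of "\<lambda>h. F 1 s * h" B \<delta>])
    show "bounded_linear (\<lambda>h. F 1 s * h)" by (rule bounded_linear_mult_right)
    show "0 \<le> B" by (rule \<open>B \<ge> 0\<close>)
    fix h :: real assume "norm h \<le> \<delta>"
    then have "s + h \<in> cball s \<delta>" by (simp add: dist_real_def)
    have "norm (F 0 (s + h) - (\<Sum>i\<le>1. F i s * ((s + h) - s) ^ i / fact i)) \<le> B * norm ((s + h) - s) ^ Suc 1 / fact 1"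
      by (rule field_Taylor[of "cball s \<delta>"]) (use D B \<delta> \<open>s + h \<in> cball s \<delta>\<close> in \<open>auto simp: numeral_2_eq_2\<close>)
    then show "\<bar>(1 - (s + h)) powr p - (1 - s) powr p - F 1 s * h\<bar> \<le> B * (norm h)\<^sup>2"
      by (simp add: F_def power2_eq_square algebra_simps)
  qed (rule \<delta>)
qed

text \<open>The support radius 2 suffices since \<open>x\<close> lies in the unit ball, so
  \<open>norm h > 2\<close> moves \<open>x + h\<close> out of it. Near \<open>x\<close> the cut-off
  is inactive and the profile is a product of functions with quadratic expansions.\<close>

lemma ball_profile_singular_integral:
  fixes V :: "'a::euclidean_space \<Rightarrow> real"
  assumes V: "real_polynomial_function V" and p: "p > -1" and x: "norm x < 1"
    and u: "u = (\<lambda>x. V x * (if norm x < 1 then (1 - (norm x)\<^sup>2) powr p else 0))"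
  shows "\<exists>C \<delta>. singular_integral u x C \<delta> 2"
proof -
  have [measurable]: "V \<in> borel_measurable borel"
    by (rule borel_measurable_real_polynomial[OF V])
  obtain B where "B \<ge> 0" and B: "\<And>y. y \<in> cball 0 1 \<Longrightarrow> \<bar>V y\<bar> \<le> B"
    using continuous_on_compact_abs_bounded[OF continuous_on_real_polynomial[OF V] compact_cball] by blast
  have int: "integrable lborel u"
  proof (rule Bochner_Integration.integrable_bound[OF integrable_mult_right[OF integrable_ball_powr[OF p], of B]])
    show "AE y in lborel. norm (u y) \<le> norm (B * (if norm y < 1 then (1 - (norm y)\<^sup>2) powr p else 0))"
      unfolding u using B \<open>B \<ge> 0\<close> by (intro AE_I2) (auto simp: abs_mult intro!: mult_right_mono)
    show "u \<in> borel_measurable lborel" unfolding u by measurable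
  qed
  have "(norm x)\<^sup>2 < 1" using x by (simp add: power_less_one_iff)
  then have "quadratic_expansion (\<lambda>y. V y * (1 - (norm y)\<^sup>2) powr p) x"
    by (intro quadratic_expansion_mult[OF quadratic_expansion_polynomial[OF V]]
        quadratic_expansion_compose[OF quadratic_expansion_norm_square quadratic_expansion_one_minus_powr])
  then obtain L C \<delta> where L: "bounded_linear L" "0 \<le> C" "0 < \<delta>"
    "\<And>h. norm h \<le> \<delta> \<Longrightarrow> \<bar>V (x + h) * (1 - (norm (x + h))\<^sup>2) powr p - V x * (1 - (norm x)\<^sup>2) powr p - L h\<bar> \<le> C * (norm h)\<^sup>2"
    unfolding quadratic_expansion_def by blast
  \<comment> \<open>Small enough that both \<open>x + h\<close> and \<open>x - h\<close> stay in the
    open unit ball, where the profile is given by its smooth formula.\<close>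
  define \<delta>' where "\<delta>' = min \<delta> ((1 - norm x) / 2)"
  have "singular_integral u x (2 * C) \<delta>' 2"
  proof
    show "integrable lborel u" by (rule int)
    show "0 < \<delta>'" using L(3) x by (simp add: \<delta>'_def)
    show "u (x + h) = 0" if "2 < norm h" for h
    proof -
      have "norm h \<le> norm (x + h) + norm x" using norm_triangle_ineq4[of "x + h" x] by simp
      then have "\<not> norm (x + h) < 1" using that x by linarith
      then show ?thesis by (simp add: u)
    qed
    fix h :: 'a assume h: "norm h \<le> \<delta>'"
    then have h': "norm h \<le> \<delta>" "norm (- h) \<le> \<delta>" by (auto simp: \<delta>'_def)
    have lt: "norm (x + k) < 1" if "norm k \<le> \<delta>'" for k
    proof -
      have "norm (x + k) \<le> norm x + (1 - norm x) / 2"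
        using norm_triangle_ineq[of x k] that by (simp add: \<delta>'_def field_simps)
      also have "\<dots> < 1" using x by (simp add: field_simps)
      finally show ?thesis .
    qed
    have uh: "u (x + k) = V (x + k) * (1 - (norm (x + k))\<^sup>2) powr p" if "norm k \<le> \<delta>'" for k
      using lt[OF that] by (simp add: u)
    have u0: "u x = V x * (1 - (norm x)\<^sup>2) powr p" using x by (simp add: u)
    have "\<bar>u (x + h) - u x - L h\<bar> \<le> C * (norm h)\<^sup>2"
      unfolding uh[OF h] u0 by (rule L(4)[OF h'(1)])
    moreover have "\<bar>u (x + - h) - u x - L (- h)\<bar> \<le> C * (norm h)\<^sup>2"
      using L(4)[OF h'(2)] h by (subst uh) (simp_all add: u0)
    moreover have "L (- h) = - L h" by (rule linear_neg[OF bounded_linear.linear[OF L(1)]])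
    ultimately show "\<bar>u (x + h) + u (x - h) - 2 * u x\<bar> \<le> 2 * C * (norm h)\<^sup>2"
      by (simp add: abs_le_iff)
  qed
  then show ?thesis by blast
qed

section \<open>The classical Laplacian\<close>

lemma monomial_scaleR: "monomial e (c *\<^sub>R x) = c ^ (\<Sum>b\<in>Basis. e b) * monomial e x"
  by (simp add: monomial_def power_mult_distrib prod.distrib power_sum)

lemma inner_monomial_lower:
  assumes "b \<in> Basis"
  shows "(x \<bullet> b) * (real (e b) * monomial (e(b := e b - 1)) x) = real (e b) * monomial e x"
proof (cases "e b")
  case (Suc n)
  have "monomial (e(b := n)) x = (x \<bullet> b) ^ n * (\<Prod>i\<in>Basis - {b}. (x \<bullet> i) ^ e i)"
    using monomial_line[OF assms, of "e(b := n)" x 0] by simp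
  moreover have "monomial e x = (x \<bullet> b) ^ Suc n * (\<Prod>i\<in>Basis - {b}. (x \<bullet> i) ^ e i)"
    using monomial_line[OF assms, of e x 0] Suc by simp
  ultimately show ?thesis by (simp add: Suc)
qed simp

text \<open>On a monomial, both the dilation derivative and the sum of coordinates times partial
  derivatives multiply by the total degree; the rest is linearity.\<close>

lemma monomial_sum_radial_derivative:
  assumes "monomial_sum f"
  shows "((\<lambda>c. f (c *\<^sub>R x)) has_real_derivative (\<Sum>b\<in>Basis. (x \<bullet> b) * partial_deriv b f x)) (at 1)"
  using assms
proof induction
  case zero
  then show ?case by (simp add: partial_deriv_def)
next
  case (step f c e)
  have "((\<lambda>t. c * (t ^ (\<Sum>b\<in>Basis. e b) * monomial e x) + f (t *\<^sub>R x)) has_real_derivative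
      c * ((real (\<Sum>b\<in>Basis. e b) * 1 ^ ((\<Sum>b\<in>Basis. e b) - 1)) * monomial e x) + (\<Sum>b\<in>Basis. (x \<bullet> b) * partial_deriv b f x)) (at 1)"
    by (intro DERIV_add DERIV_cmult step.IH) (auto intro!: derivative_eq_intros)
  also have "c * ((real (\<Sum>b\<in>Basis. e b) * 1 ^ ((\<Sum>b\<in>Basis. e b) - 1)) * monomial e x) + (\<Sum>b\<in>Basis. (x \<bullet> b) * partial_deriv b f x)
      = (\<Sum>b\<in>Basis. c * (real (e b) * monomial e x) + (x \<bullet> b) * partial_deriv b f x)"
    by (simp add: sum.distrib sum_distrib_left sum_distrib_right)
  also have "\<dots> = (\<Sum>b\<in>Basis. (x \<bullet> b) * partial_deriv b (\<lambda>y. c * monomial e y + f y) x)"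
  proof (rule sum.cong[OF refl])
    fix b :: 'a assume b: "b \<in> Basis"
    have "partial_deriv b (\<lambda>y. c * monomial e y + f y) x = c * real (e b) * monomial (e(b := e b - 1)) x + partial_deriv b f x"
      using partial_deriv_add[OF monomial_sum_monomial step.hyps b, of c e x] partial_deriv_monomial[OF b, of c e] by simp
    then have "(x \<bullet> b) * partial_deriv b (\<lambda>y. c * monomial e y + f y) x
        = c * ((x \<bullet> b) * (real (e b) * monomial (e(b := e b - 1)) x)) + (x \<bullet> b) * partial_deriv b f x"
      by (simp add: algebra_simps)
    then show "c * (real (e b) * monomial e x) + (x \<bullet> b) * partial_deriv b f x
        = (x \<bullet> b) * partial_deriv b (\<lambda>y. c * monomial e y + f y) x"
      unfolding inner_monomial_lower[OF b] by simp
  qed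
  finally show ?case by (simp add: monomial_scaleR)
qed

text \<open>Both sides are the derivative at 1 of the dilated function, computed once from
  homogeneity and once by the chain rule.\<close>

lemma Euler_homogeneous:
  assumes "monomial_sum V" "\<And>c x. V (c *\<^sub>R x) = c ^ l * V x"
  shows "(\<Sum>b\<in>Basis. (x \<bullet> b) * partial_deriv b V x) = real l * V x"
proof -
  have "((\<lambda>c. c ^ l * V x) has_real_derivative real l * 1 ^ (l - 1) * V x) (at 1)"
    by (auto intro!: derivative_eq_intros)
  moreover have "((\<lambda>c. c ^ l * V x) has_real_derivative (\<Sum>b\<in>Basis. (x \<bullet> b) * partial_deriv b V x)) (at 1)"
    using monomial_sum_radial_derivative[OF assms(1), of x] by (simp add: assms(2))
  ultimately show ?thesis using DERIV_unique by fastforce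
qed

lemma has_derivative_norm_square_line:
  fixes x b :: "'a::real_inner"
  shows "((\<lambda>t. (norm (x + t *\<^sub>R b))\<^sup>2) has_real_derivative 2 * (x \<bullet> b)) (at 0)"
proof -
  have "(norm (x + t *\<^sub>R b))\<^sup>2 = (norm x)\<^sup>2 + 2 * (x \<bullet> b) * t + (b \<bullet> b) * t\<^sup>2" for t
    unfolding power2_norm_eq_inner
    by (simp add: inner_add_left inner_add_right inner_commute power2_eq_square algebra_simps)
  then show ?thesis by (auto intro!: derivative_eq_intros)
qed

lemma has_derivative_one_minus_norm_powr_line:
  fixes x b :: "'a::real_inner"
  assumes "norm x < 1"
  shows "((\<lambda>t. (1 - (norm (x + t *\<^sub>R b))\<^sup>2) powr q) has_real_derivative
    - q * (1 - (norm x)\<^sup>2) powr (q - 1) * (2 * (x \<bullet> b))) (at 0)"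
proof -
  have "(norm x)\<^sup>2 < 1" using assms by (simp add: power_less_one_iff)
  have "((\<lambda>s. (1 - s) powr q) has_real_derivative - q * (1 - (norm x)\<^sup>2) powr (q - 1)) (at ((norm (x + 0 *\<^sub>R b))\<^sup>2))"
    using \<open>(norm x)\<^sup>2 < 1\<close> by (auto intro!: derivative_eq_intros)
  from DERIV_chain2[OF this has_derivative_norm_square_line] show ?thesis .
qed

section \<open>Partial derivatives of the ball profile\<close>

context
  fixes V u :: "'a::euclidean_space \<Rightarrow> real" and p :: real
  assumes V: "monomial_sum V"
    and u: "u = (\<lambda>x. V x * (if norm x < 1 then (1 - (norm x)\<^sup>2) powr p else 0))"
begin

lemma has_partial_deriv_ball_profile:
  assumes x: "norm x < 1" and b: "b \<in> Basis"
  shows "((\<lambda>t. u (x + t *\<^sub>R b)) has_real_derivative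
    partial_deriv b V x * (1 - (norm x)\<^sup>2) powr p + V x * (- p * (1 - (norm x)\<^sup>2) powr (p - 1) * (2 * (x \<bullet> b)))) (at 0)"
proof (rule has_field_derivative_transform_within_open[where S = "{t. norm (x + t *\<^sub>R b) < 1}"])
  show "((\<lambda>t. V (x + t *\<^sub>R b) * (1 - (norm (x + t *\<^sub>R b))\<^sup>2) powr p) has_real_derivative
    partial_deriv b V x * (1 - (norm x)\<^sup>2) powr p + V x * (- p * (1 - (norm x)\<^sup>2) powr (p - 1) * (2 * (x \<bullet> b)))) (at 0)"
    using DERIV_mult[OF monomial_sum_has_partial_deriv[OF V b, of x] has_derivative_one_minus_norm_powr_line[OF x, of b p]]
    by (simp add: algebra_simps)
  show "open {t. norm (x + t *\<^sub>R b) < 1}"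
    by (intro open_Collect_less continuous_intros)
qed (use x in \<open>auto simp: u\<close>)

text \<open>The formula for the first partial derivative holds throughout the open unit ball, hence
  for all small \<open>t\<close>, and may therefore be differentiated once more along the same
  line.\<close>

lemma has_second_partial_deriv_ball_profile:
  assumes x: "norm x < 1" and b: "b \<in> Basis"
  shows "((\<lambda>t. partial_deriv b u (x + t *\<^sub>R b)) has_real_derivative
    partial_deriv b (partial_deriv b V) x * (1 - (norm x)\<^sup>2) powr p
    - 4 * p * (1 - (norm x)\<^sup>2) powr (p - 1) * ((x \<bullet> b) * partial_deriv b V x)
    + V x * (4 * p * (p - 1) * (1 - (norm x)\<^sup>2) powr (p - 2) * (x \<bullet> b)\<^sup>2 - 2 * p * (1 - (norm x)\<^sup>2) powr (p - 1))) (at 0)"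
proof (rule has_field_derivative_transform_within_open[where S = "{t. norm (x + t *\<^sub>R b) < 1}"])
  let ?W = "\<lambda>q t. (1 - (norm (x + t *\<^sub>R b))\<^sup>2) powr q"
  have inn: "((\<lambda>t. (x + t *\<^sub>R b) \<bullet> b) has_real_derivative 1) (at 0)"
    using b by (simp add: inner_add_left) (auto intro!: derivative_eq_intros)
  have "((\<lambda>t. partial_deriv b V (x + t *\<^sub>R b) * ?W p t
      + V (x + t *\<^sub>R b) * ((- 2 * p) * (?W (p - 1) t * ((x + t *\<^sub>R b) \<bullet> b)))) has_real_derivative
      (partial_deriv b (partial_deriv b V) x * ?W p 0 + (- p * (1 - (norm x)\<^sup>2) powr (p - 1) * (2 * (x \<bullet> b))) * partial_deriv b V (x + 0 *\<^sub>R b))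
      + (partial_deriv b V x * ((- 2 * p) * (?W (p - 1) 0 * ((x + 0 *\<^sub>R b) \<bullet> b)))
        + ((- 2 * p) * ((- (p - 1) * (1 - (norm x)\<^sup>2) powr (p - 1 - 1) * (2 * (x \<bullet> b))) * ((x + 0 *\<^sub>R b) \<bullet> b) + 1 * ?W (p - 1) 0)) * V (x + 0 *\<^sub>R b))) (at 0)"
    by (intro DERIV_add DERIV_mult DERIV_cmult inn monomial_sum_has_partial_deriv monomial_sum_partial_deriv
        has_derivative_one_minus_norm_powr_line V b x)
  then show "((\<lambda>t. partial_deriv b V (x + t *\<^sub>R b) * ?W p t
      + V (x + t *\<^sub>R b) * ((- 2 * p) * (?W (p - 1) t * ((x + t *\<^sub>R b) \<bullet> b)))) has_real_derivative
    partial_deriv b (partial_deriv b V) x * (1 - (norm x)\<^sup>2) powr p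
    - 4 * p * (1 - (norm x)\<^sup>2) powr (p - 1) * ((x \<bullet> b) * partial_deriv b V x)
    + V x * (4 * p * (p - 1) * (1 - (norm x)\<^sup>2) powr (p - 2) * (x \<bullet> b)\<^sup>2 - 2 * p * (1 - (norm x)\<^sup>2) powr (p - 1))) (at 0)"
    by (rule DERIV_cong) (simp add: algebra_simps power2_eq_square)
  show "open {t. norm (x + t *\<^sub>R b) < 1}"
    by (intro open_Collect_less continuous_intros)
  show "partial_deriv b V (x + t *\<^sub>R b) * ?W p t + V (x + t *\<^sub>R b) * ((- 2 * p) * (?W (p - 1) t * ((x + t *\<^sub>R b) \<bullet> b)))
      = partial_deriv b u (x + t *\<^sub>R b)" if "t \<in> {t. norm (x + t *\<^sub>R b) < 1}" for t
    using partial_deriv_eqI[OF has_partial_deriv_ball_profile[of "x + t *\<^sub>R b" b]] that b by (simp add: mult_ac)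
qed (use x in simp)

text \<open>Summing over coordinates, the second derivatives of \<open>V\<close> cancel by
  harmonicity, the mixed terms reduce to \<open>l\<close> times \<open>V x\<close> by Euler's
  identity, and the squared coordinates add up to the squared norm.\<close>

lemma laplacian_ball_profile:
  assumes x: "norm x < 1" and hom: "\<And>c x. V (c *\<^sub>R x) = c ^ l * V x" and harm: "laplacian V x = 0"
  shows "laplacian_exists u x"
    and "- laplacian u x = 4 * p * V x * ((DIM('a) / 2 + real l) * (1 - (norm x)\<^sup>2) powr (p - 1)
      - (p - 1) * (norm x)\<^sup>2 * (1 - (norm x)\<^sup>2) powr (p - 2))"
proof -
  have "open (ball (0::'a) 1)" by simp
  then have ev: "\<forall>\<^sub>F y in nhds x. norm y < 1"
    using x by (auto simp: eventually_nhds intro!: exI[of _ "ball (0::'a) 1"])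
  show "laplacian_exists u x"
    unfolding laplacian_exists_def
  proof (intro ballI conjI)
    fix b :: 'a assume b: "b \<in> Basis"
    show "\<forall>\<^sub>F y in nhds x. (\<lambda>t. u (y + t *\<^sub>R b)) field_differentiable at 0"
      using ev by eventually_elim (use has_partial_deriv_ball_profile b in \<open>auto simp: field_differentiable_def\<close>)
    show "(\<lambda>t. partial_deriv b u (x + t *\<^sub>R b)) field_differentiable at 0"
      using has_second_partial_deriv_ball_profile[OF x b] by (auto simp: field_differentiable_def)
  qed
  define A where "A = (1 - (norm x)\<^sup>2) powr (p - 1)"
  define B where "B = (1 - (norm x)\<^sup>2) powr (p - 2)"
  define E where "E = (1 - (norm x)\<^sup>2) powr p"
  have "laplacian u x = (\<Sum>b\<in>Basis. partial_deriv b (partial_deriv b V) x * E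
    - 4 * p * A * ((x \<bullet> b) * partial_deriv b V x) + V x * (4 * p * (p - 1) * B * (x \<bullet> b)\<^sup>2 - 2 * p * A))"
    unfolding laplacian_def A_def B_def E_def
    by (intro sum.cong refl partial_deriv_eqI has_second_partial_deriv_ball_profile x)
  also have "\<dots> = (\<Sum>b\<in>Basis. partial_deriv b (partial_deriv b V) x) * E
    - 4 * p * A * (\<Sum>b\<in>Basis. (x \<bullet> b) * partial_deriv b V x)
    + V x * (4 * p * (p - 1) * B * (\<Sum>b\<in>(Basis::'a set). (x \<bullet> b)\<^sup>2) - 2 * p * A * DIM('a))"
    by (simp add: sum.distrib sum_subtractf sum_distrib_left sum_distrib_right algebra_simps)
  also have "(\<Sum>b\<in>Basis. partial_deriv b (partial_deriv b V) x) = 0"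
    using harm by (simp add: laplacian_def)
  also have "(\<Sum>b\<in>Basis. (x \<bullet> b) * partial_deriv b V x) = real l * V x"
    by (rule Euler_homogeneous[OF V hom])
  also have "(\<Sum>b\<in>(Basis::'a set). (x \<bullet> b)\<^sup>2) = (norm x)\<^sup>2"
    unfolding power2_norm_eq_inner using euclidean_inner[of x x] by (simp add: power2_eq_square)
  finally show "- laplacian u x = 4 * p * V x * ((DIM('a) / 2 + real l) * (1 - (norm x)\<^sup>2) powr (p - 1)
      - (p - 1) * (norm x)\<^sup>2 * (1 - (norm x)\<^sup>2) powr (p - 2))"
    unfolding A_def[symmetric] B_def[symmetric] by (simp add: algebra_simps)
qed

end

section \<open>The identity for all orders\<close>

text \<open>Summability is what allows the embedding of the reals to pass through the infinite
  sum.\<close>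

lemma hyp2F1_complex:
  fixes a b \<theta> X :: real
  assumes "\<theta> > 0" "0 \<le> X" "X < 1"
  shows "(\<Sum>n. pochhammer (of_real a) n * pochhammer (of_real b) n / of_real (pochhammer \<theta> n) * of_real (X ^ n / fact n))
    = complex_of_real (hyp2F1 a b \<theta> X)"
proof -
  define K where "K = \<bar>a\<bar> + \<bar>b\<bar> + 1"
  have K: "K > 0" "\<bar>a\<bar> \<le> K" "\<bar>b\<bar> \<le> K" by (auto simp: K_def)
  have le: "\<bar>pochhammer c n\<bar> \<le> pochhammer K n" if "\<bar>c\<bar> \<le> K" for c n
    using norm_pochhammer_le[of "of_real c" K n] that by (simp add: pochhammer_of_real)
  have "summable (\<lambda>n. pochhammer a n * pochhammer b n / pochhammer \<theta> n * (X ^ n / fact n))"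
  proof (rule summable_comparison_test'[OF summable_hypergeometric[OF K(1) assms], of 0])
    fix n
    have "pochhammer \<theta> n > 0" using assms by (intro pochhammer_pos)
    then show "norm (pochhammer a n * pochhammer b n / pochhammer \<theta> n * (X ^ n / fact n))
        \<le> pochhammer K n * pochhammer K n / pochhammer \<theta> n * (X ^ n / fact n)"
      using assms le K unfolding norm_mult norm_divide
      by (intro mult_mono divide_mono) (auto intro!: pochhammer_nonneg simp: norm_power)
  qed
  then have "complex_of_real (\<Sum>n. pochhammer a n * pochhammer b n / pochhammer \<theta> n * (X ^ n / fact n))
      = (\<Sum>n. of_real (pochhammer a n * pochhammer b n / pochhammer \<theta> n * (X ^ n / fact n)))"
    by (rule bounded_linear.suminf[OF bounded_linear_of_real])
  then show ?thesis
    unfolding hyp2F1_def by (simp only: pochhammer_of_real of_real_mult[symmetric] of_real_divide[symmetric])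
qed

text \<open>When the first parameter exceeds the third by one, the quotient of their Pochhammer
  symbols is \<open>1 + n / \<theta>\<close>. The series is therefore a binomial series plus a
  multiple of its Euler derivative.\<close>

lemma hyp2F1_plus_one:
  fixes c \<theta> X :: real
  assumes "\<theta> > 0" "0 \<le> X" "X < 1"
  shows "hyp2F1 (\<theta> + 1) c \<theta> X = (1 - X) powr (- c) + c / \<theta> * X * (1 - X) powr (- c - 1)"
proof -
  have X: "\<bar>X\<bar> < 1" using assms by simp
  have "(\<lambda>n. c * X * (pochhammer (c + 1) n / fact n * X ^ n)) sums (c * X * (1 - X) powr (- (c + 1)))"
    by (intro sums_mult pochhammer_binomial_series X)
  moreover have "real (Suc n) * (pochhammer c (Suc n) / fact (Suc n) * X ^ Suc n) = c * X * (pochhammer (c + 1) n / fact n * X ^ n)" for n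
    by (simp add: pochhammer_rec[of c] field_simps del: of_nat_Suc)
  ultimately have "(\<lambda>n. real (Suc n) * (pochhammer c (Suc n) / fact (Suc n) * X ^ Suc n)) sums (c * X * (1 - X) powr (- (c + 1)))"
    by (simp only:)
  then have "(\<lambda>n. real n * (pochhammer c n / fact n * X ^ n)) sums (c * X * (1 - X) powr (- (c + 1)))"
    by (subst (asm) sums_Suc_iff) simp
  from sums_add[OF pochhammer_binomial_series[OF X, of c] sums_mult[OF this, of "1 / \<theta>"]]
  have "(\<lambda>n. pochhammer c n / fact n * X ^ n + 1 / \<theta> * (real n * (pochhammer c n / fact n * X ^ n)))
      sums ((1 - X) powr (- c) + 1 / \<theta> * (c * X * (1 - X) powr (- (c + 1))))" .
  moreover have "pochhammer (\<theta> + 1) n * pochhammer c n / pochhammer \<theta> n * (X ^ n / fact n)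
      = pochhammer c n / fact n * X ^ n + 1 / \<theta> * (real n * (pochhammer c n / fact n * X ^ n))" for n
  proof -
    have pos: "pochhammer \<theta> n > 0" using assms by (intro pochhammer_pos)
    have "\<theta> * pochhammer (\<theta> + 1) n = (\<theta> + real n) * pochhammer \<theta> n"
      using pochhammer_rec[of \<theta> n] pochhammer_rec'[of \<theta> n] by simp
    then have "pochhammer (\<theta> + 1) n / pochhammer \<theta> n = 1 + real n / \<theta>"
      using pos assms by (simp add: field_simps)
    then have "pochhammer (\<theta> + 1) n * pochhammer c n / pochhammer \<theta> n * (X ^ n / fact n)
        = (1 + real n / \<theta>) * (pochhammer c n * (X ^ n / fact n))"
      by (metis (no_types, lifting) mult.assoc mult.commute times_divide_eq_right)
    then show ?thesis by (simp add: algebra_simps add_divide_distrib)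
  qed
  ultimately have "(\<lambda>n. pochhammer (\<theta> + 1) n * pochhammer c n / pochhammer \<theta> n * (X ^ n / fact n))
      sums ((1 - X) powr (- c) + 1 / \<theta> * (c * X * (1 - X) powr (- (c + 1))))"
    by simp
  moreover have "- (c + 1) = - c - 1" by simp
  ultimately show ?thesis unfolding hyp2F1_def by (simp add: sums_iff)
qed

lemma sqrt_pi_power: "sqrt (pi ^ d) = pi powr (real d / 2)"
proof -
  have "sqrt (pi ^ d) = (pi powr real d) powr (1 / 2)"
    by (subst powr_realpow) (simp_all add: powr_half_sqrt)
  then show ?thesis by (simp add: powr_powr)
qed

text \<open>The factor of \<open>V x\<close> in the formula, viewed as a function of the order.
  Using \<open>rGamma\<close> keeps it holomorphic across the poles of
  \<open>Gamma (p + 1 - a / 2)\<close> and gives the value 0 there.\<close>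

definition closed_form :: "real \<Rightarrow> real \<Rightarrow> real \<Rightarrow> real \<Rightarrow> real" where
  "closed_form \<theta> p X a = 2 powr a * Gamma (p + 1) * Gamma (\<theta> + a / 2) / Gamma \<theta> * rGamma (p + 1 - a / 2)
     * hyp2F1 (\<theta> + a / 2) (- p + a / 2) \<theta> X"

text \<open>At order 2 the Gamma quotients collapse to \<theta> and \<open>p\<close>, the latter
  also for \<open>p = 0\<close>, where \<open>rGamma p\<close> vanishes. The hypergeometric factor
  is the elementary case in which the first and third parameters differ by one.\<close>

lemma closed_form_two:
  fixes \<theta> p X :: real
  assumes "\<theta> > 0" "p > -1" "0 \<le> X" "X < 1"
  shows "closed_form \<theta> p X 2 = 4 * p * (\<theta> * (1 - X) powr (p - 1) - (p - 1) * X * (1 - X) powr (p - 2))"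
proof -
  have "Gamma (\<theta> + 1) = \<theta> * Gamma \<theta>"
    using assms by (intro Gamma_plus1) (auto elim!: nonpos_Ints_cases)
  moreover have "Gamma (p + 1) * rGamma p = p"
  proof -
    have "Gamma (p + 1) > 0" using assms by (intro Gamma_real_pos) simp
    then show ?thesis unfolding rGamma_plus1[of p, symmetric] rGamma_inverse_Gamma[of "p + 1"] by simp
  qed
  ultimately have "closed_form \<theta> p X 2 = 4 * p * \<theta> * hyp2F1 (\<theta> + 1) (1 - p) \<theta> X"
    using Gamma_real_pos[OF assms(1)] by (simp add: closed_form_def field_simps)
  also have "\<dots> = 4 * p * \<theta> * ((1 - X) powr (p - 1) + (1 - p) / \<theta> * X * (1 - X) powr (p - 2))"
    using hyp2F1_plus_one[OF assms(1,3,4), of "1 - p"] by (simp add: algebra_simps)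
  also have "\<dots> = 4 * p * (\<theta> * (1 - X) powr (p - 1) - (p - 1) * X * (1 - X) powr (p - 2))"
    using assms(1) by (simp add: field_simps)
  finally show ?thesis .
qed

section \<open>Passage from negative to positive order\<close>

context singular_integral
begin

text \<open>The identity theorem for holomorphic functions. In this form the factor \<open>a\<close>
  of the operator's constant has already cancelled against the division of
  \<open>continued a\<close> by \<open>a\<close>, so nothing is singular at order 0 and a single
  connected strip can be used.\<close>

lemma continued_eq_closed_form:
  fixes k \<theta> p X a :: real
  assumes \<theta>: "\<theta> \<ge> 1 / 2" and X: "0 \<le> X" "X < 1"
    and neg: "\<And>a::real. -1 < a \<Longrightarrow> a < 0 \<Longrightarrow>
      - (2 powr (a - 1) * Gamma ((a + DIM('a)) / 2) * rGamma (1 - a / 2) / sqrt (pi ^ DIM('a))) * continued a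
      = k * closed_form \<theta> p X a"
    and a: "0 < a" "a < 2"
  shows "- (2 powr (a - 1) * Gamma ((a + DIM('a)) / 2) * rGamma (1 - a / 2) / sqrt (pi ^ DIM('a))) * continued a
      = k * closed_form \<theta> p X a"
proof -
  define S where "S = {z. - 1 < Re z \<and> Re z < 2}"
  define H where "H z = (\<Sum>n. pochhammer (of_real \<theta> + z) n * pochhammer (of_real (- p) + z) n
      / of_real (pochhammer \<theta> n) * of_real (X ^ n / fact n) :: complex)" for z
  define lhs where "lhs z = - (exp ((z - 1) * of_real (ln 2)) * Gamma ((z + of_nat DIM('a)) / 2) * rGamma (1 - z / 2)
      / of_real (sqrt (pi ^ DIM('a)))) * continued_complex z" for z
  define rhs where "rhs z = of_real k * (exp (z * of_real (ln 2)) * of_real (Gamma (p + 1)) * Gamma (of_real \<theta> + z / 2)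
      / of_real (Gamma \<theta>) * rGamma (of_real (p + 1) - z / 2) * H (z / 2))" for z
  have exp2: "exp (of_real c * of_real (ln 2)) = complex_of_real (2 powr c)" for c
    by (simp add: powr_def exp_of_real[symmetric])
  have lhs_real: "lhs (of_real c) = of_real (- (2 powr (c - 1) * Gamma ((c + DIM('a)) / 2) * rGamma (1 - c / 2)
      / sqrt (pi ^ DIM('a))) * continued c)" for c
  proof -
    have e: "(complex_of_real c - 1) * of_real (ln 2) = of_real (c - 1) * of_real (ln 2)"
      "(complex_of_real c + of_nat DIM('a)) / 2 = of_real ((c + DIM('a)) / 2)"
      "1 - complex_of_real c / 2 = of_real (1 - c / 2)" by simp_all
    then show ?thesis
      unfolding lhs_def e exp2 Gamma_complex_of_real rGamma_complex_of_real continued_complex_of_real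
      by (simp only: of_real_mult of_real_divide of_real_minus)
  qed
  have rhs_real: "rhs (of_real c) = of_real (k * closed_form \<theta> p X c)" for c
  proof -
    have e: "complex_of_real \<theta> + of_real c / 2 = of_real (\<theta> + c / 2)"
      "complex_of_real (- p) + of_real c / 2 = of_real (- p + c / 2)"
      "complex_of_real (p + 1) - of_real c / 2 = of_real (p + 1 - c / 2)" by simp_all
    have "H (of_real c / 2) = of_real (hyp2F1 (\<theta> + c / 2) (- p + c / 2) \<theta> X)"
      unfolding H_def e by (rule hyp2F1_complex) (use \<theta> X in auto)
    then show ?thesis
      unfolding rhs_def closed_form_def e exp2 Gamma_complex_of_real rGamma_complex_of_real
      by (simp only: of_real_mult of_real_divide)
  qed
  have nonpole: "z \<notin> \<int>\<^sub>\<le>\<^sub>0" if "Re z > 0" for z :: complex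
    using that by (auto elim!: nonpos_Ints_cases)
  have "(\<lambda>z. H (z / 2)) holomorphic_on S"
  proof -
    have "H holomorphic_on UNIV"
      unfolding H_def[abs_def] by (rule holomorphic_hypergeometric) (use \<theta> X in auto)
    then have "H \<circ> (\<lambda>z. z / 2) holomorphic_on S"
      by (intro holomorphic_on_compose_gen[where t = UNIV] holomorphic_intros) auto
    then show ?thesis by (simp add: o_def)
  qed
  \<comment> \<open>The left edge of the strip is matched to these arguments: with dimension at
    least 1 and \<theta> at least 1/2, both have positive real part for \<open>Re z > -1\<close>, so
    the Gamma factors have no poles.\<close>
  moreover have "(z + of_nat DIM('a)) / 2 \<notin> \<int>\<^sub>\<le>\<^sub>0" "of_real \<theta> + z / 2 \<notin> \<int>\<^sub>\<le>\<^sub>0" if "z \<in> S" for z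
  proof -
    have D: "real DIM('a) \<ge> 1" using DIM_positive[where 'a = 'a] by linarith
    have z: "Re z > -1" using that by (simp add: S_def)
    have "Re ((z + of_nat DIM('a)) / 2) = (Re z + real DIM('a)) / 2" "Re (of_real \<theta> + z / 2) = \<theta> + Re z / 2" by simp_all
    moreover have "(Re z + real DIM('a)) / 2 > 0" "\<theta> + Re z / 2 > 0"
      using D z \<theta> by (intro divide_pos_pos | linarith)+
    ultimately have "Re ((z + of_nat DIM('a)) / 2) > 0" "Re (of_real \<theta> + z / 2) > 0"
      by (simp_all only:)
    then show "(z + of_nat DIM('a)) / 2 \<notin> \<int>\<^sub>\<le>\<^sub>0" "of_real \<theta> + z / 2 \<notin> \<int>\<^sub>\<le>\<^sub>0"
      by (simp_all only: nonpole not_False_eq_True)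
  qed
  moreover have "complex_of_real (Gamma \<theta>) \<noteq> 0" "complex_of_real (sqrt (pi ^ DIM('a))) \<noteq> 0"
  proof -
    have "Gamma \<theta> > 0" using \<theta> by (intro Gamma_real_pos) linarith
    then show "complex_of_real (Gamma \<theta>) \<noteq> 0" "complex_of_real (sqrt (pi ^ DIM('a))) \<noteq> 0" by simp_all
  qed
  ultimately have hol: "(\<lambda>z. lhs z - rhs z) holomorphic_on S"
    unfolding lhs_def rhs_def
    by (intro holomorphic_intros holomorphic_continued_complex[of 1, folded S_def]) auto
  \<comment> \<open>The midpoint of the interval of known agreement. It is an interior point of the
    strip and an accumulation point of that real interval.\<close>
  define z\<^sub>0 where "z\<^sub>0 = complex_of_real (- 1 / 2)"
  have "lhs (of_real a) - rhs (of_real a) = 0"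
  proof (rule analytic_continuation[OF hol, where U = "of_real ` {-1<..<0}" and \<xi> = z\<^sub>0])
    show "open S"
      unfolding S_def by (intro open_Collect_conj open_halfspace_Re_gt open_halfspace_Re_lt)
    have "S = {z. -1 < Re z} \<inter> {z. Re z < 2}" by (auto simp: S_def)
    then have "convex S"
      by (simp only: convex_Int convex_halfspace_Re_gt convex_halfspace_Re_lt)
    then show "connected S" by (rule convex_connected)
    show "of_real ` {-1<..<0} \<subseteq> S" "z\<^sub>0 \<in> S" "of_real a \<in> S" using a by (auto simp: S_def z\<^sub>0_def)
    show "z\<^sub>0 islimpt of_real ` {-1<..<0}"
      unfolding islimpt_approachable
    proof (intro allI impI)
      fix e :: real assume "e > 0"
      \<comment> \<open>A nearby real point different from the midpoint; the cap 1/4 keeps it in the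
        interval of agreement.\<close>
      define t where "t = - 1 / 2 + min (e / 2) (1 / 4)"
      have t: "t \<in> {-1<..<0}" "t \<noteq> - 1 / 2" "\<bar>t + 1 / 2\<bar> < e"
        using \<open>e > 0\<close> by (auto simp: t_def min_def)
      have "dist (complex_of_real t) z\<^sub>0 = \<bar>t + 1 / 2\<bar>"
        unfolding z\<^sub>0_def dist_of_real by (simp add: dist_real_def)
      with t show "\<exists>x'\<in>complex_of_real ` {-1<..<0}. x' \<noteq> z\<^sub>0 \<and> dist x' z\<^sub>0 < e"
        unfolding z\<^sub>0_def by (intro bexI[of _ "of_real t"]) (auto simp del: of_real_minus of_real_divide)
    qed
    show "lhs z - rhs z = 0" if "z \<in> of_real ` {-1<..<0}" for z
    proof -
      obtain c where c: "z = of_real c" "-1 < c" "c < 0" using \<open>z \<in> of_real ` {-1<..<0}\<close> by auto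
      have "lhs z = rhs z"
        unfolding c(1) lhs_real rhs_real neg[OF c(2,3)] ..
      then show ?thesis by simp
    qed
  qed
  then have "complex_of_real (- (2 powr (a - 1) * Gamma ((a + DIM('a)) / 2) * rGamma (1 - a / 2) / sqrt (pi ^ DIM('a))) * continued a)
      = of_real (k * closed_form \<theta> p X a)"
    unfolding lhs_real rhs_real by (simp only: right_minus_eq)
  then show ?thesis by (simp only: of_real_eq_iff)
qed

end

text \<open>The Riesz potential of the ball profile supplies the identity for orders between -1 and
  0; continuation carries it to positive order, where the continued quantity is a multiple of the
  principal value.\<close>

lemma fractional_laplacian_ball_profile:
  fixes V u :: "'a::euclidean_space \<Rightarrow> real" and p a :: real
  assumes V: "solid_harmonic l V" and p: "p > -1" and x: "norm x < 1" and a: "0 < a" "a < 2"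
    and u: "u = (\<lambda>x. V x * (if norm x < 1 then (1 - (norm x)\<^sup>2) powr p else 0))"
  shows "\<exists>I. has_principal_value (frac_lap_integrand a u x) x I \<and>
    frac_lap_const DIM('a) a * I = V x * closed_form (DIM('a) / 2 + real l) p ((norm x)\<^sup>2) a"
proof -
  define \<theta> where "\<theta> = DIM('a) / 2 + real l"
  define X where "X = (norm x)\<^sup>2"
  have "real DIM('a) \<ge> 1" using DIM_positive[where 'a = 'a] by linarith
  then have "real DIM('a) / 2 + real l \<ge> 1 / 2 + 0" by (intro add_mono) auto
  then have \<theta>: "\<theta> \<ge> 1 / 2" by (simp add: \<theta>_def)
  have X: "0 \<le> X" "X < 1" using x by (auto simp: X_def power_less_one_iff)
  have "real_polynomial_function V" using V by (simp add: solid_harmonic_def)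
  then obtain C \<delta> where "singular_integral u x C \<delta> 2"
    using ball_profile_singular_integral[OF _ p x u] by blast
  then interpret singular_integral u x C \<delta> 2 .
  have u': "u y = V y * max 0 (1 - (norm y)\<^sup>2) powr p" for y
    by (auto simp: u max_def power_le_one_iff abs_square_less_1 not_less power_less_one_iff)
  have neg: "- (2 powr (c - 1) * Gamma ((c + DIM('a)) / 2) * rGamma (1 - c / 2) / sqrt (pi ^ DIM('a))) * continued c
      = V x * closed_form \<theta> p X c" if c: "-1 < c" "c < 0" for c :: real
  proof -
    \<comment> \<open>Since \<open>c > -1\<close>, this satisfies \<open>2 * b < 1\<close>, which is
      at most the dimension.\<close>
    define b where "b = - c / 2"
    have b: "b > 0" "2 * b < DIM('a)" unfolding b_def using c \<open>real DIM('a) \<ge> 1\<close> by linarith+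
    have cb: "c = - 2 * b" by (simp add: b_def)
    have e: "- c - DIM('a) = 2 * b - DIM('a)" by (simp add: b_def)
    note R = riesz_potential_ball[OF V b p x]
    have "integrable lborel (\<lambda>y. u y * norm (y - x) powr (- c - DIM('a)))"
      using R(1) unfolding u' e by (simp add: mult_ac)
    then have "continued c = c * (\<integral>y. u y * norm (y - x) powr (- c - DIM('a)) \<partial>lborel)"
      using c \<open>real DIM('a) \<ge> 1\<close> by (intro continued_eq_Riesz_potential[symmetric]) linarith+
    also have "(\<integral>y. u y * norm (y - x) powr (- c - DIM('a)) \<partial>lborel)
        = (\<integral>y. V y * norm (y - x) powr (2 * b - DIM('a)) * max 0 (1 - (norm y)\<^sup>2) powr p \<partial>lborel)"
      unfolding u' e by (simp add: mult_ac)
    finally have cont: "continued c = c * (pi powr (DIM('a) / 2) / (Gamma (DIM('a) / 2 - b) * Gamma b) * V x *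
        (Beta b (p + 1) * (Beta (\<theta> - b) b * hyp2F1 (\<theta> - b) (- p - b) \<theta> X)))"
      unfolding R(2) by (simp add: \<theta>_def X_def)
    have pos: "Gamma b > 0" "Gamma (DIM('a) / 2 - b) > 0" "Gamma \<theta> > 0" "Gamma (b + (p + 1)) > 0"
      using b p \<theta> by (auto intro!: Gamma_real_pos)
    have g1: "Gamma ((c + DIM('a)) / 2) = Gamma (DIM('a) / 2 - b)"
      by (simp add: cb diff_divide_distrib)
    have g2: "rGamma (1 - c / 2) = 1 / (b * Gamma b)"
    proof -
      have "Gamma (b + 1) = b * Gamma b" using b by (intro Gamma_plus1) (auto elim!: nonpos_Ints_cases)
      moreover have "1 - c / 2 = b + 1" by (simp add: cb)
      ultimately show ?thesis by (simp only: rGamma_inverse_Gamma divide_inverse mult_1)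
    qed
    have g3: "2 powr (c - 1) * c = - (b * 2 powr c)"
      by (simp add: powr_diff cb)
    have g4: "rGamma (p + 1 - c / 2) = 1 / Gamma (b + (p + 1))"
    proof -
      have "p + 1 - c / 2 = b + (p + 1)" by (simp add: cb)
      then show ?thesis by (simp only: rGamma_inverse_Gamma divide_inverse mult_1)
    qed
    have g5: "Beta (\<theta> - b) b = Gamma (\<theta> - b) * Gamma b / Gamma \<theta>" by (simp add: Beta_def)
    have g6: "Beta b (p + 1) = Gamma b * Gamma (p + 1) / Gamma (b + (p + 1))" by (simp add: Beta_def)
    have h: "\<theta> + c / 2 = \<theta> - b" "- p + c / 2 = - p - b" by (simp_all add: cb)
    define Hy where "Hy = hyp2F1 (\<theta> - b) (- p - b) \<theta> X"
    \<comment> \<open>The powers of \<open>pi\<close> cancel, and the Gamma factor of the operator's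
      constant cancels the one introduced by subordination.\<close>
    have "- (2 powr (c - 1) * Gamma ((c + DIM('a)) / 2) * rGamma (1 - c / 2) / sqrt (pi ^ DIM('a))) * continued c
        = - (2 powr (c - 1) * c) * (Gamma (DIM('a) / 2 - b) * (1 / (b * Gamma b)) *
          (1 / (Gamma (DIM('a) / 2 - b) * Gamma b) * V x * (Beta b (p + 1) * (Beta (\<theta> - b) b * Hy))))"
      unfolding cont g1 g2 sqrt_pi_power Hy_def[symmetric] by (simp add: field_simps)
    also have "\<dots> = V x * (2 powr c * Gamma (p + 1) * Gamma (\<theta> - b) / Gamma \<theta> * (1 / Gamma (b + (p + 1))) * Hy)"
    proof -
      \<comment> \<open>The remaining cancellation: the two Beta functions provide two factors
        \<open>Gamma b\<close>, which meet the one from the potential and the one from the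
        operator's constant.\<close>
      have alg: "- (- (b * z)) * (M * (1 / (b * A)) * (1 / (M * A) * v * (A * P / Q * (N * A / T * Hy))))
          = v * (z * P * N / T * (1 / Q) * Hy)"
        if "A \<noteq> 0" "M \<noteq> 0" "T \<noteq> 0" "Q \<noteq> 0" for z M A v P Q N T :: real
        using that b by (simp add: field_simps)
      show ?thesis unfolding g3 g5 g6 by (rule alg) (use pos in auto)
    qed
    also have "\<dots> = V x * closed_form \<theta> p X c"
      unfolding closed_form_def h g4 Hy_def ..
    finally show ?thesis .
  qed
  have "frac_lap_const DIM('a) a * (- continued a / a)
      = - (2 powr (a - 1) * Gamma ((a + DIM('a)) / 2) * rGamma (1 - a / 2) / sqrt (pi ^ DIM('a))) * continued a"
  proof -
    \<comment> \<open>Here the factor \<open>a\<close> of \<open>frac_lap_const\<close> cancels the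
      denominator of the principal value.\<close>
    have alg: "q * a * g / (s * G) * (- c / a) = - (q * g * inverse G / s) * c" for q g s G c :: real
      using a by (cases "G = 0"; cases "s = 0") (simp_all add: field_simps)
    show ?thesis unfolding frac_lap_const_def rGamma_inverse_Gamma by (rule alg)
  qed
  also have "\<dots> = V x * closed_form \<theta> p X a"
    by (rule continued_eq_closed_form[OF \<theta> X neg a])
  finally show ?thesis
    using has_principal_value_frac_lap_integrand[OF a] unfolding \<theta>_def X_def by blast
qed

theorem lemma2p4:
  fixes V u \<alpha> :: "'a::euclidean_space \<Rightarrow> real"
    and l :: nat and p \<theta> :: real
  assumes "solid_harmonic l V"
    and "\<theta> = real DIM('a) / 2 + real l"
    and "p > -1"
    and "u = (\<lambda>x. V x * (if norm x < 1 then (1 - (norm x)\<^sup>2) powr p else 0))"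
    and "\<forall>x. 0 < \<alpha> x \<and> \<alpha> x \<le> 2"
    and "holder_continuous \<alpha>"
    and "(INF x. \<alpha> x) > 0"
  shows "\<forall>x. norm x < 1 \<longrightarrow>
    var_laplacian_exists \<alpha> u x \<and>
    var_laplacian \<alpha> u x =
      2 powr \<alpha> x * Gamma (p + 1) * Gamma (\<theta> + \<alpha> x / 2) / Gamma \<theta> * rGamma (p + 1 - \<alpha> x / 2)
        * V x * hyp2F1 (\<theta> + \<alpha> x / 2) (- p + \<alpha> x / 2) \<theta> ((norm x)\<^sup>2)"
proof (intro allI impI)
  fix x :: 'a assume x: "norm x < 1"
  have "var_laplacian_exists \<alpha> u x \<and> var_laplacian \<alpha> u x = V x * closed_form \<theta> p ((norm x)\<^sup>2) (\<alpha> x)"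
  proof (cases "\<alpha> x = 2")
    case True
    have V: "monomial_sum V" and hom: "\<And>c x. V (c *\<^sub>R x) = c ^ l * V x" and harm: "laplacian V x = 0"
      using assms(1) by (auto simp: solid_harmonic_def intro: real_polynomial_function_monomial_sum)
    have "(norm x)\<^sup>2 < 1" using x by (simp add: power_less_one_iff)
    moreover have "\<theta> > 0" using DIM_positive[where 'a = 'a] by (simp add: assms(2) add_pos_nonneg)
    ultimately have "closed_form \<theta> p ((norm x)\<^sup>2) 2 = 4 * p * (\<theta> * (1 - (norm x)\<^sup>2) powr (p - 1)
        - (p - 1) * (norm x)\<^sup>2 * (1 - (norm x)\<^sup>2) powr (p - 2))"
      using assms(3) by (intro closed_form_two) auto
    then show ?thesis
      using True laplacian_ball_profile[OF V assms(4) x hom harm]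
      by (simp add: var_laplacian_exists_def var_laplacian_def assms(2))
  next
    case False
    then have a: "0 < \<alpha> x" "\<alpha> x < 2" using assms(5) by (auto simp: less_le)
    from fractional_laplacian_ball_profile[OF assms(1,3) x a assms(4)]
    obtain I where "has_principal_value (frac_lap_integrand (\<alpha> x) u x) x I"
      "frac_lap_const DIM('a) (\<alpha> x) * I = V x * closed_form \<theta> p ((norm x)\<^sup>2) (\<alpha> x)"
      unfolding assms(2) by blast
    \<comment> \<open>Because the limit is known to exist, the total function
      \<open>principal_value\<close> takes the genuine value \<open>I\<close>.\<close>
    then show ?thesis
      using False by (auto simp: var_laplacian_exists_def var_laplacian_def principal_value_eqI)
  qed
  then show "var_laplacian_exists \<alpha> u x \<and>
    var_laplacian \<alpha> u x =
      2 powr \<alpha> x * Gamma (p + 1) * Gamma (\<theta> + \<alpha> x / 2) / Gamma \<theta> * rGamma (p + 1 - \<alpha> x / 2)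
        * V x * hyp2F1 (\<theta> + \<alpha> x / 2) (- p + \<alpha> x / 2) \<theta> ((norm x)\<^sup>2)"
    by (simp add: closed_form_def mult_ac)
qed

end
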